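(* Let $\beta_\mu$ be the magnetic two-form on the space of configurations $(\mathbf{x}_1,\dots,\mathbf{x}_N;g)\in\mathbb{R}^{2N}\times SE(2)$ associated with $N$ point vortices of strengths $\Gamma_1,\dots,\Gamma_N$ and a circular rigid body of radius $R$ (see context). Then for all $\mathbf{v}_i,\mathbf{w}_i\in T_{\mathbf{x}_i}\mathbb{R}^2$ and $\dot g_1,\dot g_2\in T_gSE(2)$, $$\beta_\mu(\mathbf{x}_1,\dots,\mathbf{x}_N;g)\big((\mathbf{v}_1,\dots,\mathbf{v}_N,\dot g_1),(\mathbf{w}_1,\dots,\mathbf{w}_N,\dot g_2)\big)=\sum_{i=1}^N\Gamma_i\Big(-d\mathbf{x}(\mathbf{v}_i,\mathbf{w}_i)-\mathbf{d}\Theta(g,\mathbf{x}_i)\big((\dot g_1,\mathbf{v}_i),(\dot g_2,\mathbf{w}_i)\big)\Big),$$ where $d\mathbf{x}=dx\wedge dy$ and $\Theta$ is the one-form $$\Theta(g,\mathbf{x})(\dot g,\mathbf{v})=\Psi'_x(g,\mathbf{x})\,dx_0(\dot g)+\Psi'_y(g,\mathbf{x})\,dy_0(\dot g)+\Psi'_\omega(g,\mathbf{x})\,d\beta(\dot g).$$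
   Context: Body and fluid. $\mathcal{B}_0\subset\mathbb{R}^2$ is the closed disc of radius $R$ centred at the origin, $\mathcal{F}_0$ is the closure of $\mathbb{R}^2\setminus\mathcal{B}_0$ and $\eta_0$ its Euclidean area form. An element $g\in SE(2)$ is given by an angle $\beta$ and a vector $\mathbf{x}_0=(x_0,y_0)$ and acts by $\mathbf{x}\mapsto R_\beta\mathbf{x}+\mathbf{x}_0$ ($R_\beta$ the rotation by $\beta$); $(x_0,y_0,\beta)$ are coordinates on $SE(2)$. $Q$ is the (formal infinite-dimensional) manifold of pairs $(g,\varphi)$, $g\in SE(2)$, $\varphi:\mathcal{F}_0\to\mathbb{R}^2$ an embedding with $\varphi^*(dx\wedge dy)=\eta_0$, tending to the identity suitably fast at infinity, and $\varphi(\partial\mathcal{F}_0)=g(\partial\mathcal{B}_0)$. Put $\mathcal{F}=\varphi(\mathcal{F}_0)$. The group $\mathrm{Diff}_{\mathrm{vol}}(\mathcal{F}_0)$ of area-preserving diffeomorphisms acts on the right by $(g,\varphi)\cdot\phi=(g,\varphi\circ\phi)$; its Lie algebra $\mathfrak{X}_{\mathrm{vol}}$ consists of the divergence-free vector fields on $\mathcal{F}_0$ tangent to $\partial\mathcal{F}_0$. Neumann connection. For $(\dot g,\dot\varphi)\in T_{(g,\varphi)}Q$ with $\dot g=(\dot\beta,\dot{\mathbf{x}}_0)$ let $\mathbf{u}=\dot\varphi\circ\varphi^{-1}$ and let $\Phi$ be the solution of $\nabla^2\Phi=0$ in $\mathcal{F}$, $\partial\Phi/\partial n=(\dot\beta\,\mathbf{e}_3\times(\mathbf{x}-\mathbf{x}_0)+\dot{\mathbf{x}}_0)\cdot\mathbf{n}$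 on $\partial\mathcal{F}$, $\Phi\to0$ at infinity. Write $\mathbf{u}=\nabla\Phi+\mathbf{u}_{\mathrm v}$ (Helmholtz-Hodge decomposition; $\mathbf{u}_{\mathrm v}$ is divergence free and tangent to $\partial\mathcal{F}$). The Neumann connection one-form is $\mathcal{A}_{(g,\varphi)}(\dot g,\dot\varphi)=\varphi^*\mathbf{u}_{\mathrm v}\in\mathfrak{X}_{\mathrm{vol}}$. Vorticity. $\mathfrak{X}_{\mathrm{vol}}^*=\Omega^1(\mathcal{F}_0)/\mathbf{d}\Omega^0(\mathcal{F}_0)$ with pairing $\langle[\alpha],\mathbf{u}\rangle=\int_{\mathcal{F}_0}\alpha(\mathbf{u})\,\eta_0$. The momentum value $\mu$ is the class $[\alpha]$ with $\mathbf{d}\alpha=\sum_{i=1}^N\Gamma_i\,\delta(\bar{\mathbf{x}}-\bar{\mathbf{x}}_i)\,d\bar x\wedge d\bar y$ (distinct reference points $\bar{\mathbf{x}}_i$ in the interior of $\mathcal{F}_0$) and zero circulation $\oint_{\partial\mathcal{F}_0}\alpha=0$. Magnetic two-form. The one-form $\alpha_\mu=\langle\mu,\mathcal{A}\rangle$ on $Q$ has differential $\mathbf{d}\alpha_\mu$ which descends along $(g,\varphi)\mapsto(\varphi(\bar{\mathbf{x}}_1),\dots,\varphi(\bar{\mathbf{x}}_N);g)$ to a two-form $\beta_\mu$ on $\mathbb{R}^{2N}\times SE(2)$; here $\mathbb{R}^{2N}\times SE(2)$ stands for the configurations in which the $\mathbf{x}_i$ are distinct points in the fluid region outside the disc $g(\mathcal{B}_0)$.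 Stream functions. By linearity $\Phi=\dot x_0\Phi_x+\dot y_0\Phi_y+\dot\beta\,\Phi_\omega$, and $\Psi'_x,\Psi'_y,\Psi'_\omega$ are the harmonic conjugates vanishing at infinity, with $\mathbf{i}_{\nabla\Phi_A}(dx\wedge dy)=\mathbf{d}\Psi'_A$ ($g$ fixed). Explicitly, $\Psi'_x=R^2\frac{y-y_0}{(x-x_0)^2+(y-y_0)^2}$, $\Psi'_y=-R^2\frac{x-x_0}{(x-x_0)^2+(y-y_0)^2}$, $\Psi'_\omega=0$. In the claim, $\mathbf{d}\Theta$ is the full exterior derivative on $SE(2)\times\mathbb{R}^2$ (both $g$ and $\mathbf{x}$ vary), with $\mathbf{d}(f\,\mathbf{d}h)=\mathbf{d}f\wedge\mathbf{d}h$ and $(\mathbf{a}\wedge\mathbf{b})(u,v)=\mathbf{a}(u)\mathbf{b}(v)-\mathbf{a}(v)\mathbf{b}(u)$. *)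

theory Defs
  imports "HOL-Analysis.Analysis"
begin

section \<open>Smooth maps and differential forms on Euclidean spaces\<close>

fun iter_deriv :: "'a::euclidean_space list \<Rightarrow> ('a \<Rightarrow> 'b::euclidean_space) \<Rightarrow> 'a \<Rightarrow> 'b" where
  "iter_deriv [] f = f"
| "iter_deriv (d # ds) f = (\<lambda>x. frechet_derivative (iter_deriv ds f) (at x) d)"

text \<open>Smooth means \<open>C\<^sup>\<infinity>\<close>; \<open>smooth_on\<close> is meant for open sets, \<open>smooth_near\<close> for arbitrary ones.
  On a set that is the closure of its interior, all derivatives are determined by the values on
  the set.\<close>

definition smooth_on :: "'a::euclidean_space set \<Rightarrow> ('a \<Rightarrow> 'b::euclidean_space) \<Rightarrow> bool" where
  "smooth_on U f \<longleftrightarrow> (\<forall>ds. \<forall>x\<in>U. iter_deriv ds f differentiable (at x))"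

definition smooth_near :: "'a::euclidean_space set \<Rightarrow> ('a \<Rightarrow> 'b::euclidean_space) \<Rightarrow> bool" where
  "smooth_near S f \<longleftrightarrow> (\<exists>U. open U \<and> S \<subseteq> U \<and> smooth_on U f)"

text \<open>A one-form is a map \<open>\<theta>\<close> with \<open>\<theta> p u\<close> its value at the point \<open>p\<close> on the tangent vector \<open>u\<close>.
  The normalisation is the one of \<open>d(f dh) = df \<and> dh\<close> and
  \<open>(a \<and> b)(u,v) = a(u) b(v) - a(v) b(u)\<close>.\<close>

definition ext_deriv ::
    "('a::euclidean_space \<Rightarrow> 'a \<Rightarrow> real) \<Rightarrow> 'a \<Rightarrow> 'a \<Rightarrow> 'a \<Rightarrow> real" where
  "ext_deriv \<theta> p u v =
     frechet_derivative (\<lambda>q. \<theta> q v) (at p) u - frechet_derivative (\<lambda>q. \<theta> q u) (at p) v"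

text \<open>The area form \<open>dx \<and> dy\<close>.\<close>

definition area_form :: "real^2 \<Rightarrow> real^2 \<Rightarrow> real" where
  "area_form u v = u $ 1 * v $ 2 - u $ 2 * v $ 1"

definition grad :: "(real^2 \<Rightarrow> real) \<Rightarrow> real^2 \<Rightarrow> real^2" where
  "grad f x = (\<chi> i. frechet_derivative f (at x) (axis i 1))"

definition laplacian :: "(real^2 \<Rightarrow> real) \<Rightarrow> real^2 \<Rightarrow> real" where
  "laplacian f x = (\<Sum>i\<in>UNIV. iter_deriv [axis i 1, axis i 1] f x)"

section \<open>Body and fluid\<close>

text \<open>An element of \<open>SE(2)\<close> is written in the coordinates \<open>(\<beta>, \<^bold>x\<^sub>0)\<close>, the angle being a real number
  (so this is the universal cover, on which forms have the same coordinate expressions as on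
  \<open>SE(2)\<close>); tangent vectors are written \<open>(d\<beta>, d\<^bold>x\<^sub>0)\<close>.\<close>

type_synonym se2 = "real \<times> (real^2)"

definition se2_act :: "se2 \<Rightarrow> real^2 \<Rightarrow> real^2" where
  "se2_act g x =
     vector [cos (fst g) * x $ 1 - sin (fst g) * x $ 2,
             sin (fst g) * x $ 1 + cos (fst g) * x $ 2] + snd g"

definition body :: "real \<Rightarrow> (real^2) set" where
  "body R = cball 0 R"

definition fluid :: "real \<Rightarrow> (real^2) set" where
  "fluid R = closure (- body R)"

text \<open>Decay of order \<open>|x|\<^sup>-\<^sup>2\<close> is the order of \<open>\<nabla>\<Phi>\<close> for the Neumann potentials below, so that
  horizontal motions stay in \<open>Q\<close>, and it makes the pairing with the momentum converge. The
  embedding \<open>\<phi>\<close> is a total function, of which only the values on \<open>fluid R\<close> matter.\<close>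

definition Qspace :: "real \<Rightarrow> (se2 \<times> (real^2 \<Rightarrow> real^2)) set" where
  "Qspace R = {(g, \<phi>).
     smooth_near (fluid R) \<phi> \<and>
     inj_on \<phi> (fluid R) \<and>
     (\<forall>x\<in>fluid R. \<forall>a b.
        area_form (frechet_derivative \<phi> (at x) a) (frechet_derivative \<phi> (at x) b) = area_form a b) \<and>
     (\<forall>ds. \<exists>C. \<forall>x\<in>fluid R. norm (iter_deriv ds (\<lambda>x. \<phi> x - x) x) * (norm x)\<^sup>2 \<le> C) \<and>
     \<phi> ` frontier (fluid R) = se2_act g ` frontier (body R)}"

section \<open>Neumann potentials, stream functions and the Neumann connection\<close>

definition rigid_velocity :: "se2 \<Rightarrow> se2 \<Rightarrow> real^2 \<Rightarrow> real^2" where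
  "rigid_velocity g gd x =
     fst gd *\<^sub>R vector [- (x - snd g) $ 2, (x - snd g) $ 1] + snd gd"

text \<open>\<open>F\<close> is the region outside the disc \<open>g(\<B>\<^sub>0)\<close>, whose unit normal at \<open>x\<close> is \<open>sgn (x - \<^bold>x\<^sub>0)\<close>.\<close>

definition is_neumann_potential ::
    "(real^2) set \<Rightarrow> se2 \<Rightarrow> se2 \<Rightarrow> (real^2 \<Rightarrow> real) \<Rightarrow> bool" where
  "is_neumann_potential F g gd \<Phi> \<longleftrightarrow>
     smooth_near F \<Phi> \<and>
     (\<forall>x\<in>interior F. laplacian \<Phi> x = 0) \<and>
     (\<forall>x\<in>frontier F. grad \<Phi> x \<bullet> sgn (x - snd g) = rigid_velocity g gd x \<bullet> sgn (x - snd g)) \<and>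
     (\<Phi> \<longlongrightarrow> 0) at_infinity"

text \<open>The potential is unique on \<open>F\<close>, and only its values and derivatives there are used. The same
  holds for the stream function below.\<close>

definition neumann_potential :: "(real^2) set \<Rightarrow> se2 \<Rightarrow> se2 \<Rightarrow> real^2 \<Rightarrow> real" where
  "neumann_potential F g gd = (SOME \<Phi>. is_neumann_potential F g gd \<Phi>)"

definition is_stream_function ::
    "(real^2) set \<Rightarrow> (real^2 \<Rightarrow> real^2) \<Rightarrow> (real^2 \<Rightarrow> real) \<Rightarrow> bool" where
  "is_stream_function F u \<Psi> \<longleftrightarrow>
     smooth_near F \<Psi> \<and>
     (\<forall>x\<in>F. \<forall>w. frechet_derivative \<Psi> (at x) w = area_form (u x) w) \<and>
     (\<Psi> \<longlongrightarrow> 0) at_infinity"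

text \<open>\<open>stream R gd g\<close> is the harmonic conjugate of the potential of the unit motion \<open>gd\<close> of the
  body at \<open>g\<close>.\<close>

definition stream :: "real \<Rightarrow> se2 \<Rightarrow> se2 \<Rightarrow> real^2 \<Rightarrow> real" where
  "stream R gd g =
     (let F = closure (- se2_act g ` body R)
      in SOME \<Psi>. is_stream_function F (grad (neumann_potential F g gd)) \<Psi>)"

definition Psi_x :: "real \<Rightarrow> se2 \<Rightarrow> real^2 \<Rightarrow> real" where
  "Psi_x R = stream R (0, axis 1 1)"

definition Psi_y :: "real \<Rightarrow> se2 \<Rightarrow> real^2 \<Rightarrow> real" where
  "Psi_y R = stream R (0, axis 2 1)"

definition Psi_omega :: "real \<Rightarrow> se2 \<Rightarrow> real^2 \<Rightarrow> real" where
  "Psi_omega R = stream R (1, 0)"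

definition Theta :: "real \<Rightarrow> se2 \<times> (real^2) \<Rightarrow> se2 \<times> (real^2) \<Rightarrow> real" where
  "Theta R = (\<lambda>(g, x) (gd, v).
     Psi_x R g x * snd gd $ 1 + Psi_y R g x * snd gd $ 2 + Psi_omega R g x * fst gd)"

text \<open>The value at \<open>x\<close> of \<open>\<phi>\<^sup>* \<^bold>u\<^sub>v\<close>, where \<open>\<^bold>u\<^sub>v = \<^bold>u - \<nabla>\<Phi>\<close>.\<close>

definition connection ::
    "real \<Rightarrow> se2 \<times> (real^2 \<Rightarrow> real^2) \<Rightarrow> se2 \<times> (real^2 \<Rightarrow> real^2) \<Rightarrow> real^2 \<Rightarrow> real^2" where
  "connection R = (\<lambda>(g, \<phi>) (gd, \<phi>d) x.
     let F = \<phi> ` fluid R;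
         u = (\<lambda>y. \<phi>d (inv_into (fluid R) \<phi> y));
         uv = (\<lambda>y. u y - grad (neumann_potential F g gd) y)
     in inv (frechet_derivative \<phi> (at x)) (uv (\<phi> x)))"

section \<open>Vorticity\<close>

text \<open>The one-form \<open>\<alpha>\<^sub>1 dx + \<alpha>\<^sub>2 dy\<close> is given by its coefficient field. It represents the momentum
  value \<open>\<mu>\<close> of \<open>N = CARD('n)\<close> point vortices at the reference points \<open>xb $ i\<close>: it is smooth off
  these points and locally integrable, \<open>d\<alpha>\<close> is the given sum of delta distributions in the
  interior (as \<open>\<integral> f d\<alpha> = \<integral> \<alpha> \<and> df\<close> for test functions \<open>f\<close>), and it has no circulation around
  the body. The bound at infinity, satisfied by the usual vortex fields, makes the pairing
  converge and independent of the representative.\<close>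

definition represents_momentum ::
    "real \<Rightarrow> real^'n \<Rightarrow> (real^2)^'n \<Rightarrow> (real^2 \<Rightarrow> real^2) \<Rightarrow> bool" where
  "represents_momentum R \<Gamma> xb \<alpha> \<longleftrightarrow>
     smooth_near (fluid R - range (($) xb)) \<alpha> \<and>
     (\<forall>K. compact K \<and> K \<subseteq> fluid R \<longrightarrow> set_integrable lborel K \<alpha>) \<and>
     (\<exists>C r. \<forall>x. norm x \<ge> r \<longrightarrow> norm (\<alpha> x) * norm x \<le> C) \<and>
     (\<forall>f. smooth_on UNIV f \<and> (\<exists>K. compact K \<and> K \<subseteq> interior (fluid R) \<and> (\<forall>x. x \<notin> K \<longrightarrow> f x = 0)) \<longrightarrow>
        (LINT x:fluid R|lborel. area_form (\<alpha> x) (grad f x)) = (\<Sum>i\<in>UNIV. \<Gamma> $ i * f (xb $ i))) \<and>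
     integral {0..2 * pi} (\<lambda>t. \<alpha> (vector [R * cos t, R * sin t]) \<bullet> vector [- R * sin t, R * cos t]) = 0"

definition pairing :: "real \<Rightarrow> (real^2 \<Rightarrow> real^2) \<Rightarrow> (real^2 \<Rightarrow> real^2) \<Rightarrow> real" where
  "pairing R \<alpha> u = (LINT x:fluid R|lborel. \<alpha> x \<bullet> u x)"

section \<open>The magnetic two-form\<close>

definition momentum_form ::
    "real \<Rightarrow> (real^2 \<Rightarrow> real^2) \<Rightarrow>
     se2 \<times> (real^2 \<Rightarrow> real^2) \<Rightarrow> se2 \<times> (real^2 \<Rightarrow> real^2) \<Rightarrow> real" where
  "momentum_form R \<alpha> q qd = pairing R \<alpha> (connection R q qd)"

text \<open>Calculus on \<open>Q\<close> is done by means of smooth two-parameter families: for a one-form \<open>a\<close> on \<open>Q\<close>,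
  \<open>da\<close> is determined by \<open>q\<^sup>*(da) = d(q\<^sup>*a)\<close> for all smooth families \<open>q\<close> in \<open>Q\<close>.\<close>

definition smooth_family ::
    "real \<Rightarrow> (real \<times> real \<Rightarrow> se2 \<times> (real^2 \<Rightarrow> real^2)) \<Rightarrow> bool" where
  "smooth_family R q \<longleftrightarrow>
     (\<forall>p. q p \<in> Qspace R) \<and>
     smooth_on UNIV (\<lambda>p. fst (q p)) \<and>
     smooth_near (UNIV \<times> fluid R) (\<lambda>(p, x). snd (q p) x) \<and>
     (\<forall>ds K. compact K \<longrightarrow> (\<exists>C. \<forall>p\<in>K. \<forall>x\<in>fluid R.
        norm (iter_deriv ds (\<lambda>(p, x). snd (q p) x - x) (p, x)) * (norm x)\<^sup>2 \<le> C))"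

definition family_velocity ::
    "(real \<times> real \<Rightarrow> se2 \<times> (real^2 \<Rightarrow> real^2)) \<Rightarrow> real \<times> real \<Rightarrow> real \<times> real \<Rightarrow>
     se2 \<times> (real^2 \<Rightarrow> real^2)" where
  "family_velocity q p h =
     (frechet_derivative (\<lambda>p. fst (q p)) (at p) h,
      \<lambda>x. frechet_derivative (\<lambda>p. snd (q p) x) (at p) h)"

definition pullback ::
    "(real \<times> real \<Rightarrow> se2 \<times> (real^2 \<Rightarrow> real^2)) \<Rightarrow>
     (se2 \<times> (real^2 \<Rightarrow> real^2) \<Rightarrow> se2 \<times> (real^2 \<Rightarrow> real^2) \<Rightarrow> real) \<Rightarrow>
     real \<times> real \<Rightarrow> real \<times> real \<Rightarrow> real" where
  "pullback q a p h = a (q p) (family_velocity q p h)"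

definition vortex_proj ::
    "(real^2)^'n \<Rightarrow> se2 \<times> (real^2 \<Rightarrow> real^2) \<Rightarrow> ((real^2)^'n) \<times> se2" where
  "vortex_proj xb q = (\<chi> i. snd q (xb $ i), fst q)"

definition configurations :: "real \<Rightarrow> (((real^2)^'n) \<times> se2) set" where
  "configurations R =
     {(x, g). inj (($) x) \<and> (\<forall>i. x $ i \<notin> se2_act g ` body R)}"

text \<open>The families tangent at \<open>0\<close> to lifts of \<open>V\<close> and \<open>W\<close>.\<close>

definition lifts ::
    "real \<Rightarrow> (real^2)^'n \<Rightarrow> ((real^2)^'n) \<times> se2 \<Rightarrow> ((real^2)^'n) \<times> se2 \<Rightarrow> ((real^2)^'n) \<times> se2 \<Rightarrow>
     (real \<times> real \<Rightarrow> se2 \<times> (real^2 \<Rightarrow> real^2)) set" where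
  "lifts R xb c V W =
     {q. smooth_family R q \<and> vortex_proj xb (q 0) = c \<and>
         frechet_derivative (\<lambda>p. vortex_proj xb (q p)) (at 0) (1, 0) = V \<and>
         frechet_derivative (\<lambda>p. vortex_proj xb (q p)) (at 0) (0, 1) = W}"

text \<open>The two-form \<open>\<beta>\<^sub>\<mu>\<close> to which \<open>d\<alpha>\<^sub>\<mu>\<close> descends: \<open>\<beta>\<^sub>\<mu>(V,W)\<close> is the common value of \<open>d\<alpha>\<^sub>\<mu>\<close> on
  all lifts of \<open>V\<close> and \<open>W\<close>.\<close>

definition magnetic_form ::
    "real \<Rightarrow> (real^2)^'n \<Rightarrow> (real^2 \<Rightarrow> real^2) \<Rightarrow>
     ((real^2)^'n) \<times> se2 \<Rightarrow> ((real^2)^'n) \<times> se2 \<Rightarrow> ((real^2)^'n) \<times> se2 \<Rightarrow> real" where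
  "magnetic_form R xb \<alpha> c V W =
     (THE b. \<forall>q\<in>lifts R xb c V W.
        ext_deriv (pullback q (momentum_form R \<alpha>)) 0 (1, 0) (0, 1) = b)"

end

theory Submission
  imports Defs
begin

text \<open>The connection one-form is a Hamiltonian vector field, which turns the momentum one-form into
  a function of the particle positions. Let \<open>q p = (g\<^sub>p, \<phi>\<^sub>p)\<close> be a smooth
  two-parameter family in the configuration space and \<open>h\<close> a direction in the parameter plane. The
  field \<open>A\<^sub>h = \<phi>\<^sub>p\<^sup>* \<^bold>u\<^sub>v\<close> is divergence free and tangent to
  the circle, and it decays like \<open>|x|\<^sup>-\<^sup>2\<close>; hence the contraction of the area form with
  \<open>A\<^sub>h\<close> is \<open>da\<^sub>h\<close> for a function \<open>a\<^sub>h\<close> that vanishes at infinity and is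
  constant on the circle (\<open>vortical_stream_derivative\<close>, \<open>vortical_stream_const_boundary\<close>). Integrating
  by parts against \<open>\<alpha>\<close>, whose vorticity is a sum of point masses, gives

  \<open>\<langle>\<mu>, A\<^sub>h\<rangle> = (\<Sum>i. \<Gamma>\<^sub>i a\<^sub>h(xb\<^sub>i))\<close>

  (\<open>green_exterior\<close>, \<open>momentum_form_eq\<close>). The boundary term is the constant value of \<open>a\<^sub>h\<close> on the
  circle times the circulation of \<open>\<alpha>\<close>, which is zero, and the term at infinity disappears by
  decay.

  It remains to differentiate with respect to the parameters at a fixed particle \<open>x\<close>. The function is a
  difference \<open>a\<^sub>h = b\<^sub>h - \<psi>\<^sub>h\<close> of the stream functions of the whole
  velocity and of its potential part. The first one is a primitive of the closed form
  \<open>w \<mapsto> area_form (\<partial>\<^sub>h \<phi>) (D\<phi> w)\<close>, obtained by integration along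
  rays from infinity. Its curl in the parameters is the Hamiltonian of a commutator,
  \<open>\<partial>\<^sub>1 b\<^sub>2 - \<partial>\<^sub>2 b\<^sub>1 = - area_form (\<partial>\<^sub>1 \<phi>) (\<partial>\<^sub>2 \<phi>)\<close>
  (\<open>flow_stream_curl\<close>). This is the term \<open>- d\<^bold>x\<close>.

  The second one is the harmonic conjugate of the Neumann potential, evaluated at
  \<open>\<phi>\<^sub>p(x)\<close>. It is linear in the velocity of the body, so \<open>\<psi>\<close> is the pull-back
  of \<open>\<Theta>\<close> along \<open>p \<mapsto> (g\<^sub>p, \<phi>\<^sub>p(x))\<close>, and its curl is the pull-back of
  \<open>d\<Theta>\<close> (\<open>potential_stream_curl\<close>). For a disc the potentials are dipole fields; as the potential
  and its conjugate are specified by their properties, this uses that the exterior Neumann problem and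
  the stream function have unique solutions (\<open>grad_neumann_potential\<close>, \<open>stream_eq\<close>).

  Together these facts compute \<open>d\<alpha>\<^sub>\<mu>\<close> on a pair of tangent vectors, and the
  result depends on the tangent vectors only through their projections. So all lifts of a given pair
  give the same value. For this common value to be the magnetic form a lift has to exist
  (\<open>lifts_nonempty\<close>), that is, a family of area-preserving embeddings carrying the reference points
  and the body through prescribed positions with prescribed velocities. Such families are composed
  of twists, which rotate every circle about a centre by an angle depending on the radius.\<close>

section \<open>Smooth maps between Euclidean spaces\<close>

lemma frechet_derivative_cong_open:
  assumes "open U" "x \<in> U" "\<And>y. y \<in> U \<Longrightarrow> f y = g y"
  shows "frechet_derivative f (at x) = frechet_derivative g (at x)"
proof -
  have "(f has_derivative D) (at x) \<longleftrightarrow> (g has_derivative D) (at x)" for D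
    using assms by (metis has_derivative_transform_within_open)
  then show ?thesis unfolding frechet_derivative_def by simp
qed

lemma iter_deriv_cong_open:
  assumes "open U" "\<And>y. y \<in> U \<Longrightarrow> f y = g y" "x \<in> U"
  shows "iter_deriv ds f x = iter_deriv ds g x"
  using assms(3)
proof (induction ds arbitrary: x)
  case (Cons d ds)
  then show ?case
    using frechet_derivative_cong_open[OF assms(1) Cons.prems, of "iter_deriv ds f" "iter_deriv ds g"] by simp
qed (use assms in auto)

lemma differentiable_cong_open:
  assumes "open U" "x \<in> U" "\<And>y. y \<in> U \<Longrightarrow> f y = g y"
  shows "f differentiable (at x) \<longleftrightarrow> g differentiable (at x)"
  using assms unfolding differentiable_def by (metis has_derivative_transform_within_open)

lemma iter_deriv_snoc:
  "iter_deriv (ds @ [d]) f = iter_deriv ds (\<lambda>x. frechet_derivative f (at x) d)"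
  by (induction ds) auto

text \<open>Closure properties of smooth maps are proved by induction on the number of
  derivatives. This needs a notion for finite order. It records differentiability alone, as each
  order makes the derivatives of the previous one continuous.\<close>

definition times_differentiable_on ::
    "nat \<Rightarrow> 'a::euclidean_space set \<Rightarrow> ('a \<Rightarrow> 'b::euclidean_space) \<Rightarrow> bool" where
  "times_differentiable_on n U f \<longleftrightarrow>
     (\<forall>ds. length ds < n \<longrightarrow> (\<forall>x\<in>U. iter_deriv ds f differentiable (at x)))"

lemma smooth_on_iff_times: "smooth_on U f \<longleftrightarrow> (\<forall>n. times_differentiable_on n U f)"
  unfolding smooth_on_def times_differentiable_on_def by blast

lemma times_differentiable_0 [simp]: "times_differentiable_on 0 U f"
  by (simp add: times_differentiable_on_def)

text \<open>The list of directions is extended at its end, which differentiates first: this is the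
  form in which an induction can use the derivative
  \<open>\<lambda>x. frechet_derivative f (at x) d\<close>.\<close>

lemma times_differentiable_Suc:
  "times_differentiable_on (Suc n) U f \<longleftrightarrow>
     (\<forall>x\<in>U. f differentiable (at x)) \<and>
     (\<forall>d. times_differentiable_on n U (\<lambda>x. frechet_derivative f (at x) d))"
proof (intro iffI conjI allI)
  assume L: "times_differentiable_on (Suc n) U f"
  from L show "\<forall>x\<in>U. f differentiable (at x)"
    unfolding times_differentiable_on_def by (auto dest: spec[of _ "[]"])
  fix d
  show "times_differentiable_on n U (\<lambda>x. frechet_derivative f (at x) d)"
    unfolding times_differentiable_on_def
  proof (intro allI impI ballI)
    fix ds :: "'a list" and x assume "length ds < n" "x \<in> U"
    with L have "iter_deriv (ds @ [d]) f differentiable (at x)"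
      unfolding times_differentiable_on_def by (metis Suc_less_eq length_append_singleton)
    then show "iter_deriv ds (\<lambda>x. frechet_derivative f (at x) d) differentiable (at x)"
      by (simp add: iter_deriv_snoc)
  qed
next
  assume R: "(\<forall>x\<in>U. f differentiable (at x)) \<and>
     (\<forall>d. times_differentiable_on n U (\<lambda>x. frechet_derivative f (at x) d))"
  show "times_differentiable_on (Suc n) U f"
    unfolding times_differentiable_on_def
  proof (intro allI impI ballI)
    fix ds :: "'a list" and x assume *: "length ds < Suc n" "x \<in> U"
    show "iter_deriv ds f differentiable (at x)"
    proof (cases ds rule: rev_cases)
      case Nil
      then show ?thesis using R * by simp
    next
      case (snoc es d)
      then show ?thesis using R * unfolding times_differentiable_on_def by (simp add: iter_deriv_snoc)
    qed
  qed
qed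

lemma times_differentiable_cong:
  assumes "open U" "\<And>x. x \<in> U \<Longrightarrow> f x = g x"
  shows "times_differentiable_on n U f \<longleftrightarrow> times_differentiable_on n U g"
proof -
  have "iter_deriv ds f differentiable at x \<longleftrightarrow> iter_deriv ds g differentiable at x" if "x \<in> U" for ds x
    by (rule differentiable_cong_open[OF assms(1) that iter_deriv_cong_open[OF assms]])
  then show ?thesis unfolding times_differentiable_on_def by blast
qed

lemma smooth_on_cong:
  assumes "open U" "\<And>x. x \<in> U \<Longrightarrow> f x = g x"
  shows "smooth_on U f \<longleftrightarrow> smooth_on U g"
  using times_differentiable_cong[OF assms] by (simp add: smooth_on_iff_times)

lemma smooth_on_subset: "smooth_on U f \<Longrightarrow> V \<subseteq> U \<Longrightarrow> smooth_on V f"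
  unfolding smooth_on_def by blast

lemma smooth_on_Un: "smooth_on U f \<Longrightarrow> smooth_on V f \<Longrightarrow> smooth_on (U \<union> V) f"
  unfolding smooth_on_def by blast

lemma times_differentiable_SucD: "times_differentiable_on (Suc n) U f \<Longrightarrow> times_differentiable_on n U f"
  unfolding times_differentiable_on_def by auto

lemma times_differentiable_SucI:
  assumes "open U" "\<And>x. x \<in> U \<Longrightarrow> (f has_derivative f' x) (at x)"
    and "\<And>d. times_differentiable_on n U (\<lambda>x. f' x d)"
  shows "times_differentiable_on (Suc n) U f"
  unfolding times_differentiable_Suc
proof (intro conjI allI ballI)
  show "f differentiable at x" if "x \<in> U" for x using assms(2)[OF that] differentiable_def by blast
  have "frechet_derivative f (at x) = f' x" if "x \<in> U" for x
    using frechet_derivative_at[OF assms(2)[OF that]] by simp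
  then show "times_differentiable_on n U (\<lambda>x. frechet_derivative f (at x) d)" for d
    using assms(3)[of d] times_differentiable_cong[OF assms(1), of "\<lambda>x. frechet_derivative f (at x) d" "\<lambda>x. f' x d"]
    by metis
qed

lemma times_differentiable_has_derivative:
  assumes "times_differentiable_on (Suc n) U f" "x \<in> U"
  shows "(f has_derivative (frechet_derivative f (at x))) (at x)"
  using assms times_differentiable_Suc frechet_derivative_works by blast

lemma times_differentiable_deriv:
  "times_differentiable_on (Suc n) U f \<Longrightarrow> times_differentiable_on n U (\<lambda>x. frechet_derivative f (at x) d)"
  using times_differentiable_Suc by blast

lemma smooth_on_has_derivative:
  "smooth_on U f \<Longrightarrow> x \<in> U \<Longrightarrow> (f has_derivative (frechet_derivative f (at x))) (at x)"
  using times_differentiable_has_derivative smooth_on_iff_times by blast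

lemma smooth_on_deriv: "smooth_on U f \<Longrightarrow> smooth_on U (\<lambda>x. frechet_derivative f (at x) d)"
  using times_differentiable_deriv smooth_on_iff_times by blast

lemma smooth_on_iter_deriv: "smooth_on U f \<Longrightarrow> smooth_on U (iter_deriv ds f)"
  by (induction ds) (auto intro: smooth_on_deriv)

lemma smooth_on_imp_continuous_on: "smooth_on U f \<Longrightarrow> continuous_on U f"
  by (meson continuous_at_imp_continuous_on has_derivative_continuous smooth_on_has_derivative)

lemma smooth_onI_deriv:
  assumes "open U" "\<And>x. x \<in> U \<Longrightarrow> (f has_derivative f' x) (at x)" "\<And>d. smooth_on U (\<lambda>x. f' x d)"
  shows "smooth_on U f"
  unfolding smooth_on_iff_times
proof
  fix n show "times_differentiable_on n U f"
    by (rule times_differentiable_SucD, rule times_differentiable_SucI[OF assms(1,2)])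
       (use assms(3) in \<open>auto simp: smooth_on_iff_times\<close>)
qed

lemma times_differentiable_const: "open U \<Longrightarrow> times_differentiable_on n U (\<lambda>x. c)"
proof (induction n arbitrary: c)
  case (Suc n)
  show ?case by (rule times_differentiable_SucI[OF Suc.prems, of _ "\<lambda>x h. 0"]) (use Suc in auto)
qed simp

lemma times_differentiable_linear:
  assumes "bounded_linear L" "open U" "times_differentiable_on n U f"
  shows "times_differentiable_on n U (\<lambda>x. L (f x))"
  using assms(3)
proof (induction n arbitrary: f)
  case (Suc n)
  show ?case
  proof (rule times_differentiable_SucI[OF assms(2), of _ "\<lambda>x h. L (frechet_derivative f (at x) h)"])
    fix x assume "x \<in> U"
    then show "((\<lambda>x. L (f x)) has_derivative (\<lambda>h. L (frechet_derivative f (at x) h))) (at x)"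
      using bounded_linear.has_derivative[OF assms(1)] times_differentiable_has_derivative[OF Suc.prems] by blast
  qed (use Suc times_differentiable_deriv in blast)
qed simp

lemma times_differentiable_add:
  assumes "open U" "times_differentiable_on n U f" "times_differentiable_on n U g"
  shows "times_differentiable_on n U (\<lambda>x. f x + g x)"
  using assms(2,3)
proof (induction n arbitrary: f g)
  case (Suc n)
  show ?case
    by (rule times_differentiable_SucI[OF assms(1) has_derivative_add])
       (use Suc times_differentiable_has_derivative times_differentiable_deriv in blast)+
qed simp

lemma times_differentiable_sum:
  assumes "open U" "finite I" "\<And>i. i \<in> I \<Longrightarrow> times_differentiable_on n U (f i)"
  shows "times_differentiable_on n U (\<lambda>x. \<Sum>i\<in>I. f i x)"
  using assms(2,3)
  by (induction I rule: finite_induct) (auto intro!: times_differentiable_add times_differentiable_const assms(1))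

lemma times_differentiable_bilinear:
  assumes "bounded_bilinear B" "open U" "times_differentiable_on n U f" "times_differentiable_on n U g"
  shows "times_differentiable_on n U (\<lambda>x. B (f x) (g x))"
  using assms(3,4)
proof (induction n arbitrary: f g)
  case (Suc n)
  show ?case
  proof (rule times_differentiable_SucI[OF assms(2)])
    show "((\<lambda>x. B (f x) (g x)) has_derivative
        (\<lambda>h. B (f x) (frechet_derivative g (at x) h) + B (frechet_derivative f (at x) h) (g x))) (at x)"
      if "x \<in> U" for x
      by (rule bounded_bilinear.FDERIV[OF assms(1)])
        (use times_differentiable_has_derivative that Suc.prems in blast)+
    show "times_differentiable_on n U
        (\<lambda>x. B (f x) (frechet_derivative g (at x) d) + B (frechet_derivative f (at x) d) (g x))" for d
      by (intro times_differentiable_add assms(2)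
            Suc.IH[OF times_differentiable_SucD[OF Suc.prems(1)] times_differentiable_deriv[OF Suc.prems(2)]]
            Suc.IH[OF times_differentiable_deriv[OF Suc.prems(1)] times_differentiable_SucD[OF Suc.prems(2)]])
  qed
qed simp

text \<open>The induction is over the order for all outer functions at once. The chain rule
  expresses the derivative of the composition by a product of a component of the derivative of
  \<open>g\<close> with \<open>\<lambda>x. frechet_derivative f (at (g x)) b\<close>, for
  \<open>b\<close> in a basis, and the latter is again a composition with \<open>g\<close>, of one
  order less.\<close>

lemma times_differentiable_compose:
  assumes "open U" "open V" "times_differentiable_on n U g" "times_differentiable_on n V f"
    and "\<And>x. x \<in> U \<Longrightarrow> g x \<in> V"
  shows "times_differentiable_on n U (\<lambda>x. f (g x))"
  using assms(3,4)
proof (induction n arbitrary: f)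
  case (Suc n)
  let ?D = "\<lambda>x h. frechet_derivative f (at (g x)) (frechet_derivative g (at x) h)"
  show ?case
  proof (rule times_differentiable_SucI[OF assms(1), of _ ?D])
    fix x assume "x \<in> U"
    then show "((\<lambda>x. f (g x)) has_derivative ?D x) (at x)"
      using has_derivative_compose[OF times_differentiable_has_derivative[OF Suc.prems(1)]
          times_differentiable_has_derivative[OF Suc.prems(2)]] assms(5) by blast
  next
    fix d
    \<comment> \<open>expanding in a basis removes the dependence of the direction of the
      outer derivative on \<open>x\<close>\<close>
    have e: "?D x d = (\<Sum>b\<in>Basis. (frechet_derivative g (at x) d \<bullet> b) *\<^sub>R frechet_derivative f (at (g x)) b)"
      if "x \<in> U" for x
    proof -
      have l: "linear (frechet_derivative f (at (g x)))"
        using times_differentiable_has_derivative[OF Suc.prems(2)] assms(5)[OF that] has_derivative_linear by blast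
      show ?thesis
        by (subst euclidean_representation[of "frechet_derivative g (at x) d", symmetric])
           (simp only: linear_sum[OF l] linear_scale[OF l])
    qed
    have "times_differentiable_on n U
       (\<lambda>x. \<Sum>b\<in>Basis. (frechet_derivative g (at x) d \<bullet> b) *\<^sub>R frechet_derivative f (at (g x)) b)"
    proof (rule times_differentiable_sum[OF assms(1) finite_Basis])
      fix b :: 'b
      show "times_differentiable_on n U
         (\<lambda>x. (frechet_derivative g (at x) d \<bullet> b) *\<^sub>R frechet_derivative f (at (g x)) b)"
        by (rule times_differentiable_bilinear[OF bounded_bilinear_scaleR assms(1)
              times_differentiable_linear[OF bounded_linear_inner_left assms(1) times_differentiable_deriv[OF Suc.prems(1)]]
              Suc.IH[OF times_differentiable_SucD[OF Suc.prems(1)] times_differentiable_deriv[OF Suc.prems(2)]]])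
    qed
    then show "times_differentiable_on n U (\<lambda>x. ?D x d)"
      by (subst times_differentiable_cong[OF assms(1) e])
  qed
qed simp

lemma smooth_on_const: "open U \<Longrightarrow> smooth_on U (\<lambda>x. c)"
  by (simp add: smooth_on_iff_times times_differentiable_const)

lemma smooth_on_linear: "bounded_linear L \<Longrightarrow> open U \<Longrightarrow> smooth_on U f \<Longrightarrow> smooth_on U (\<lambda>x. L (f x))"
  by (simp add: smooth_on_iff_times times_differentiable_linear)

lemma smooth_on_id: "open U \<Longrightarrow> smooth_on U (\<lambda>x. x)"
  by (rule smooth_onI_deriv[where f'="\<lambda>x h. h"]) (auto intro: smooth_on_const has_derivative_ident)

lemma smooth_on_add: "open U \<Longrightarrow> smooth_on U f \<Longrightarrow> smooth_on U g \<Longrightarrow> smooth_on U (\<lambda>x. f x + g x)"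
  by (simp add: smooth_on_iff_times times_differentiable_add)

lemma smooth_on_sum:
  "open U \<Longrightarrow> finite I \<Longrightarrow> (\<And>i. i \<in> I \<Longrightarrow> smooth_on U (f i)) \<Longrightarrow> smooth_on U (\<lambda>x. \<Sum>i\<in>I. f i x)"
  by (simp add: smooth_on_iff_times times_differentiable_sum)

lemma smooth_on_bilinear:
  "bounded_bilinear B \<Longrightarrow> open U \<Longrightarrow> smooth_on U f \<Longrightarrow> smooth_on U g \<Longrightarrow> smooth_on U (\<lambda>x. B (f x) (g x))"
  by (simp add: smooth_on_iff_times times_differentiable_bilinear)

lemma smooth_on_compose:
  "open U \<Longrightarrow> open V \<Longrightarrow> smooth_on V f \<Longrightarrow> smooth_on U g \<Longrightarrow> (\<And>x. x \<in> U \<Longrightarrow> g x \<in> V) \<Longrightarrow>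
   smooth_on U (\<lambda>x. f (g x))"
  unfolding smooth_on_iff_times using times_differentiable_compose by blast

lemmas smooth_on_compose_UNIV = smooth_on_compose[OF _ open_UNIV _ _ UNIV_I]

lemma smooth_on_uminus: "open U \<Longrightarrow> smooth_on U f \<Longrightarrow> smooth_on U (\<lambda>x. - f x)"
  by (rule smooth_on_linear[OF bounded_linear_minus[OF bounded_linear_ident]])

lemma smooth_on_diff: "open U \<Longrightarrow> smooth_on U f \<Longrightarrow> smooth_on U g \<Longrightarrow> smooth_on U (\<lambda>x. f x - g x)"
  using smooth_on_add[OF _ _ smooth_on_uminus, of U f g] by simp

lemma smooth_on_Pair:
  fixes f :: "'a::euclidean_space \<Rightarrow> 'b::euclidean_space" and g :: "'a \<Rightarrow> 'c::euclidean_space"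
  assumes "open U" "smooth_on U f" "smooth_on U g"
  shows "smooth_on U (\<lambda>x. (f x, g x))"
proof -
  have "bounded_linear (\<lambda>x::'b. (x, 0::'c))" "bounded_linear (\<lambda>x::'c. (0::'b, x))"
    by (auto intro!: bounded_linear_Pair bounded_linear_ident bounded_linear_zero)
  from smooth_on_add[OF assms(1) smooth_on_linear[OF this(1) assms(1,2)] smooth_on_linear[OF this(2) assms(1,3)]]
  show ?thesis by simp
qed

lemmas smooth_on_fst = smooth_on_linear[OF bounded_linear_fst]
lemmas smooth_on_snd = smooth_on_linear[OF bounded_linear_snd]
lemmas smooth_on_nth = smooth_on_linear[OF bounded_linear_vec_nth]
lemmas smooth_on_mult = smooth_on_bilinear[OF bounded_bilinear_mult]
lemmas smooth_on_scaleR = smooth_on_bilinear[OF bounded_bilinear_scaleR]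
lemmas smooth_on_inner = smooth_on_bilinear[OF bounded_bilinear_inner]

lemma vector2_eq_axis: "(vector [a, b] :: real^2) = a *\<^sub>R axis 1 1 + b *\<^sub>R axis 2 1"
  by (simp add: vec_eq_iff forall_2 axis_def)

lemma smooth_on_vector2:
  assumes "open U" "smooth_on U f" "smooth_on U g"
  shows "smooth_on U (\<lambda>x. vector [f x, g x] :: real^2)"
  unfolding vector2_eq_axis by (intro smooth_on_add smooth_on_scaleR smooth_on_const assms)

lemma smooth_on_inverse:
  fixes f :: "'a::euclidean_space \<Rightarrow> real"
  assumes "open U" "smooth_on U f" "\<And>x. x \<in> U \<Longrightarrow> f x \<noteq> 0"
  shows "smooth_on U (\<lambda>x. inverse (f x))"
proof (rule smooth_on_compose[OF assms(1) _ _ assms(2), of "-{0}"])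
  have o: "open (- {0::real})" by auto
  show "open (- {0::real})" by auto
  have "times_differentiable_on n (-{0}) (inverse :: real \<Rightarrow> real)" for n
  proof (induction n)
    case (Suc n)
    show ?case
    proof (rule times_differentiable_SucI[OF o, where f'="\<lambda>x h. - (inverse x * h * inverse x)"])
      fix x :: real assume "x \<in> - {0}"
      then show "(inverse has_derivative (\<lambda>h. - (inverse x * h * inverse x))) (at x)"
        by (intro has_derivative_inverse') auto
    next
      fix d :: real
      have "times_differentiable_on n (-{0}) (\<lambda>x::real. (- d) * (inverse x * inverse x))"
        by (intro times_differentiable_bilinear[OF bounded_bilinear_mult o] times_differentiable_const o Suc)
      then show "times_differentiable_on n (-{0}) (\<lambda>x::real. - (inverse x * d * inverse x))"
        by (simp add: algebra_simps)
    qed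
  qed simp
  then show "smooth_on (-{0}) (inverse :: real \<Rightarrow> real)" by (simp add: smooth_on_iff_times)
qed (use assms in auto)

lemma smooth_on_divide:
  fixes f g :: "'a::euclidean_space \<Rightarrow> real"
  assumes "open U" "smooth_on U f" "smooth_on U g" "\<And>x. x \<in> U \<Longrightarrow> g x \<noteq> 0"
  shows "smooth_on U (\<lambda>x. f x / g x)"
  unfolding divide_inverse by (intro smooth_on_mult smooth_on_inverse assms)

text \<open>Linear combinations of both functions are closed under differentiation, so the
  induction is for all of them together.\<close>

lemma smooth_sin_cos: "smooth_on UNIV (sin :: real \<Rightarrow> real)" "smooth_on UNIV (cos :: real \<Rightarrow> real)"
proof -
  have "times_differentiable_on n UNIV (\<lambda>x::real. a * sin x + b * cos x)" for n a b
  proof (induction n arbitrary: a b)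
    case (Suc n)
    show ?case
    proof (rule times_differentiable_SucI[where f'="\<lambda>x h. ((-b*h) * sin x + (a*h) * cos x)"])
      fix x :: real
      show "((\<lambda>x. a * sin x + b * cos x) has_derivative (\<lambda>h. ((-b*h) * sin x + (a*h) * cos x))) (at x)"
        by (auto intro!: derivative_eq_intros simp: algebra_simps)
      show "times_differentiable_on n UNIV (\<lambda>x. (- b * d) * sin x + (a * d) * cos x)" for d
        by (rule Suc.IH)
    qed simp
  qed simp
  from this[of _ 1 0] this[of _ 0 1]
  show "smooth_on UNIV (sin :: real \<Rightarrow> real)" "smooth_on UNIV (cos :: real \<Rightarrow> real)"
    by (simp_all add: smooth_on_iff_times)
qed

lemma smooth_on_sin: "open U \<Longrightarrow> smooth_on U f \<Longrightarrow> smooth_on U (\<lambda>x. sin (f x :: real))"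
  by (rule smooth_on_compose_UNIV[OF _ smooth_sin_cos(1)])
lemma smooth_on_cos: "open U \<Longrightarrow> smooth_on U f \<Longrightarrow> smooth_on U (\<lambda>x. cos (f x :: real))"
  by (rule smooth_on_compose_UNIV[OF _ smooth_sin_cos(2)])

lemmas smooth_intros = smooth_on_add smooth_on_diff smooth_on_uminus smooth_on_mult smooth_on_scaleR
  smooth_on_inner smooth_on_const smooth_on_id smooth_on_sin smooth_on_cos smooth_on_vector2 smooth_on_Pair
  smooth_on_fst smooth_on_snd smooth_on_nth smooth_on_sum

text \<open>The second difference over a parallelogram is a mixed derivative at some point of it.
  It is symmetric in the two directions, and this is why mixed derivatives commute.\<close>

lemma second_difference_mvt:
  fixes f :: "'a::euclidean_space \<Rightarrow> real"
  assumes "smooth_on U f" "h > 0"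
    and U: "\<And>s t. 0 \<le> s \<Longrightarrow> s \<le> h \<Longrightarrow> 0 \<le> t \<Longrightarrow> t \<le> h \<Longrightarrow> x + s *\<^sub>R a + t *\<^sub>R b \<in> U"
  obtains s t where "0 \<le> s" "s \<le> h" "0 \<le> t" "t \<le> h"
    "f (x + h *\<^sub>R a + h *\<^sub>R b) - f (x + h *\<^sub>R a) - f (x + h *\<^sub>R b) + f x
       = h * h * iter_deriv [b, a] f (x + s *\<^sub>R a + t *\<^sub>R b)"
proof -
  let ?F = "\<lambda>s. f (x + s *\<^sub>R a + h *\<^sub>R b) - f (x + s *\<^sub>R a)"
  let ?d = "\<lambda>y. frechet_derivative f (at y) a"
  have lin: "c * frechet_derivative f (at y) v = frechet_derivative f (at y) (c *\<^sub>R v)" if "y \<in> U" for c y v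
    using linear_cmul[OF has_derivative_linear[OF smooth_on_has_derivative[OF assms(1) that]]] by simp
  have lin2: "c * frechet_derivative ?d (at y) v = frechet_derivative ?d (at y) (c *\<^sub>R v)" if "y \<in> U" for c y v
    using linear_cmul[OF has_derivative_linear[OF smooth_on_has_derivative[OF smooth_on_deriv[OF assms(1)] that]]]
    by simp
  have D: "((\<lambda>s. f (x + s *\<^sub>R a + t *\<^sub>R b)) has_real_derivative ?d (x + s *\<^sub>R a + t *\<^sub>R b)) (at s)"
    if "0 \<le> s" "s \<le> h" "0 \<le> t" "t \<le> h" for s t
  proof -
    have "((\<lambda>s. x + s *\<^sub>R a + t *\<^sub>R b) has_derivative (\<lambda>c. c *\<^sub>R a)) (at s)"
      by (auto intro!: derivative_eq_intros)
    from has_derivative_compose[OF this smooth_on_has_derivative[OF assms(1) U[OF that]]]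
    show ?thesis unfolding has_field_derivative_def
      by (rule has_derivative_eq_rhs) (use lin[OF U[OF that]] in \<open>auto simp: fun_eq_iff algebra_simps\<close>)
  qed
  have D2: "((\<lambda>t. ?d (x + s *\<^sub>R a + t *\<^sub>R b)) has_real_derivative iter_deriv [b,a] f (x + s *\<^sub>R a + t *\<^sub>R b)) (at t)"
    if "0 \<le> s" "s \<le> h" "0 \<le> t" "t \<le> h" for s t
  proof -
    have "((\<lambda>t. x + s *\<^sub>R a + t *\<^sub>R b) has_derivative (\<lambda>c. c *\<^sub>R b)) (at t)"
      by (auto intro!: derivative_eq_intros)
    from has_derivative_compose[OF this smooth_on_has_derivative[OF smooth_on_deriv[OF assms(1)] U[OF that]]]
    show ?thesis unfolding has_field_derivative_def
      by (rule has_derivative_eq_rhs) (use lin2[OF U[OF that]] in \<open>auto simp: fun_eq_iff algebra_simps\<close>)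
  qed
  have "\<exists>s. 0 < s \<and> s < h \<and> ?F h - ?F 0 = (h - 0) * (?d (x + s *\<^sub>R a + h *\<^sub>R b) - ?d (x + s *\<^sub>R a))"
    by (rule MVT2[OF assms(2)]) (use D[where t=h] D[where t=0] assms(2) in \<open>auto intro!: derivative_intros\<close>)
  then obtain s where s: "0 < s" "s < h" "?F h - ?F 0 = h * (?d (x + s *\<^sub>R a + h *\<^sub>R b) - ?d (x + s *\<^sub>R a))"
    by auto
  have "\<exists>t. 0 < t \<and> t < h \<and> ?d (x + s *\<^sub>R a + h *\<^sub>R b) - ?d (x + s *\<^sub>R a + 0 *\<^sub>R b)
          = (h - 0) * iter_deriv [b,a] f (x + s *\<^sub>R a + t *\<^sub>R b)"
    by (rule MVT2[OF assms(2)]) (use D2 s in auto)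
  then obtain t where t: "0 < t" "t < h" "?d (x + s *\<^sub>R a + h *\<^sub>R b) - ?d (x + s *\<^sub>R a)
          = h * iter_deriv [b,a] f (x + s *\<^sub>R a + t *\<^sub>R b)" by auto
  show ?thesis
    using s t that[of s t] by (auto simp: algebra_simps)
qed

lemma iter_deriv_inner:
  assumes "smooth_on U f" "open U" "x \<in> U"
  shows "iter_deriv ds (\<lambda>y. f y \<bullet> b) x = iter_deriv ds f x \<bullet> b"
  using assms(3)
proof (induction ds arbitrary: x)
  case (Cons d ds)
  have "frechet_derivative (iter_deriv ds (\<lambda>y. f y \<bullet> b)) (at x) = frechet_derivative (\<lambda>y. iter_deriv ds f y \<bullet> b) (at x)"
    by (rule frechet_derivative_cong_open[OF assms(2) Cons.prems Cons.IH])
  also have "\<dots> = (\<lambda>h. frechet_derivative (iter_deriv ds f) (at x) h \<bullet> b)"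
    by (rule frechet_derivative_at[symmetric], rule has_derivative_inner_left,
        rule smooth_on_has_derivative[OF smooth_on_iter_deriv[OF assms(1)] Cons.prems])
  finally show ?case by simp
qed simp

lemma iter_deriv_symmetric_real:
  fixes f :: "'a::euclidean_space \<Rightarrow> real"
  assumes "open U" "smooth_on U f" "x \<in> U"
  shows "iter_deriv [a, b] f x = iter_deriv [b, a] f x"
proof (rule ccontr)
  let ?A = "iter_deriv [a, b] f" and ?B = "iter_deriv [b, a] f"
  assume "?A x \<noteq> ?B x"
  define e where "e = dist (?A x) (?B x) / 2"
  have e: "e > 0" using \<open>?A x \<noteq> ?B x\<close> by (simp add: e_def)
  have cont: "isCont ?A x" "isCont ?B x"
    using smooth_on_imp_continuous_on[OF smooth_on_iter_deriv[OF assms(2)]] assms(1,3) continuous_on_eq_continuous_at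
    by blast+
  obtain d1 where d1: "d1 > 0" "\<And>y. dist y x < d1 \<Longrightarrow> dist (?A y) (?A x) < e"
    using cont(1) e unfolding continuous_at_eps_delta by blast
  obtain d2 where d2: "d2 > 0" "\<And>y. dist y x < d2 \<Longrightarrow> dist (?B y) (?B x) < e"
    using cont(2) e unfolding continuous_at_eps_delta by blast
  obtain d3 where d3: "d3 > 0" "ball x d3 \<subseteq> U" using assms openE by blast
  define d where "d = min d1 (min d2 d3)"
  \<comment> \<open>a parallelogram so small that it stays in \<open>U\<close> and both mixed
    derivatives vary on it by less than half of their assumed distance\<close>
  define h where "h = d / (2 * (norm a + norm b + 1))"
  have d: "d > 0" using d1 d2 d3 by (simp add: d_def)
  have nn: "norm a + norm b + 1 > 0" by (simp add: add_nonneg_pos)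
  have hN: "h * N = d / 2" if "N = norm a + norm b + 1" for N using nn unfolding h_def that[symmetric] by simp
  have h: "h > 0" using d nn by (simp add: h_def)
  have near: "dist (x + s *\<^sub>R a + t *\<^sub>R b) x < d" if "0 \<le> s" "s \<le> h" "0 \<le> t" "t \<le> h" for s t
  proof -
    have "dist (x + s *\<^sub>R a + t *\<^sub>R b) x \<le> norm (s *\<^sub>R a) + norm (t *\<^sub>R b)"
      using norm_triangle_ineq[of "s *\<^sub>R a" "t *\<^sub>R b"] by (simp add: dist_norm add.assoc)
    also have "\<dots> \<le> h * norm a + h * norm b" using that by (auto intro!: add_mono mult_right_mono)
    also have "\<dots> \<le> h * (norm a + norm b + 1)" using h by (simp add: algebra_simps)
    also have "\<dots> = d / 2" by (rule hN) simp
    finally show ?thesis using d by simp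
  qed
  have inU: "x + s *\<^sub>R a + t *\<^sub>R b \<in> U" if "0 \<le> s" "s \<le> h" "0 \<le> t" "t \<le> h" for s t
    using near[OF that] d3(2) by (auto simp: d_def dist_commute)
  obtain s t where st: "0 \<le> s" "s \<le> h" "0 \<le> t" "t \<le> h"
    "f (x + h *\<^sub>R a + h *\<^sub>R b) - f (x + h *\<^sub>R a) - f (x + h *\<^sub>R b) + f x
       = h * h * ?B (x + s *\<^sub>R a + t *\<^sub>R b)"
    using second_difference_mvt[OF assms(2) h, of x a b] inU by blast
  have inU': "x + s *\<^sub>R b + t *\<^sub>R a \<in> U" if "0 \<le> s" "s \<le> h" "0 \<le> t" "t \<le> h" for s t
    using inU[OF that(3,4,1,2)] by (simp add: algebra_simps)
  obtain s' t' where st': "0 \<le> s'" "s' \<le> h" "0 \<le> t'" "t' \<le> h"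
    "f (x + h *\<^sub>R b + h *\<^sub>R a) - f (x + h *\<^sub>R b) - f (x + h *\<^sub>R a) + f x
       = h * h * ?A (x + s' *\<^sub>R b + t' *\<^sub>R a)"
    using second_difference_mvt[OF assms(2) h, of x b a] inU' by blast
  have sw: "x + h *\<^sub>R b + h *\<^sub>R a = x + h *\<^sub>R a + h *\<^sub>R b" by (simp add: algebra_simps)
  have "h * h * ?A (x + s' *\<^sub>R b + t' *\<^sub>R a) = h * h * ?B (x + s *\<^sub>R a + t *\<^sub>R b)"
    using st(5) st'(5)[unfolded sw] by linarith
  then have eq: "?A (x + t' *\<^sub>R a + s' *\<^sub>R b) = ?B (x + s *\<^sub>R a + t *\<^sub>R b)" using h by (simp add: algebra_simps)
  have "dist (?A (x + t' *\<^sub>R a + s' *\<^sub>R b)) (?A x) < e" "dist (?B (x + s *\<^sub>R a + t *\<^sub>R b)) (?B x) < e"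
    using near st st' d1 d2 by (auto simp: d_def)
  then have "dist (?A x) (?B x) < 2 * e" using eq unfolding dist_real_def by arith
  then show False by (simp add: e_def)
qed

lemma iter_deriv_symmetric:
  fixes f :: "'a::euclidean_space \<Rightarrow> 'b::euclidean_space"
  assumes "open U" "smooth_on U f" "x \<in> U"
  shows "iter_deriv [a, b] f x = iter_deriv [b, a] f x"
proof (rule euclidean_eqI)
  fix i :: 'b
  have "smooth_on U (\<lambda>y. f y \<bullet> i)" by (rule smooth_on_linear[OF bounded_linear_inner_left assms(1,2)])
  from iter_deriv_symmetric_real[OF assms(1) this assms(3)]
  show "iter_deriv [a, b] f x \<bullet> i = iter_deriv [b, a] f x \<bullet> i"
    by (simp only: iter_deriv_inner[OF assms(2,1,3)])
qed

text \<open>The factors \<open>inverse x ^ k\<close> make the family closed under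
  differentiation, so that smoothness follows by induction. At the origin exponential decay beats
  the power.\<close>

lemma flat_exp_differentiable:
  "((\<lambda>x. if x > 0 then inverse x ^ k * exp (- inverse x) else 0) has_real_derivative
     (if x > 0 then - real k * (inverse x ^ (k+1) * exp (- inverse x)) + inverse x ^ (k+2) * exp (- inverse x) else 0)) (at x)"
  (is "(?f has_real_derivative ?d) (at x)")
proof (cases x "0::real" rule: linorder_cases)
  case less
  show ?thesis
    by (rule has_field_derivative_transform_within_open[of "\<lambda>x. 0" _ _ "{..<0}"]) (use less in auto)
next
  case greater
  have i: "(inverse has_real_derivative - (inverse x * inverse x)) (at x)"
    using DERIV_inverse[of x] greater by (simp add: power2_eq_square)
  have e: "((\<lambda>x. exp (- inverse x)) has_real_derivative exp (- inverse x) * (inverse x * inverse x)) (at x)"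
    using DERIV_fun_exp[OF DERIV_minus[OF i]] by simp
  have "((\<lambda>x. inverse x ^ k * exp (- inverse x)) has_real_derivative ?d) (at x)"
  proof (rule DERIV_cong[OF DERIV_mult[OF DERIV_power[OF i, of k] e]])
    show "real k * (- (inverse x * inverse x) * inverse x ^ (k - Suc 0)) * exp (- inverse x) +
        exp (- inverse x) * (inverse x * inverse x) * inverse x ^ k = ?d"
      using greater by (cases k) (simp_all add: algebra_simps)
  qed
  then show ?thesis
    by (rule has_field_derivative_transform_within_open[of _ _ _ "{0<..}"]) (use greater in auto)
next
  case equal
  have "((\<lambda>y::real. y ^ (k+1) / exp y) \<longlongrightarrow> 0) at_top" by (rule tendsto_power_div_exp_0)
  then have "((\<lambda>x::real. inverse x ^ (k+1) / exp (inverse x)) \<longlongrightarrow> 0) (at_right 0)"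
    by (rule filterlim_compose[OF _ filterlim_inverse_at_top_right])
  then have r: "((\<lambda>h. (?f (0 + h) - ?f 0) / h) \<longlongrightarrow> 0) (at_right 0)"
    by (rule Lim_transform_eventually)
      (auto simp: eventually_at_filter exp_minus field_simps)
  have l: "((\<lambda>h. (?f (0 + h) - ?f 0) / h) \<longlongrightarrow> 0) (at_left 0)"
    by (rule Lim_transform_eventually[of "\<lambda>h. 0"]) (auto simp: eventually_at_filter)
  show ?thesis using equal filterlim_split_at[OF l r] by (simp add: DERIV_def)
qed

lemma smooth_flat_exp: "smooth_on UNIV (\<lambda>x::real. if x > 0 then exp (- inverse x) else 0)"
proof -
  let ?f = "\<lambda>k x::real. if x > 0 then inverse x ^ k * exp (- inverse x) else 0"
  have "times_differentiable_on n UNIV (?f k)" for n k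
  proof (induction n arbitrary: k)
    case (Suc n)
    show ?case
    proof (rule times_differentiable_SucI[where f'="\<lambda>x h. h * (- real k * ?f (k+1) x + ?f (k+2) x)"])
      fix x :: real
      show "(?f k has_derivative (\<lambda>h. h * (- real k * ?f (k+1) x + ?f (k+2) x))) (at x)"
        by (rule has_derivative_eq_rhs[OF flat_exp_differentiable[of k x, unfolded has_field_derivative_def]])
          (auto simp: fun_eq_iff)
    next
      fix d
      show "times_differentiable_on n UNIV (\<lambda>x. d * (- real k * ?f (k+1) x + ?f (k+2) x))"
        by (intro times_differentiable_bilinear[OF bounded_bilinear_mult open_UNIV] times_differentiable_add
            times_differentiable_const open_UNIV Suc)
    qed simp
  qed simp
  from this[of _ 0] show ?thesis by (simp add: smooth_on_iff_times cong: if_cong)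
qed

lemma smooth_step_exists:
  obtains \<sigma> :: "real \<Rightarrow> real" where "smooth_on UNIV \<sigma>" "\<And>t. t \<le> 1 \<Longrightarrow> \<sigma> t = 0" "\<And>t. t \<ge> 2 \<Longrightarrow> \<sigma> t = 1"
    "\<And>t. 0 \<le> \<sigma> t" "\<And>t. \<sigma> t \<le> 1"
proof -
  define f where "f = (\<lambda>x::real. if x > 0 then exp (- inverse x) else 0)"
  have f: "smooth_on UNIV f" unfolding f_def by (rule smooth_flat_exp)
  have nn: "f x \<ge> 0" for x by (simp add: f_def)
  have pos: "f (t - 1) + f (2 - t) \<noteq> 0" for t
  proof -
    have "f (t - 1) > 0 \<or> f (2 - t) > 0" by (auto simp: f_def)
    then show ?thesis using nn[of "t-1"] nn[of "2-t"] by linarith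
  qed
  define \<sigma> where "\<sigma> = (\<lambda>t. f (t - 1) / (f (t - 1) + f (2 - t)))"
  show ?thesis
  proof (rule that[of \<sigma>])
    show "smooth_on UNIV \<sigma>" unfolding \<sigma>_def
      by (intro smooth_on_divide smooth_on_add smooth_on_compose_UNIV[OF _ f] smooth_on_diff smooth_on_id smooth_on_const pos open_UNIV)
    show "\<sigma> t = 0" if "t \<le> 1" for t using that by (simp add: \<sigma>_def f_def)
    show "\<sigma> t = 1" if "t \<ge> 2" for t using that pos[of t] by (simp add: \<sigma>_def f_def)
    show "0 \<le> \<sigma> t" for t using nn[of "t-1"] nn[of "2-t"] by (simp add: \<sigma>_def)
    show "\<sigma> t \<le> 1" for t using nn[of "t-1"] nn[of "2-t"] pos[of t] by (simp add: \<sigma>_def divide_simps)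
  qed
qed

section \<open>Plane geometry of the body and the fluid\<close>

definition rot :: "real \<Rightarrow> real^2 \<Rightarrow> real^2" where
  "rot b x = vector [cos b * x $ 1 - sin b * x $ 2, sin b * x $ 1 + cos b * x $ 2]"

lemma vec2_eq_iff: "(x::real^2) = y \<longleftrightarrow> x $ 1 = y $ 1 \<and> x $ 2 = y $ 2"
  by (simp add: vec_eq_iff forall_2)

lemma inner_vec2: "(x::real^2) \<bullet> y = x $ 1 * y $ 1 + x $ 2 * y $ 2"
  by (simp add: inner_vec_def sum_2)

lemma rot_nth [simp]: "rot b x $ 1 = cos b * x $ 1 - sin b * x $ 2" "rot b x $ 2 = sin b * x $ 1 + cos b * x $ 2"
  by (simp_all add: rot_def)

lemma rot_rot: "rot a (rot b x) = rot (a + b) x"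
  by (simp add: vec2_eq_iff cos_add sin_add algebra_simps)

lemma rot_0 [simp]: "rot 0 x = x" by (simp add: vec2_eq_iff)

lemma rot_inner [simp]: "rot b x \<bullet> rot b y = x \<bullet> y"
  unfolding inner_vec2 rot_nth using sin_cos_squared_add3[of b] by algebra

lemma norm_rot [simp]: "norm (rot b x) = norm x"
  by (simp add: norm_eq_sqrt_inner)

lemma linear_rot: "linear (rot b)"
  by (rule linearI) (simp_all add: vec2_eq_iff algebra_simps)

lemma bounded_linear_rot: "bounded_linear (rot b)"
  using linear_rot linear_conv_bounded_linear by blast

lemma rot_image_symmetric:
  assumes "\<And>b x. x \<in> S \<Longrightarrow> rot b x \<in> S" shows "rot b ` S = S"
proof
  show "S \<subseteq> rot b ` S"
  proof
    fix x assume "x \<in> S"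
    then have "rot (-b) x \<in> S" "x = rot b (rot (-b) x)" using assms by (auto simp: rot_rot)
    then show "x \<in> rot b ` S" by blast
  qed
qed (use assms in auto)

lemma se2_act_eq: "se2_act g x = rot (fst g) x + snd g"
  by (simp add: se2_act_def rot_def)

lemma se2_act_image:
  assumes "\<And>b x. x \<in> S \<Longrightarrow> rot b x \<in> S"
  shows "se2_act g ` S = (\<lambda>x. x + snd g) ` S"
proof -
  have "se2_act g = (\<lambda>x. x + snd g) \<circ> rot (fst g)" by (auto simp: se2_act_eq)
  then show ?thesis using rot_image_symmetric[OF assms] by (metis image_comp)
qed

lemma translate_cball: "(\<lambda>x. x + c) ` cball 0 R = cball (c::real^2) R" "(\<lambda>x. x + c) ` sphere 0 R = sphere (c::real^2) R"
  by (force simp: image_iff dist_norm norm_minus_commute intro: bexI[of _ "x - c" for x])+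

lemma se2_act_body: "se2_act g ` body R = cball (snd g) R"
  unfolding body_def by (subst se2_act_image) (auto simp: translate_cball)

lemma se2_act_frontier_body: "R > 0 \<Longrightarrow> se2_act g ` frontier (body R) = sphere (snd g) R"
  unfolding body_def by (subst se2_act_image) (auto simp: translate_cball)

lemma exterior_eq: "R > 0 \<Longrightarrow> closure (- cball (c::real^2) R) = - ball c R"
  by (simp add: closure_complement)

lemma interior_exterior: "R > 0 \<Longrightarrow> interior (- ball (c::real^2) R) = - cball c R"
  by (simp add: interior_complement)

lemma frontier_exterior: "R > 0 \<Longrightarrow> frontier (- ball (c::real^2) R) = sphere c R"
  by (simp add: frontier_complement)

lemma fluid_eq: "R > 0 \<Longrightarrow> fluid R = - ball 0 R" by (simp add: fluid_def body_def exterior_eq)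

lemma area_form_simps:
  "area_form (a + b) c = area_form a c + area_form b c"
  "area_form c (a + b) = area_form c a + area_form c b"
  "area_form (a - b) c = area_form a c - area_form b c"
  "area_form c (a - b) = area_form c a - area_form c b"
  "area_form (k *\<^sub>R a) c = k * area_form a c"
  "area_form c (k *\<^sub>R a) = k * area_form c a"
  "area_form a a = 0" "area_form 0 a = 0" "area_form a 0 = 0"
  "area_form (- a) c = - area_form a c" "area_form c (- a) = - area_form c a"
  by (simp_all add: area_form_def algebra_simps)

lemma area_form_commute: "area_form a b = - area_form b a"
  by (simp add: area_form_def)

lemma area_form_rot: "area_form (rot b x) (rot b y) = area_form x y"
  unfolding area_form_def rot_nth using sin_cos_squared_add3[of b] by algebra

lemma area_form_bound: "\<bar>area_form a b\<bar> \<le> norm a * norm b"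
proof -
  have "(area_form a b)\<^sup>2 + (a \<bullet> b)\<^sup>2 = (a \<bullet> a) * (b \<bullet> b)"
    by (simp add: area_form_def inner_vec2 power2_eq_square algebra_simps)
  then have "(area_form a b)\<^sup>2 \<le> (norm a * norm b)\<^sup>2"
    by (simp add: power_mult_distrib dot_square_norm) (metis le_add_same_cancel1 zero_le_power2)
  then show ?thesis by (metis abs_le_square_iff abs_mult abs_norm_cancel)
qed

lemma bounded_bilinear_area_form: "bounded_bilinear area_form"
  by (rule bounded_bilinear.intro)
    (auto simp: area_form_simps intro!: exI[of _ 1] area_form_bound)

lemmas has_derivative_area_form = bounded_bilinear.FDERIV[OF bounded_bilinear_area_form]
lemmas smooth_on_area_form = smooth_on_bilinear[OF bounded_bilinear_area_form]

text \<open>Vectors are compared by their contractions with the area form. This identifies vector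
  fields with the differentials of their Hamiltonians.\<close>

lemma area_form_nondegenerate:
  assumes "\<And>w. area_form a w = area_form b w" shows "a = b"
  using assms[of "axis 1 1"] assms[of "axis 2 1"] by (simp add: area_form_def vec2_eq_iff axis_def)

lemma linear_vec2: "linear f \<Longrightarrow> f (w::real^2) = w $ 1 *\<^sub>R f (axis 1 1) + w $ 2 *\<^sub>R f (axis 2 1)"
proof -
  assume l: "linear f"
  have "w = w $ 1 *\<^sub>R axis 1 1 + w $ 2 *\<^sub>R axis 2 1" by (simp add: vec2_eq_iff axis_def)
  then have "f w = f (w $ 1 *\<^sub>R axis 1 1 + w $ 2 *\<^sub>R axis 2 1)" by simp
  then show ?thesis by (simp add: linear_add[OF l] linear_scale[OF l])
qed

lemma grad_inner: "(f has_derivative D) (at x) \<Longrightarrow> grad f x \<bullet> w = D w"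
proof -
  assume d: "(f has_derivative D) (at x)"
  have "grad f x \<bullet> w = w $ 1 * D (axis 1 1) + w $ 2 * D (axis 2 1)"
    by (simp add: grad_def inner_vec2 frechet_derivative_at[OF d, symmetric])
  then show ?thesis using linear_vec2[OF has_derivative_linear[OF d], of w] by simp
qed

section \<open>The exterior Neumann problem for a disc\<close>

lemma second_derivative_nonpos_at_max:
  fixes g :: "real \<Rightarrow> real"
  assumes "d > 0" "\<And>t. \<bar>t\<bar> < d \<Longrightarrow> (g has_real_derivative g' t) (at t)"
    and "(g' has_real_derivative m) (at 0)" "\<And>t. \<bar>t\<bar> < d \<Longrightarrow> g t \<le> g 0"
  shows "m \<le> 0"
proof (rule ccontr)
  assume "\<not> m \<le> 0"
  then obtain e where e: "e > 0" "\<And>h. h > 0 \<Longrightarrow> h < e \<Longrightarrow> g' 0 < g' h"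
    using DERIV_pos_inc_right[OF assms(3)] by auto
  have "g' 0 = 0"
    by (rule DERIV_local_max[OF assms(2) assms(1)]) (use assms in auto)
  define t where "t = min d e / 2"
  have t: "t > 0" "t < d" "t < e" using assms(1) e(1) by (auto simp: t_def)
  obtain s where "0 < s" "s < t" "g t - g 0 = (t - 0) * g' s"
    using MVT2[OF t(1), of g g'] assms(2) t by (auto)
  moreover have "g' s > 0" using e(2)[of s] \<open>g' 0 = 0\<close> calculation t by auto
  ultimately have "g t > g 0" using t by (simp add: algebra_simps)
  then show False using assms(4)[of t] t by auto
qed

text \<open>A maximum principle. Adding \<open>\<epsilon> |x - c|\<^sup>2\<close> to
  \<open>h\<close> makes the function strictly subharmonic, hence without interior maximum, and
  strictly increasing outwards at the circle, where the normal derivative of \<open>h\<close>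
  vanishes. On a large annulus the maximum is therefore attained at the outer circle. There
  \<open>h\<close> is small, and \<open>\<epsilon>\<close> is chosen so that the added term is
  small too.\<close>

lemma exterior_neumann_nonpos:
  fixes h :: "real^2 \<Rightarrow> real"
  assumes R: "R > 0" and U: "open U" "- ball c R \<subseteq> U" "smooth_on U h"
    and harm: "\<And>x. x \<in> - cball c R \<Longrightarrow> laplacian h x = 0"
    and neum: "\<And>x. x \<in> sphere c R \<Longrightarrow> frechet_derivative h (at x) (x - c) = 0"
    and lim: "(h \<longlongrightarrow> 0) at_infinity" and x0: "x0 \<in> - ball c R"
  shows "h x0 \<le> 0"
proof (rule ccontr)
  assume "\<not> h x0 \<le> 0"
  then have pos: "h x0 > 0" by simp
  obtain B where B: "\<And>x. B \<le> norm x \<Longrightarrow> \<bar>h x\<bar> < h x0 / 2"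
    using tendstoD[OF lim, of "h x0 / 2"] pos unfolding eventually_at_infinity by auto
  \<comment> \<open>outer radius: \<open>x0\<close> lies inside, and on the outer circle
    \<open>h\<close> is less than half of \<open>h x0\<close>\<close>
  define S where "S = \<bar>B\<bar> + norm c + norm (x0 - c) + R + 1"
  have S: "S > R" "S > norm (x0 - c)" "S > 0"
    using R norm_ge_zero[of c] norm_ge_zero[of "x0 - c"] unfolding S_def by linarith+
  \<comment> \<open>the perturbation contributes only \<open>h x0 / 4\<close> on the outer
    circle\<close>
  define \<epsilon> where "\<epsilon> = h x0 / (4 * S\<^sup>2)"
  have eps: "\<epsilon> > 0" "\<epsilon> * S\<^sup>2 = h x0 / 4" using pos S by (auto simp: \<epsilon>_def)
  define k where "k = (\<lambda>x. h x + \<epsilon> * ((x - c) \<bullet> (x - c)))"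
  define A where "A = cball c S - ball c R"
  have "compact A" unfolding A_def by (intro compact_diff) auto
  have AU: "A \<subseteq> U" using U(2) by (auto simp: A_def)
  have x0A: "x0 \<in> A" using S x0 by (auto simp: A_def dist_norm norm_minus_commute)
  have "continuous_on A k" unfolding k_def
    by (intro continuous_intros continuous_on_subset[OF smooth_on_imp_continuous_on[OF U(3)] AU])
  then obtain z where z: "z \<in> A" "\<And>y. y \<in> A \<Longrightarrow> k y \<le> k z"
    using continuous_attains_sup[OF \<open>compact A\<close>] x0A by blast
  have zU: "z \<in> U" using AU z by blast
  have kz: "k z \<ge> h x0" using z(2)[OF x0A] eps by (simp add: k_def) (smt (verit) inner_ge_zero mult_nonneg_nonneg)
  have dk: "((\<lambda>t. k (z + t *\<^sub>R a)) has_real_derivative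
       frechet_derivative h (at (z + t *\<^sub>R a)) a + 2 * \<epsilon> * ((z + t *\<^sub>R a - c) \<bullet> a)) (at t)"
    if "z + t *\<^sub>R a \<in> U" for t a
  proof -
    have l: "linear (frechet_derivative h (at (z + t *\<^sub>R a)))"
      using smooth_on_has_derivative[OF U(3) that] has_derivative_linear by blast
    have "((\<lambda>t. z + t *\<^sub>R a) has_derivative (\<lambda>s. s *\<^sub>R a)) (at t)" by (auto intro!: derivative_eq_intros)
    from has_derivative_compose[OF this smooth_on_has_derivative[OF U(3) that]]
    have h: "((\<lambda>t. h (z + t *\<^sub>R a)) has_real_derivative frechet_derivative h (at (z + t *\<^sub>R a)) a) (at t)"
      unfolding has_field_derivative_def
      by (rule has_derivative_eq_rhs) (simp add: fun_eq_iff linear_scale[OF l])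
    have q: "((\<lambda>t. (z + t *\<^sub>R a - c) \<bullet> (z + t *\<^sub>R a - c)) has_real_derivative 2 * ((z + t *\<^sub>R a - c) \<bullet> a)) (at t)"
      unfolding has_field_derivative_def
      by (auto intro!: derivative_eq_intros simp: fun_eq_iff inner_commute algebra_simps)
    show ?thesis unfolding k_def
      by (rule DERIV_cong[OF DERIV_add[OF h DERIV_cmult[OF q]]]) simp
  qed
  have Rz: "R \<le> norm (z - c)" "norm (z - c) \<le> S" using z(1) by (auto simp: A_def dist_norm norm_minus_commute)
  consider "norm (z - c) = S" | "norm (z - c) = R" "norm (z - c) < S" | "R < norm (z - c)" "norm (z - c) < S"
    using Rz by linarith
  \<comment> \<open>the maximum is on the outer circle, on the body, or in between\<close>
  then show False
  proof cases
    case 1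
    have "S \<le> norm z + norm c" using norm_triangle_ineq4[of z c] 1 by simp
    then have "B \<le> norm z" by (simp add: S_def) (smt (verit) norm_ge_zero R)
    then have "h z < h x0 / 2" using B by fastforce
    moreover have "k z = h z + \<epsilon> * S\<^sup>2" using 1 by (simp add: k_def dot_square_norm)
    ultimately show False using kz eps pos by linarith
  next
    case 2
    have zz: "z + 0 *\<^sub>R (z - c) \<in> U" using zU by simp
    have "((\<lambda>t. k (z + t *\<^sub>R (z - c))) has_real_derivative 2 * \<epsilon> * R\<^sup>2) (at 0)"
      using dk[OF zz] neum[of z] 2 by (simp add: dist_norm norm_minus_commute dot_square_norm)
    from DERIV_pos_inc_right[OF this] obtain d where d: "d > 0"
      "\<And>t. t > 0 \<Longrightarrow> t < d \<Longrightarrow> k (z + 0 *\<^sub>R (z - c)) < k (z + (0 + t) *\<^sub>R (z - c))"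
      using eps R by auto
    \<comment> \<open>\<open>1 + q\<close> is the ratio of the radii, so steps
      \<open>t \<le> q\<close> along the normal stay in the annulus\<close>
    define q where "q = S / R - 1"
    have q: "q > 0" "(1 + q) * R = S" using S(1) R by (simp_all add: q_def)
    define t where "t = min d q / 2"
    have t: "t > 0" "t < d" "t \<le> q" using d(1) q(1) by (auto simp: t_def)
    have "norm (z + t *\<^sub>R (z - c) - c) = norm ((1 + t) *\<^sub>R (z - c))" by (simp add: algebra_simps)
    also have "\<dots> = (1 + t) * R" using 2 t by simp
    finally have n: "norm (z + t *\<^sub>R (z - c) - c) = (1 + t) * R" .
    have "(1 + t) * R \<le> (1 + q) * R" "(1 + t) * R \<ge> 1 * R" using t R by (auto intro!: mult_right_mono)
    then have "(1 + t) * R \<le> S" "(1 + t) * R \<ge> R" using q(2) by auto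
    then have "z + t *\<^sub>R (z - c) \<in> A" unfolding A_def using n by (auto simp: dist_norm norm_minus_commute)
    then show False using z(2) d(2)[OF t(1,2)] by force
  next
    case 3
    define d where "d = min (S - norm (z - c)) (norm (z - c) - R)"
    have d: "d > 0" using 3 by (simp add: d_def)
    have inA: "z + t *\<^sub>R a \<in> A" if "\<bar>t\<bar> < d" "norm a = 1" for t a
    proof -
      have "norm (z - c + t *\<^sub>R a) \<le> norm (z - c) + \<bar>t\<bar>" using norm_triangle_ineq[of "z - c" "t *\<^sub>R a"] that by simp
      moreover have "norm (z - c + t *\<^sub>R a) \<ge> norm (z - c) - \<bar>t\<bar>"
        using norm_diff_ineq[of "z - c" "t *\<^sub>R a"] that by simp
      moreover have "z - c + t *\<^sub>R a = z + t *\<^sub>R a - c" by simp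
      ultimately show ?thesis using that unfolding A_def d_def
        by (auto simp: dist_norm norm_minus_commute[of c])
    qed
    have le: "iter_deriv [a, a] h z + 2 * \<epsilon> \<le> 0" if a: "norm a = 1" for a
    proof (rule second_derivative_nonpos_at_max[OF d])
      let ?g' = "\<lambda>t. frechet_derivative h (at (z + t *\<^sub>R a)) a + 2 * \<epsilon> * ((z + t *\<^sub>R a - c) \<bullet> a)"
      show "((\<lambda>t. k (z + t *\<^sub>R a)) has_real_derivative ?g' t) (at t)" if "\<bar>t\<bar> < d" for t
        by (rule dk) (use inA[OF that a] AU in blast)
      have l: "linear (frechet_derivative (\<lambda>x. frechet_derivative h (at x) a) (at z))"
        using smooth_on_has_derivative[OF smooth_on_deriv[OF U(3)] zU] has_derivative_linear by blast
      have "((\<lambda>t. z + t *\<^sub>R a) has_derivative (\<lambda>s. s *\<^sub>R a)) (at 0)" by (auto intro!: derivative_eq_intros)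
      from has_derivative_compose[OF this, of "\<lambda>x. frechet_derivative h (at x) a"
           "frechet_derivative (\<lambda>x. frechet_derivative h (at x) a) (at z)"]
      have h: "((\<lambda>t. frechet_derivative h (at (z + t *\<^sub>R a)) a) has_real_derivative iter_deriv [a, a] h z) (at 0)"
        unfolding has_field_derivative_def using smooth_on_has_derivative[OF smooth_on_deriv[OF U(3)] zU]
        by (simp add: linear_scale[OF l] mult.commute[of _ "frechet_derivative _ _ _"])
      have q: "((\<lambda>t. (z + t *\<^sub>R a - c) \<bullet> a) has_real_derivative 1) (at 0)"
        unfolding has_field_derivative_def
        by (rule has_derivative_eq_rhs, (rule derivative_intros)+) (use a in \<open>simp add: fun_eq_iff dot_square_norm\<close>)
      show "(?g' has_real_derivative iter_deriv [a, a] h z + 2 * \<epsilon>) (at 0)"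
        by (rule DERIV_cong[OF DERIV_add[OF h DERIV_cmult[OF q]]]) simp
      show "k (z + t *\<^sub>R a) \<le> k (z + 0 *\<^sub>R a)" if "\<bar>t\<bar> < d" for t
        using z(2)[OF inA[OF that a]] by simp
    qed
    have "laplacian h z + 4 * \<epsilon> \<le> 0"
      using le[of "axis 1 1"] le[of "axis 2 1"] by (simp add: laplacian_def sum_2)
    then show False using harm[of z] 3 eps by (simp add: dist_norm norm_minus_commute)
  qed
qed

lemma laplacian_diff:
  assumes "open U" "smooth_on U f" "smooth_on U g" "x \<in> U"
  shows "laplacian (\<lambda>y. f y - g y) x = laplacian f x - laplacian g x"
proof -
  have 1: "frechet_derivative (\<lambda>y. f y - g y) (at y) d = frechet_derivative f (at y) d - frechet_derivative g (at y) d"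
    if "y \<in> U" "smooth_on U f" "smooth_on U g" for y d f and g :: "real^2 \<Rightarrow> real"
    by (simp add: frechet_derivative_at[OF has_derivative_diff[OF smooth_on_has_derivative[OF that(2,1)]
          smooth_on_has_derivative[OF that(3,1)]], symmetric])
  have "iter_deriv [d, d] (\<lambda>y. f y - g y) x = iter_deriv [d, d] f x - iter_deriv [d, d] g x" for d
    using frechet_derivative_cong_open[OF assms(1,4) 1[OF _ assms(2,3)]]
      1[OF assms(4) smooth_on_deriv[OF assms(2)] smooth_on_deriv[OF assms(3)]] by simp
  then show ?thesis by (simp add: laplacian_def sum_subtractf)
qed

lemma neumann_le:
  assumes R: "R > 0" and N: "is_neumann_potential (- ball (snd g) R) g gd f1" "is_neumann_potential (- ball (snd g) R) g gd f2"
    and x: "x \<in> - ball (snd g) R"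
  shows "f1 x \<le> f2 x"
proof -
  let ?F = "- ball (snd g) R"
  obtain U1 where U1: "open U1" "?F \<subseteq> U1" "smooth_on U1 f1"
    using N(1) unfolding is_neumann_potential_def smooth_near_def by blast
  obtain U2 where U2: "open U2" "?F \<subseteq> U2" "smooth_on U2 f2"
    using N(2) unfolding is_neumann_potential_def smooth_near_def by blast
  let ?U = "U1 \<inter> U2"
  have U: "open ?U" "?F \<subseteq> ?U" "smooth_on ?U f1" "smooth_on ?U f2"
    using U1 U2 smooth_on_subset by blast+
  have "f1 x - f2 x \<le> 0"
  proof (rule exterior_neumann_nonpos[OF R U(1,2) smooth_on_diff[OF U(1,3,4)] _ _ _ x])
    fix y assume y: "y \<in> - cball (snd g) R"
    then have "y \<in> ?U" using U(2) by auto
    then show "laplacian (\<lambda>x. f1 x - f2 x) y = 0"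
      using laplacian_diff[OF U(1,3,4), of y] N y R unfolding is_neumann_potential_def
      by (simp add: interior_exterior)
  next
    fix y assume y: "y \<in> sphere (snd g) R"
    then have yU: "y \<in> ?U" using U(2) by auto
    have e: "grad f1 y \<bullet> sgn (y - snd g) = grad f2 y \<bullet> sgn (y - snd g)"
      using N y R unfolding is_neumann_potential_def by (simp add: frontier_exterior)
    have s: "y - snd g = R *\<^sub>R sgn (y - snd g)"
      using y R by (simp add: sgn_div_norm dist_norm norm_minus_commute)
    have "grad f1 y \<bullet> (y - snd g) = grad f2 y \<bullet> (y - snd g)" using e
      by (subst (1 2) s) simp
    then show "frechet_derivative (\<lambda>x. f1 x - f2 x) (at y) (y - snd g) = 0"
      by (simp add: frechet_derivative_at[OF has_derivative_diff[OF smooth_on_has_derivative[OF U(3) yU]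
            smooth_on_has_derivative[OF U(4) yU]], symmetric]
          grad_inner[OF smooth_on_has_derivative[OF U(3) yU]] grad_inner[OF smooth_on_has_derivative[OF U(4) yU]])
  next
    show "((\<lambda>x. f1 x - f2 x) \<longlongrightarrow> 0) at_infinity"
      using tendsto_diff[of f1 0 at_infinity f2 0] N unfolding is_neumann_potential_def by simp
  qed
  then show ?thesis by simp
qed

lemma neumann_unique:
  assumes "R > 0" "is_neumann_potential (- ball (snd g) R) g gd f1" "is_neumann_potential (- ball (snd g) R) g gd f2"
    and "x \<in> - ball (snd g) R"
  shows "f1 x = f2 x"
  using neumann_le assms by (metis order_antisym)

text \<open>The dipole potential of a disc with centre \<open>c\<close> moving with velocity
  \<open>e\<close>. Rotation about the centre does not move the boundary in the normal direction
  and so does not enter. The next two functions are its harmonic conjugate and its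
  gradient.\<close>

definition neumann_disc :: "real \<Rightarrow> real^2 \<Rightarrow> real^2 \<Rightarrow> real^2 \<Rightarrow> real" where
  "neumann_disc R c e x = - R\<^sup>2 * (e \<bullet> (x - c)) / ((x - c) \<bullet> (x - c))"

definition stream_disc :: "real \<Rightarrow> real^2 \<Rightarrow> real^2 \<Rightarrow> real^2 \<Rightarrow> real" where
  "stream_disc R c e x = R\<^sup>2 * area_form e (x - c) / ((x - c) \<bullet> (x - c))"

definition grad_neumann_disc :: "real \<Rightarrow> real^2 \<Rightarrow> real^2 \<Rightarrow> real^2 \<Rightarrow> real^2" where
  "grad_neumann_disc R c e x =
     (- R\<^sup>2 / ((x - c) \<bullet> (x - c))\<^sup>2) *\<^sub>R (((x - c) \<bullet> (x - c)) *\<^sub>R e - (2 * (e \<bullet> (x - c))) *\<^sub>R (x - c))"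

lemma has_derivative_square_dist:
  "((\<lambda>x. (x - c) \<bullet> (x - c)) has_derivative (\<lambda>h. 2 * ((x - c) \<bullet> h))) (at (x :: 'a::real_inner))"
  by (rule has_derivative_eq_rhs, (rule derivative_intros)+) (simp add: fun_eq_iff inner_commute)

lemma has_derivative_neumann_disc:
  assumes "x \<noteq> c"
  shows "(neumann_disc R c e has_derivative (\<lambda>w. grad_neumann_disc R c e x \<bullet> w)) (at x)"
proof -
  define z where "z = x - c"
  have s: "z \<bullet> z \<noteq> 0" using assms by (simp add: z_def)
  have f: "((\<lambda>x. - R\<^sup>2 * (e \<bullet> (x - c))) has_derivative (\<lambda>h. - R\<^sup>2 * (e \<bullet> h))) (at x)"
    by (rule has_derivative_eq_rhs, (rule derivative_intros)+) (simp add: fun_eq_iff)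
  have alg: "(- k * p * t - - k * q * (2 * r)) / (t * t) = - k / t\<^sup>2 * (t * p - 2 * q * r)"
    if "t \<noteq> 0" for k p q r t :: real
    using that by (simp add: power2_eq_square divide_simps) algebra
  have s': "(x - c) \<bullet> (x - c) \<noteq> 0" using assms by simp
  show ?thesis unfolding neumann_disc_def[abs_def]
    by (rule has_derivative_eq_rhs[OF has_derivative_divide'[OF f has_derivative_square_dist s']])
      (simp only: z_def[symmetric] alg[OF s] grad_neumann_disc_def inner_scaleR_left inner_diff_left)
qed

lemma has_derivative_stream_disc:
  assumes "x \<noteq> c"
  shows "(stream_disc R c e has_derivative (\<lambda>w. area_form (grad_neumann_disc R c e x) w)) (at x)"
proof -
  define z where "z = x - c"
  have s: "z \<bullet> z \<noteq> 0" using assms by (simp add: z_def)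
  have f: "((\<lambda>x. R\<^sup>2 * area_form e (x - c)) has_derivative (\<lambda>h. R\<^sup>2 * area_form e h)) (at x)"
    by (rule has_derivative_eq_rhs, (rule derivative_intros has_derivative_area_form)+)
      (simp add: fun_eq_iff area_form_simps)
  \<comment> \<open>for the quarter turn of the dipole field the product rule gives this
    identity in the plane\<close>
  have id: "area_form e w * (z \<bullet> z) - area_form e z * (2 * (z \<bullet> w))
      = - ((z \<bullet> z) * area_form e w - (2 * (e \<bullet> z)) * area_form z w)" for w
    unfolding inner_vec2 area_form_def by algebra
  have "R\<^sup>2 * area_form e w * (z \<bullet> z) - R\<^sup>2 * area_form e z * (2 * (z \<bullet> w))
      = R\<^sup>2 * - ((z \<bullet> z) * area_form e w - (2 * (e \<bullet> z)) * area_form z w)" for w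
    unfolding id[symmetric] by (simp only: right_diff_distrib mult.assoc)
  moreover have alg: "(k * - X) / (t * t) = - k / t\<^sup>2 * X" for k X t :: real
    by (simp add: power2_eq_square)
  ultimately have e: "(R\<^sup>2 * area_form e w * (z \<bullet> z) - R\<^sup>2 * area_form e z * (2 * (z \<bullet> w))) / ((z \<bullet> z) * (z \<bullet> z))
      = area_form (grad_neumann_disc R c e x) w" for w
    by (simp only: grad_neumann_disc_def z_def[symmetric] area_form_simps alg)
  have s': "(x - c) \<bullet> (x - c) \<noteq> 0" using assms by simp
  show ?thesis unfolding stream_disc_def[abs_def]
    by (rule has_derivative_eq_rhs[OF has_derivative_divide'[OF f has_derivative_square_dist s']])
      (simp only: z_def[symmetric] e)
qed

lemma laplacian_neumann_disc:
  assumes "x \<noteq> c" shows "laplacian (neumann_disc R c e) x = 0"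
proof -
  define z where "z = x - c"
  have s: "z \<bullet> z \<noteq> 0" "(x - c) \<bullet> (x - c) \<noteq> 0" using assms by (simp_all add: z_def)
  have o: "open (- {c})" by auto
  let ?D = "\<lambda>d h. - R\<^sup>2 / (z \<bullet> z) ^ 3 *
         (- 2 * (e \<bullet> d) * (z \<bullet> h) * (z \<bullet> z) - 2 * (e \<bullet> h) * (z \<bullet> d) * (z \<bullet> z) - 2 * (e \<bullet> z) * (h \<bullet> d) * (z \<bullet> z)
           + 8 * (e \<bullet> z) * (z \<bullet> d) * (z \<bullet> h))"
  have i: "iter_deriv [d, d] (neumann_disc R c e) x = ?D d d" for d
  proof -
    have "frechet_derivative (\<lambda>y. frechet_derivative (neumann_disc R c e) (at y) d) (at x)
        = frechet_derivative (\<lambda>y. grad_neumann_disc R c e y \<bullet> d) (at x)"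
      by (rule frechet_derivative_cong_open[OF o])
        (use assms in \<open>auto simp: frechet_derivative_at[OF has_derivative_neumann_disc, symmetric]\<close>)
    also have "\<dots> = ?D d"
    proof (rule frechet_derivative_at[symmetric])
      have e: "(\<lambda>y. grad_neumann_disc R c e y \<bullet> d) =
        (\<lambda>y. - R\<^sup>2 * (((y - c) \<bullet> (y - c)) * (e \<bullet> d) - 2 * (e \<bullet> (y - c)) * ((y - c) \<bullet> d))
             / (((y - c) \<bullet> (y - c)) * ((y - c) \<bullet> (y - c))))"
        by (simp add: grad_neumann_disc_def inner_diff_left fun_eq_iff power2_eq_square)
      have f: "((\<lambda>y. - R\<^sup>2 * (((y - c) \<bullet> (y - c)) * (e \<bullet> d) - 2 * (e \<bullet> (y - c)) * ((y - c) \<bullet> d))) has_derivative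
          (\<lambda>h. - R\<^sup>2 * (2 * (z \<bullet> h) * (e \<bullet> d) - 2 * (e \<bullet> h) * (z \<bullet> d) - 2 * (e \<bullet> z) * (h \<bullet> d)))) (at x)"
        by (rule has_derivative_eq_rhs, (rule derivative_intros has_derivative_square_dist)+)
          (simp add: fun_eq_iff z_def[symmetric] algebra_simps)
      have g: "((\<lambda>y. ((y - c) \<bullet> (y - c)) * ((y - c) \<bullet> (y - c))) has_derivative (\<lambda>h. 4 * (z \<bullet> z) * (z \<bullet> h))) (at x)"
        by (rule has_derivative_eq_rhs, (rule derivative_intros has_derivative_square_dist)+)
          (simp add: fun_eq_iff z_def[symmetric] algebra_simps)
      have alg: "(- k * (2*a*b - 2*b'*q - 2*p*m) * (t * t) - - k * (t * b - 2*p*q) * (4 * t * a)) / ((t * t) * (t * t))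
          = - k / t ^ 3 * (- 2*b*a*t - 2*b'*q*t - 2*p*m*t + 8*p*q*a)"
        if "t \<noteq> 0" for k a b b' p q m t :: real
        using that by (simp add: power3_eq_cube divide_simps) algebra
      have g0: "((x - c) \<bullet> (x - c)) * ((x - c) \<bullet> (x - c)) \<noteq> 0" using s by simp
      show "((\<lambda>y. grad_neumann_disc R c e y \<bullet> d) has_derivative ?D d) (at x)"
        unfolding e
        by (rule has_derivative_eq_rhs[OF has_derivative_divide'[OF f g g0]])
          (simp only: z_def[symmetric] alg[OF s(1)])
    qed
    finally show ?thesis by simp
  qed
  have c: "- 2 * e $ 1 * z $ 1 * (z \<bullet> z) - 2 * e $ 1 * z $ 1 * (z \<bullet> z) - 2 * (e \<bullet> z) * 1 * (z \<bullet> z) + 8 * (e \<bullet> z) * z $ 1 * z $ 1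
    + (- 2 * e $ 2 * z $ 2 * (z \<bullet> z) - 2 * e $ 2 * z $ 2 * (z \<bullet> z) - 2 * (e \<bullet> z) * 1 * (z \<bullet> z) + 8 * (e \<bullet> z) * z $ 2 * z $ 2) = 0"
    unfolding inner_vec2 by algebra
  have ax: "w \<bullet> axis i 1 = w $ i" "axis i (1::real) $ i = 1" for w :: "real^2" and i :: 2
    by (simp_all add: inner_axis)
  show ?thesis unfolding laplacian_def sum_2 by (simp only: i ax distrib_left[symmetric] c mult_zero_right)
qed

lemma norm_grad_neumann_disc: "norm (grad_neumann_disc R c e x) \<le> 3 * R\<^sup>2 * norm e / (norm (x - c))\<^sup>2"
proof -
  let ?z = "x - c"
  have "norm ((?z \<bullet> ?z) *\<^sub>R e - (2 * (e \<bullet> ?z)) *\<^sub>R ?z) \<le> norm ((?z \<bullet> ?z) *\<^sub>R e) + norm ((2 * (e \<bullet> ?z)) *\<^sub>R ?z)"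
    by (rule norm_triangle_ineq4)
  also have "\<dots> \<le> (norm ?z)\<^sup>2 * norm e + 2 * (norm e * norm ?z) * norm ?z"
    using mult_right_mono[OF Cauchy_Schwarz_ineq2[of e ?z], of "norm ?z"] by (simp add: dot_square_norm abs_mult)
  finally have "norm ((?z \<bullet> ?z) *\<^sub>R e - (2 * (e \<bullet> ?z)) *\<^sub>R ?z) \<le> 3 * norm e * (norm ?z)\<^sup>2"
    by (simp add: power2_eq_square)
  then have "R\<^sup>2 / ((norm ?z)\<^sup>2)\<^sup>2 * norm ((?z \<bullet> ?z) *\<^sub>R e - (2 * (e \<bullet> ?z)) *\<^sub>R ?z)
      \<le> R\<^sup>2 / ((norm ?z)\<^sup>2)\<^sup>2 * (3 * norm e * (norm ?z)\<^sup>2)"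
    by (intro mult_left_mono) auto
  also have "\<dots> \<le> 3 * R\<^sup>2 * norm e / (norm (x - c))\<^sup>2"
    by (cases "x = c") (simp_all add: power2_eq_square field_simps)
  finally show ?thesis by (simp add: grad_neumann_disc_def dot_square_norm)
qed

lemma abs_stream_disc: "\<bar>stream_disc R c e x\<bar> \<le> R\<^sup>2 * norm e / norm (x - c)"
proof -
  have "\<bar>stream_disc R c e x\<bar> \<le> R\<^sup>2 * (norm e * norm (x - c)) / (norm (x - c))\<^sup>2"
    unfolding stream_disc_def abs_divide abs_mult dot_square_norm
    using area_form_bound[of e "x - c"] by (auto intro!: divide_right_mono mult_left_mono)
  then show ?thesis by (cases "x = c") (auto simp: power2_eq_square)
qed

lemma abs_neumann_disc: "\<bar>neumann_disc R c e x\<bar> \<le> R\<^sup>2 * norm e / norm (x - c)"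
proof -
  have "\<bar>neumann_disc R c e x\<bar> \<le> R\<^sup>2 * (norm e * norm (x - c)) / (norm (x - c))\<^sup>2"
    unfolding neumann_disc_def abs_divide abs_mult dot_square_norm
    using Cauchy_Schwarz_ineq2[of e "x - c"] by (auto intro!: divide_right_mono mult_left_mono)
  then show ?thesis by (cases "x = c") (auto simp: power2_eq_square)
qed

lemma tendsto_infinity_of_bound:
  fixes f :: "real^2 \<Rightarrow> real"
  assumes "\<And>x. \<bar>f x\<bar> \<le> C / norm (x - c)" shows "(f \<longlongrightarrow> 0) at_infinity"
proof (rule Lim_null_comparison)
  show "\<forall>\<^sub>F x in at_infinity. norm (f x) \<le> C / norm (x - c)" using assms by simp
  have "filterlim (\<lambda>x. norm (x - c)) at_top at_infinity"
    unfolding filterlim_at_top eventually_at_infinity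
  proof
    fix Z show "\<exists>b. \<forall>x. b \<le> norm x \<longrightarrow> Z \<le> norm (x - c)"
      by (rule exI[of _ "Z + norm c"]) (smt (verit) norm_triangle_ineq2)
  qed
  then show "((\<lambda>x. C / norm (x - c)) \<longlongrightarrow> 0) at_infinity"
    by (intro tendsto_divide_0[OF tendsto_const] filterlim_at_top_imp_at_infinity)
qed

lemma smooth_on_disc_fields:
  "smooth_on (- {c}) (neumann_disc R c e)" "smooth_on (- {c}) (stream_disc R c e)"
  "smooth_on (- {c}) (grad_neumann_disc R c e)"
proof -
  have o: "open (- {c})" by auto
  show "smooth_on (- {c}) (neumann_disc R c e)" unfolding neumann_disc_def[abs_def]
    by (intro smooth_on_divide smooth_intros o) auto
  show "smooth_on (- {c}) (stream_disc R c e)" unfolding stream_disc_def[abs_def]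
    by (intro smooth_on_divide smooth_intros smooth_on_area_form o) auto
  show "smooth_on (- {c}) (grad_neumann_disc R c e)" unfolding grad_neumann_disc_def[abs_def] power2_eq_square
    by (intro smooth_on_divide smooth_intros o) auto
qed

lemma grad_neumann_disc_radial:
  assumes "R > 0" "norm (x - c) = R"
  shows "grad_neumann_disc R c e x \<bullet> (x - c) = e \<bullet> (x - c)"
proof -
  define z where "z = x - c"
  have z: "z \<bullet> z = R\<^sup>2" using assms by (auto simp: z_def dot_square_norm)
  have R0: "R\<^sup>2 \<noteq> 0" using assms by simp
  show ?thesis
    using R0 unfolding grad_neumann_disc_def z_def[symmetric] z
    by (simp add: inner_diff_left z power2_eq_square divide_simps)
qed

lemma is_neumann_potential_disc:
  assumes "R > 0" shows "is_neumann_potential (- ball (snd g) R) g gd (neumann_disc R (snd g) (snd gd))"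
  unfolding is_neumann_potential_def interior_exterior[OF assms] frontier_exterior[OF assms]
proof (intro conjI ballI)
  show "smooth_near (- ball (snd g) R) (neumann_disc R (snd g) (snd gd))" unfolding smooth_near_def
    by (rule exI[of _ "- {snd g}"]) (use assms smooth_on_disc_fields in auto)
  show "laplacian (neumann_disc R (snd g) (snd gd)) x = 0" if "x \<in> - cball (snd g) R" for x
    by (rule laplacian_neumann_disc) (use that assms in auto)
  show "(neumann_disc R (snd g) (snd gd) \<longlongrightarrow> 0) at_infinity"
    by (rule tendsto_infinity_of_bound[OF abs_neumann_disc])
  fix x assume "x \<in> sphere (snd g) R"
  then have n: "norm (x - snd g) = R" by (simp add: dist_norm norm_minus_commute)
  define z where "z = x - snd g"
  have z: "z \<bullet> z = R\<^sup>2" "norm z = R" using n by (auto simp: z_def dot_square_norm)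
  have "x \<noteq> snd g" using n assms by auto
  then have g: "grad (neumann_disc R (snd g) (snd gd)) x \<bullet> w = grad_neumann_disc R (snd g) (snd gd) x \<bullet> w" for w
    by (rule grad_inner[OF has_derivative_neumann_disc])
  have "grad_neumann_disc R (snd g) (snd gd) x \<bullet> z = snd gd \<bullet> z"
    using grad_neumann_disc_radial[OF assms n] by (simp add: z_def)
  moreover have "rigid_velocity g gd x \<bullet> z = snd gd \<bullet> z"
    by (simp add: rigid_velocity_def z_def[symmetric] inner_add_left inner_vec2 algebra_simps)
  ultimately show "grad (neumann_disc R (snd g) (snd gd)) x \<bullet> sgn (x - snd g) = rigid_velocity g gd x \<bullet> sgn (x - snd g)"
    unfolding g by (simp add: z_def[symmetric] sgn_div_norm)
qed

text \<open>On the circle the derivatives involve values inside the disc, which are not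
  controlled. They are limits of derivatives at exterior points, where the functions agree in a
  neighbourhood.\<close>

lemma derivative_eq_on_exterior:
  fixes f1 f2 :: "real^2 \<Rightarrow> real"
  assumes R: "R > 0" and U: "open U1" "- ball c R \<subseteq> U1" "smooth_on U1 f1" "open U2" "- ball c R \<subseteq> U2" "smooth_on U2 f2"
    and eq: "\<And>x. x \<in> - ball c R \<Longrightarrow> f1 x = f2 x" and x: "x \<in> - ball c R"
  shows "frechet_derivative f1 (at x) w = frechet_derivative f2 (at x) w"
proof -
  \<comment> \<open>approach along the outward normal\<close>
  define s where "s n = x + (1 / real (Suc n)) *\<^sub>R (x - c)" for n
  have lim: "s \<longlonglongrightarrow> x"
  proof -
    have "s \<longlonglongrightarrow> x + 0 *\<^sub>R (x - c)" unfolding s_def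
      by (intro tendsto_intros LIMSEQ_Suc lim_1_over_n)
    then show ?thesis by simp
  qed
  have sin: "s n \<in> - cball c R" for n
  proof -
    have "norm (s n - c) = norm ((1 + 1 / real (Suc n)) *\<^sub>R (x - c))" by (simp add: s_def algebra_simps)
    also have "\<dots> = (1 + 1 / real (Suc n)) * norm (x - c)" by simp
    also have "\<dots> > 1 * norm (x - c)" using x R
      by (intro mult_strict_right_mono) (auto simp: dist_norm norm_minus_commute)
    finally show ?thesis using x by (auto simp: dist_norm norm_minus_commute)
  qed
  have e: "frechet_derivative f1 (at (s n)) w = frechet_derivative f2 (at (s n)) w" for n
    by (rule fun_cong[OF frechet_derivative_cong_open[of "- cball c R"]]) (use sin[of n] eq in \<open>auto simp: open_Compl\<close>)
  have "(\<lambda>n. frechet_derivative f1 (at (s n)) w) \<longlonglongrightarrow> frechet_derivative f1 (at x) w"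
    by (rule isCont_tendsto_compose[OF _ lim])
      (use smooth_on_imp_continuous_on[OF smooth_on_deriv[OF U(3)]] U x continuous_on_eq_continuous_at in blast)
  moreover have "(\<lambda>n. frechet_derivative f2 (at (s n)) w) \<longlonglongrightarrow> frechet_derivative f2 (at x) w"
    by (rule isCont_tendsto_compose[OF _ lim])
      (use smooth_on_imp_continuous_on[OF smooth_on_deriv[OF U(6)]] U x continuous_on_eq_continuous_at in blast)
  ultimately show ?thesis unfolding e using LIMSEQ_unique by blast
qed

text \<open>The potential is only specified by its boundary value problem; uniqueness on the
  exterior carries over to the gradient, including its values on the boundary.\<close>

lemma grad_neumann_potential:
  assumes R: "R > 0" and x: "x \<in> - ball (snd g) R"
  shows "grad (neumann_potential (- ball (snd g) R) g gd) x = grad_neumann_disc R (snd g) (snd gd) x"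
proof -
  let ?F = "- ball (snd g) R" let ?f = "neumann_potential ?F g gd"
  have N: "is_neumann_potential ?F g gd ?f" unfolding neumann_potential_def
    by (rule someI[of "is_neumann_potential ?F g gd", OF is_neumann_potential_disc[OF R]])
  obtain U where U: "open U" "?F \<subseteq> U" "smooth_on U ?f" using N unfolding is_neumann_potential_def smooth_near_def by blast
  have xc: "x \<noteq> snd g" using x R by auto
  have "frechet_derivative ?f (at x) w = frechet_derivative (neumann_disc R (snd g) (snd gd)) (at x) w" for w
    by (rule derivative_eq_on_exterior[OF R U _ _ smooth_on_disc_fields(1) neumann_unique[OF R N is_neumann_potential_disc[OF R]] x])
      (use R in auto)
  then have "grad ?f x = grad (neumann_disc R (snd g) (snd gd)) x" by (simp add: grad_def)
  also have "\<dots> = grad_neumann_disc R (snd g) (snd gd) x"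
    using grad_inner[OF has_derivative_neumann_disc[OF xc]] by (metis inner_commute vector_eq_rdot)
  finally show ?thesis .
qed

text \<open>The difference of two stream functions of the same field has zero derivative along
  each ray and tends to zero at infinity.\<close>

lemma stream_function_unique:
  assumes R: "R > 0" and S: "is_stream_function (- ball c R) u f1" "is_stream_function (- ball c R) u f2"
    and x: "x \<in> - ball c R"
  shows "f1 x = f2 x"
proof -
  let ?y = "\<lambda>t::real. c + t *\<^sub>R (x - c)"
  have nx: "norm (x - c) \<ge> R" using x by (auto simp: dist_norm norm_minus_commute)
  have yF: "?y t \<in> - ball c R" if "t \<ge> 1" for t
  proof -
    have "1 * R \<le> t * norm (x - c)" using that nx R by (intro mult_mono) auto
    then show ?thesis using that by (simp add: dist_norm)
  qed
  have D: "((\<lambda>t. f (?y t)) has_real_derivative area_form (u (?y t)) (x - c)) (at t)"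
    if SF: "is_stream_function (- ball c R) u f" "t \<ge> 1" for f t
  proof -
    obtain U where U: "open U" "- ball c R \<subseteq> U" "smooth_on U f"
      using SF(1) unfolding is_stream_function_def smooth_near_def by (elim conjE exE) (rule that)
    have d: "(f has_derivative (\<lambda>w. area_form (u (?y t)) w)) (at (?y t))"
    proof -
      have "frechet_derivative f (at (?y t)) = (\<lambda>w. area_form (u (?y t)) w)"
        using yF[OF SF(2)] SF(1) unfolding is_stream_function_def by (intro ext) blast
      then show ?thesis using smooth_on_has_derivative[OF U(3), of "?y t"] yF[OF SF(2)] U(2) by auto
    qed
    have "(?y has_derivative (\<lambda>s. s *\<^sub>R (x - c))) (at t)" by (auto intro!: derivative_eq_intros)
    from has_derivative_compose[OF this d] show ?thesis
      unfolding has_field_derivative_def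
      by (rule has_derivative_eq_rhs) (simp add: fun_eq_iff area_form_simps(6) mult.commute)
  qed
  have *: "f1 (?y t) - f2 (?y t) = f1 x - f2 x" if "t \<ge> 1" for t
  proof -
  have "f1 (?y 1) - f2 (?y 1) = f1 (?y t) - f2 (?y t)"
  proof (cases "t = 1")
    case False
    have "\<exists>z. 1 < z \<and> z < t \<and> (f1 (?y t) - f2 (?y t)) - (f1 (?y 1) - f2 (?y 1)) = (t - 1) * 0"
      by (rule MVT2) (use that False DERIV_diff[OF D[OF S(1)] D[OF S(2)]] in auto)
    then show ?thesis by auto
  qed simp
  then show ?thesis by simp
  qed
  then have ev: "\<forall>\<^sub>F t in at_top. f1 (?y t) - f2 (?y t) = f1 x - f2 x"
    by (intro eventually_at_top_linorderI[of 1]) (simp add: *)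
  have "filterlim ?y at_infinity at_top"
    unfolding filterlim_at_infinity[OF order_refl]
  proof (intro allI impI)
    fix r :: real assume "0 < r"
    show "\<forall>\<^sub>F t in at_top. r \<le> norm (?y t)"
      using eventually_ge_at_top[of "(r + norm c) / norm (x - c)"] eventually_ge_at_top[of 0]
    proof eventually_elim
      case (elim t)
      then have "r + norm c \<le> t * norm (x - c)" using nx R pos_divide_le_eq[of "norm (x - c)" "r + norm c" t] by linarith
      then have "r + norm c \<le> norm (t *\<^sub>R (x - c))" using elim by (simp only: norm_scaleR abs_of_nonneg)
      then show ?case using norm_triangle_ineq4[of "?y t" c] by simp
    qed
  qed
  then have "((\<lambda>t. f1 (?y t) - f2 (?y t)) \<longlongrightarrow> 0 - 0) at_top"
    using S unfolding is_stream_function_def by (intro tendsto_diff) (auto intro: filterlim_compose)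
  then have "((\<lambda>t::real. f1 x - f2 x) \<longlongrightarrow> 0) at_top" using tendsto_cong[OF ev] by simp
  then show ?thesis by (simp add: tendsto_const_iff)
qed

lemma stream_eq:
  assumes R: "R > 0" and x: "x \<in> - ball (snd g) R"
  shows "stream R gd g x = stream_disc R (snd g) (snd gd) x"
proof -
  let ?F = "- ball (snd g) R" let ?u = "grad (neumann_potential ?F g gd)"
  have I: "is_stream_function ?F ?u (stream_disc R (snd g) (snd gd))"
    unfolding is_stream_function_def
  proof (intro conjI ballI allI)
    show "smooth_near ?F (stream_disc R (snd g) (snd gd))" unfolding smooth_near_def
      by (rule exI[of _ "- {snd g}"]) (use R smooth_on_disc_fields in auto)
    show "(stream_disc R (snd g) (snd gd) \<longlongrightarrow> 0) at_infinity"
      by (rule tendsto_infinity_of_bound[OF abs_stream_disc])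
    fix y w assume y: "y \<in> ?F"
    then have "y \<noteq> snd g" using R by auto
    then show "frechet_derivative (stream_disc R (snd g) (snd gd)) (at y) w = area_form (?u y) w"
      unfolding grad_neumann_potential[OF R y] by (simp add: frechet_derivative_at[OF has_derivative_stream_disc, symmetric])
  qed
  have "closure (- se2_act g ` body R) = ?F" by (simp add: se2_act_body exterior_eq R)
  then have "is_stream_function ?F ?u (stream R gd g)"
    unfolding stream_def Let_def using someI[of "is_stream_function ?F ?u", OF I] by simp
  from stream_function_unique[OF R this I x] show ?thesis .
qed

text \<open>The form depends linearly on the velocity of the centre and not on the angular
  velocity, because the dipole field is linear in the velocity and the rotation of a disc induces
  no potential flow.\<close>

lemma Theta_eq:
  assumes "R > 0" and "x \<in> - ball (snd g) R"
  shows "Theta R (g, x) (gd, v) = stream_disc R (snd g) (snd gd) x"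
proof -
  have "area_form (snd gd) z = area_form (axis 1 1) z * snd gd $ 1 + area_form (axis 2 1) z * snd gd $ 2" for z
    by (simp add: area_form_def axis_def)
  then have *: "area_form (snd gd) (x - snd g) =
      area_form (axis 1 1) (x - snd g) * snd gd $ 1 + area_form (axis 2 1) (x - snd g) * snd gd $ 2" .
  have alg: "k * A / s * a + k * B / s * b + k * 0 / s * d = k * (A * a + B * b) / s" for k A B a b d s :: real
    by (simp add: add_divide_distrib algebra_simps)
  show ?thesis
    unfolding Theta_def Psi_x_def Psi_y_def Psi_omega_def prod.case stream_eq[OF assms] stream_disc_def snd_conv
      area_form_simps(8) * alg ..
qed

section \<open>The fluid region of an embedding\<close>

lemma connected_exterior: "connected (- cball (c::real^2) R)"
  by (rule connected_complement_bounded_convex) auto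

text \<open>The image of the open exterior is open by invariance of domain. Together with the
  circle it is closed, because \<open>\<phi>\<close> stays at bounded distance from the identity
  and so is proper. Hence the image is open and closed in the complement of the image circle;
  being connected and unbounded, it is the outer component.\<close>

lemma embedding_image_exterior:
  fixes \<phi> :: "real^2 \<Rightarrow> real^2"
  assumes R: "R > 0" and cont: "continuous_on (- ball 0 R) \<phi>" and inj: "inj_on \<phi> (- ball 0 R)"
    and near: "\<And>x. x \<in> - ball 0 R \<Longrightarrow> norm (\<phi> x - x) \<le> C" and bd: "\<phi> ` sphere 0 R = sphere c R"
  shows "\<phi> ` (- ball 0 R) = - ball c R" "\<phi> ` (- cball 0 R) = - cball c R"
proof -
  define Om where "Om = \<phi> ` (- cball 0 R)"
  define T where "T = \<phi> ` (- ball 0 R)"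
  have decomp: "- ball 0 R = - cball 0 R \<union> sphere (0::real^2) R" using R by auto
  have T: "T = Om \<union> sphere c R" unfolding T_def Om_def decomp image_Un bd ..
  have disj: "Om \<inter> sphere c R = {}"
    unfolding Om_def bd[symmetric] using inj by (subst inj_on_image_Int[symmetric, of _ "- ball 0 R"]) auto
  have opn: "open Om" unfolding Om_def
    by (rule invariance_of_domain) (auto intro: continuous_on_subset[OF cont] inj_on_subset[OF inj])
  have con: "connected Om" unfolding Om_def
    by (rule connected_continuous_image[OF continuous_on_subset[OF cont] connected_exterior]) auto
  have clo: "closed T"
    unfolding closed_sequential_limits
  proof (intro allI impI, elim conjE)
    fix s l assume s: "\<forall>n. s n \<in> T" "s \<longlonglongrightarrow> l"
    obtain B where B: "\<And>n. norm (s n) \<le> B"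
      using convergent_imp_bounded[OF s(2)] unfolding bounded_iff by auto
    let ?K = "cball 0 (B + C) - ball (0::real^2) R"
    have "compact (\<phi> ` ?K)"
      by (rule compact_continuous_image[OF continuous_on_subset[OF cont]]) (auto intro: compact_diff)
    moreover have "s n \<in> \<phi> ` ?K" for n
    proof -
      obtain x where x: "x \<in> - ball 0 R" "s n = \<phi> x" using s(1) unfolding T_def by blast
      have "norm x \<le> norm (\<phi> x) + norm (\<phi> x - x)" using norm_triangle_ineq4[of "\<phi> x" "\<phi> x - x"] by simp
      then have "norm x \<le> B + C" using near[OF x(1)] B[of n] x(2) by simp
      then show ?thesis using x by auto
    qed
    ultimately have "l \<in> \<phi> ` ?K" using s(2) compact_imp_closed closed_sequentially by metis
    then show "l \<in> T" unfolding T_def by auto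
  qed
  have ex: "\<exists>y. y \<in> Om \<and> y \<in> - cball c R"
  proof -
    define x :: "real^2" where "x = (\<bar>C\<bar> + norm c + 2 * R) *\<^sub>R axis 1 1"
    have nx: "norm x = \<bar>C\<bar> + norm c + 2 * R" using R by (simp add: x_def)
    have x: "x \<in> - cball 0 R" using R by (simp add: nx) (smt (verit) norm_ge_zero)
    have "norm x \<le> norm (\<phi> x - c) + norm (\<phi> x - x) + norm c"
      using norm_triangle_ineq4[of "\<phi> x - c" "\<phi> x - x"] norm_triangle_ineq[of "(\<phi> x - c) - (\<phi> x - x)" c] by simp
    then have "norm (\<phi> x - c) > R" using near[of x] x nx R by auto
    then show ?thesis using x unfolding Om_def by (intro exI[of _ "\<phi> x"]) (auto simp: dist_norm norm_minus_commute)
  qed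
  have "Om \<inter> - cball c R = {} \<or> - T \<inter> - cball c R = {}"
  proof (rule connectedD[OF connected_exterior opn])
    show "open (- T)" using clo by auto
    show "Om \<inter> - T \<inter> - cball c R = {}" using T by auto
    show "- cball c R \<subseteq> Om \<union> - T" using T by auto
  qed
  then have 1: "- cball c R \<subseteq> Om" using ex T by auto
  have "- cball c R \<inter> Om = {} \<or> ball c R \<inter> Om = {}"
  proof (rule connectedD[OF con])
    show "Om \<subseteq> - cball c R \<union> ball c R" using disj by auto
  qed auto
  moreover have "cball c R = ball c R \<union> sphere c R" by auto
  ultimately have 2: "Om \<subseteq> - cball c R" using ex disj by blast
  show A: "\<phi> ` (- cball 0 R) = - cball c R" using 1 2 unfolding Om_def by blast
  show "\<phi> ` (- ball 0 R) = - ball c R" using A T unfolding Om_def T_def by auto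
qed

section \<open>Averages over rotations and thin annuli\<close>

lemma integral_rot:
  fixes h :: "real^2 \<Rightarrow> real"
  assumes "continuous_on UNIV h" "\<And>x. x \<notin> cball 0 r \<Longrightarrow> h x = 0"
  shows "integral (cball 0 r) (\<lambda>x. h (rot t x)) = integral (cball 0 r) h"
proof -
  \<comment> \<open>the fixed unit vector turns \<open>h\<close> into a vector-valued integrand,
    as in the formula for linear changes of variables\<close>
  let ?f = "\<lambda>x. h x *\<^sub>R (axis 1 1 :: real^2)"
  have im: "rot t ` cball 0 r = cball 0 r" by (rule rot_image_symmetric) auto
  have "continuous_on (cball 0 r) ?f" by (intro continuous_intros continuous_on_subset[OF assms(1)]) auto
  from borel_integrable_compact[OF compact_cball this]
  have ai: "?f absolutely_integrable_on cball 0 r"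
    unfolding set_integrable_def using integrable_completion[OF borel_measurable_integrable] by blast
  have det: "det (matrix (rot t)) = 1"
    by (simp add: det_2 matrix_def axis_def power2_eq_square[symmetric] flip: power2_eq_square)
  have *: "integral (cball 0 r) ?f = integral (cball 0 r) (?f \<circ> rot t)"
    using integral_change_of_variables_linear[OF linear_rot[of t], where f = ?f and S = "cball 0 r"] ai unfolding im det by simp
  have i: "integral (cball 0 r) (\<lambda>x. k x *\<^sub>R (axis 1 1 :: real^2)) = integral (cball 0 r) k *\<^sub>R axis 1 1"
    if "continuous_on (cball 0 r) k" for k :: "real^2 \<Rightarrow> real"
  proof -
    have "k integrable_on cball 0 r"
      using borel_integrable_compact[OF compact_cball that] set_borel_integral_eq_integral(1)
      unfolding set_integrable_def by blast
    from integral_linear[OF this bounded_linear_scaleR_left] show ?thesis by (simp add: o_def)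
  qed
  have c: "continuous_on (cball 0 r) (\<lambda>x. h (rot t x))"
    by (rule continuous_on_compose2[OF assms(1) linear_continuous_on[OF bounded_linear_rot]]) auto
  show ?thesis using * unfolding o_def i[OF c] i[OF continuous_on_subset[OF assms(1) subset_UNIV]] by (simp add: vec2_eq_iff axis_def)
qed

lemma rot_eq: "rot t x = cos t *\<^sub>R x + sin t *\<^sub>R vector [- x $ 2, x $ 1]"
  by (simp add: vec2_eq_iff)

lemma continuous_on_vector2:
  "continuous_on S f \<Longrightarrow> continuous_on S g \<Longrightarrow> continuous_on S (\<lambda>x. vector [f x, g x] :: real^2)"
  unfolding vector2_eq_axis by (intro continuous_intros)

lemma continuous_on_rot:
  fixes f :: "'a::t2_space \<Rightarrow> real"
  assumes "continuous_on S f" "continuous_on S g" shows "continuous_on S (\<lambda>x. rot (f x) (g x))"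
  unfolding rot_def by (intro continuous_on_vector2 continuous_intros assms)

text \<open>Rotations preserve area, so the integral does not change if the integrand is rotated,
  or averaged over all rotations (Fubini).\<close>

lemma rot_average:
  fixes h :: "real^2 \<Rightarrow> real"
  assumes "continuous_on UNIV h" "\<And>x. x \<notin> cball 0 r \<Longrightarrow> h x = 0"
  shows "2 * pi * integral (cball 0 r) h = integral (cball 0 r) (\<lambda>x. integral {0..2 * pi} (\<lambda>t. h (rot t x)))"
proof -
  obtain a b where ab: "cball (0::real^2) r \<subseteq> cbox a b"
    using bounded_subset_cbox_symmetric[OF bounded_cball] by blast
  have eqbox: "integral (cball 0 r) k = integral (cbox a b) k" if "\<And>x. x \<notin> cball 0 r \<Longrightarrow> k x = 0" for k :: "real^2 \<Rightarrow> real"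
  proof -
    have "(\<lambda>x. if x \<in> cball 0 r then k x else 0) = (\<lambda>x. if x \<in> cbox a b then k x else 0)" using ab that by force
    from arg_cong[OF this, of "integral UNIV"] show ?thesis by (simp only: integral_restrict_UNIV)
  qed
  have z: "h (rot t x) = 0" if "x \<notin> cball 0 r" for t x using that assms(2)[of "rot t x"] by simp
  have "2 * pi * integral (cball 0 r) h = integral {0..2 * pi} (\<lambda>t. integral (cball 0 r) h)"
    by simp
  also have "\<dots> = integral {0..2 * pi} (\<lambda>t. integral (cbox a b) (\<lambda>x. h (rot t x)))"
    using integral_rot[OF assms] eqbox[of "\<lambda>x. h (rot t x)" for t] z by simp
  also have "\<dots> = integral (cbox a b) (\<lambda>x. integral {0..2*pi} (\<lambda>t. h (rot t x)))"
    unfolding cbox_interval[symmetric]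
    by (rule integral_swap_continuous)
      (auto simp: case_prod_beta intro!: continuous_on_compose2[OF assms(1)] continuous_on_rot continuous_intros)
  also have "\<dots> = integral (cball 0 r) (\<lambda>x. integral {0..2*pi} (\<lambda>t. h (rot t x)))"
    by (rule eqbox[symmetric]) (simp add: z)
  finally show ?thesis .
qed

lemma integral_periodic_shift:
  fixes F :: "real \<Rightarrow> real"
  assumes "continuous_on UNIV F" "\<And>t. F (t + 2 * pi) = F t" "0 \<le> s" "s \<le> 2 * pi"
  shows "integral {0..2 * pi} (\<lambda>t. F (s + t)) = integral {0..2 * pi} F"
proof -
  have c: "continuous_on S F" for S using assms(1) continuous_on_subset by blast
  have i: "F integrable_on {a..b}" for a b by (rule integrable_continuous_real[OF c])
  have sh: "integral {a..b} (\<lambda>t. F (d + t)) = integral {a + d..b + d} F" for a b d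
    using integral_shift[OF c, of a b d] by (simp add: o_def add.commute)
  have "integral {0..2 * pi} (\<lambda>t. F (s + t)) = integral {s..2 * pi + s} F" using sh[of 0 "2*pi" s] by simp
  also have "\<dots> = integral {s..2 * pi} F + integral {2 * pi..2 * pi + s} F"
    by (rule Henstock_Kurzweil_Integration.integral_combine[symmetric]) (use assms i in auto)
  also have "integral {2 * pi..2 * pi + s} F = integral {0..s} (\<lambda>t. F (2 * pi + t))"
    using sh[of 0 s "2 * pi"] by (simp add: add.commute)
  also have "\<dots> = integral {0..s} F" using assms(2) by (simp add: add.commute)
  also have "integral {s..2 * pi} F + integral {0..s} F = integral {0..2 * pi} F"
    using Henstock_Kurzweil_Integration.integral_combine[of 0 s "2 * pi" F] assms i by simp
  finally show ?thesis .
qed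

lemma abs_set_integral_le:
  fixes f :: "real^2 \<Rightarrow> real"
  assumes "compact L" "\<And>x. x \<in> L \<Longrightarrow> \<bar>f x\<bar> \<le> B" "0 \<le> B"
  shows "\<bar>LINT x:L|lborel. f x\<bar> \<le> B * measure lborel L"
proof -
  have fin: "emeasure lborel L < \<infinity>" using assms(1) emeasure_compact_finite by blast
  have s: "L \<in> sets lborel" using assms(1) borel_compact by auto
  have i: "integrable lborel (\<lambda>x. indicator L x *\<^sub>R B)" using fin s by (intro integrable_scaleR_left integrable_real_indicator) auto
  have "\<bar>LINT x:L|lborel. f x\<bar> \<le> (\<integral>x. norm (indicator L x *\<^sub>R f x) \<partial>lborel)"
    unfolding set_lebesgue_integral_def using integral_norm_bound[of lborel "\<lambda>x. indicator L x *\<^sub>R f x"] by simp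
  also have "\<dots> \<le> (\<integral>x. indicator L x *\<^sub>R B \<partial>lborel)"
    by (rule integral_mono'[OF i]) (use assms in \<open>auto simp: indicator_def\<close>)
  also have "\<dots> = B * measure lborel L" using s by (simp add: mult.commute)
  finally show ?thesis .
qed

lemma set_integral_zero_outside:
  fixes f :: "'a \<Rightarrow> 'b::{banach, second_countable_topology}"
  assumes "K \<subseteq> S" "\<And>x. x \<in> S \<Longrightarrow> x \<notin> K \<Longrightarrow> f x = 0"
  shows "(LINT x:S|M. f x) = (LINT x:K|M. f x)" "set_integrable M S f \<longleftrightarrow> set_integrable M K f"
proof -
  have "(\<lambda>x. indicator S x *\<^sub>R f x) = (\<lambda>x. indicator K x *\<^sub>R f x)"
    using assms by (auto simp: indicator_def fun_eq_iff)
  then show "(LINT x:S|M. f x) = (LINT x:K|M. f x)" "set_integrable M S f \<longleftrightarrow> set_integrable M K f"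
    unfolding set_lebesgue_integral_def set_integrable_def by simp_all
qed

lemma measure_annulus:
  assumes "0 < R" "R \<le> S"
  shows "measure lborel (cball 0 S - ball (0::real^2) R) = pi * (S\<^sup>2 - R\<^sup>2)"
proof -
  have "measure lborel (cball (0::real^2) S - ball 0 R) = measure lborel (cball (0::real^2) S) - measure lborel (ball (0::real^2) R)"
    using assms by (intro measure_Diff emeasure_compact_finite[THEN less_imp_neq]) auto
  moreover have "measure lborel (ball (0::real^2) r) = r\<^sup>2 * pi" if "r \<ge> 0" for r using circle_area[OF that, of 0] .
  moreover have "measure lborel (cball (0::real^2) S) = measure lborel (ball (0::real^2) S)"
    by (simp add: content_cball content_ball assms order.trans[of 0 R S] less_imp_le)
  ultimately show ?thesis using assms by (simp add: algebra_simps)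
qed

lemma small_near_circle:
  fixes g :: "real^2 \<Rightarrow> real"
  assumes R: "0 < R" "R < R1" and g: "continuous_on (cball 0 R1 - ball 0 R) g" "\<And>x. x \<in> sphere 0 R \<Longrightarrow> g x = 0"
    and "e > 0"
  obtains d where "d > 0" "\<And>x. x \<in> cball 0 R1 - ball 0 R \<Longrightarrow> norm x < R + d \<Longrightarrow> \<bar>g x\<bar> \<le> e"
proof -
  let ?K = "cball (0::real^2) R1 - ball 0 R"
  have "compact ?K" by (intro compact_diff) auto
  from compact_uniformly_continuous[OF g(1) this]
  obtain d where d: "d > 0" "\<And>x y. x \<in> ?K \<Longrightarrow> y \<in> ?K \<Longrightarrow> dist y x < d \<Longrightarrow> dist (g y) (g x) < e"
    using \<open>e > 0\<close> unfolding uniformly_continuous_on_def by metis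
  have "\<bar>g x\<bar> \<le> e" if "x \<in> ?K" "norm x < R + d" for x
  proof -
    define y where "y = (R / norm x) *\<^sub>R x"
    have nx: "norm x \<ge> R" using that by auto
    then have "norm x > 0" using R by linarith
    then have y: "norm y = R" using R by (simp add: y_def)
    have "x - y = (1 - R / norm x) *\<^sub>R x" by (simp add: y_def algebra_simps)
    then have "norm (x - y) = \<bar>1 - R / norm x\<bar> * norm x" by simp
    also have "\<dots> = norm x - R" using nx R \<open>norm x > 0\<close> by (simp add: abs_of_nonneg field_simps)
    finally have "dist x y < d" using that by (simp add: dist_norm)
    then have "dist (g x) (g y) < e" using d(2)[of y x] that(1) y R by auto
    then show ?thesis using g(2)[of y] y by simp
  qed
  then show ?thesis using that d(1) by blast
qed

text \<open>The weights \<open>n s(n(|x|\<^sup>2 - R\<^sup>2))\<close> are concentrated near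
  the circle with bounded total mass: they live on an annulus of area
  \<open>2 \<pi> / n\<close>. They arise as derivatives of cutoff functions near the body. A
  function vanishing on the circle is uniformly small on these annuli.\<close>

lemma layer_limit:
  fixes g :: "real^2 \<Rightarrow> real"
  assumes R: "0 < R" "R < R1" and g: "continuous_on (cball 0 R1 - ball 0 R) g" "\<And>x. x \<in> sphere 0 R \<Longrightarrow> g x = 0"
    and s: "\<And>t. \<bar>s t\<bar> \<le> M" "\<And>t. t \<notin> {1..2} \<Longrightarrow> s t = (0::real)"
  shows "(\<lambda>n. LINT x:cball 0 R1 - ball 0 R|lborel. real n * s (real n * (x \<bullet> x - R\<^sup>2)) * g x) \<longlonglongrightarrow> 0"
proof (rule LIMSEQ_I)
  let ?K = "cball (0::real^2) R1 - ball 0 R"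
  fix e :: real assume "0 < e"
  have M: "M \<ge> 0" using s(1)[of 0] by linarith
  \<comment> \<open>the total mass of the weights is at most \<open>2 \<pi> M\<close>\<close>
  define e' where "e' = e / (2 * pi * (M + 1) + 1)"
  have e': "e' > 0" "e' * (2 * pi * M) < e"
  proof -
    have p: "2 * pi * (M + 1) + 1 > 0" using M by (simp add: add_nonneg_pos)
    then show "e' > 0" using \<open>0 < e\<close> by (simp add: e'_def)
    have "e' * (2 * pi * M) < e' * (2 * pi * (M + 1) + 1)"
      using \<open>e' > 0\<close> by (intro mult_strict_left_mono) (auto simp: algebra_simps add_pos_pos)
    also have "\<dots> = e" using p by (simp add: e'_def)
    finally show "e' * (2 * pi * M) < e" .
  qed
  obtain d where d: "d > 0" and gs: "\<And>x. x \<in> ?K \<Longrightarrow> norm x < R + d \<Longrightarrow> \<bar>g x\<bar> \<le> e'"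
    using small_near_circle[OF R g e'(1)] by metis
  obtain N where N: "real N > 1 / (R * d)" "real N > 2 / (R1\<^sup>2 - R\<^sup>2)" "N > 0"
  proof -
    obtain N where "real N > max (1 / (R * d)) (max (2 / (R1\<^sup>2 - R\<^sup>2)) 0)" using reals_Archimedean2 by blast
    then show ?thesis by (intro that[of N]) auto
  qed
  have RR: "R1\<^sup>2 - R\<^sup>2 > 0" using R by (simp add: power_strict_mono)
  show "\<exists>no. \<forall>n\<ge>no. norm ((LINT x:?K|lborel. real n * s (real n * (x \<bullet> x - R\<^sup>2)) * g x) - 0) < e"
  proof (intro exI allI impI)
    fix n assume "n \<ge> N"
    then have n: "real n > 1 / (R * d)" "real n > 2 / (R1\<^sup>2 - R\<^sup>2)" "n > 0" using N by (auto intro: less_le_trans)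
    \<comment> \<open>outside the disc of radius \<open>S\<close> the weight vanishes, as its
      argument exceeds \<open>2\<close>\<close>
    define S where "S = sqrt (R\<^sup>2 + 2 / real n)"
    have S2: "S\<^sup>2 = R\<^sup>2 + 2 / real n" "S \<ge> 0" by (auto simp: S_def)
    have SR: "R < S" unfolding S_def using R n(3) by (intro real_less_rsqrt) auto
    have "2 < real n * (R1\<^sup>2 - R\<^sup>2)" using n(2) RR by (simp only: pos_divide_less_eq)
    then have "2 / real n < R1\<^sup>2 - R\<^sup>2" using n(3) by (simp add: pos_divide_less_eq mult_ac)
    then have "S\<^sup>2 \<le> R1\<^sup>2" unfolding S2(1) by linarith
    then have SR1: "S \<le> R1" by (rule power2_le_imp_le) (use R in linarith)
    have Sd: "S < R + d"
    proof (rule power2_less_imp_less)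
      have "R * d > 0" using R d by simp
      then have "1 < real n * (R * d)" using n(1) by (simp only: pos_divide_less_eq)
      then have "2 / real n < 2 * R * d" using n(3) by (simp add: pos_divide_less_eq mult_ac)
      also have "\<dots> \<le> 2 * R * d + d\<^sup>2" by simp
      finally show "S\<^sup>2 < (R + d)\<^sup>2" unfolding S2 by (simp add: power2_sum algebra_simps)
    qed (use R d in auto)
    let ?L = "cball (0::real^2) S - ball 0 R"
    let ?f = "\<lambda>x. real n * s (real n * (x \<bullet> x - R\<^sup>2)) * g x"
    have z: "?f x = 0" if "x \<in> ?K" "x \<notin> ?L" for x
    proof -
      have "norm x > S" using that by auto
      then have "x \<bullet> x > S\<^sup>2" using S2(2) by (simp add: dot_square_norm power_strict_mono)
      then have "real n * (x \<bullet> x - R\<^sup>2) > 2" using S2(1) n(3) by (simp add: field_simps)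
      then show ?thesis using s(2) by auto
    qed
    have "\<bar>LINT x:?K|lborel. ?f x\<bar> = \<bar>LINT x:?L|lborel. ?f x\<bar>"
      by (subst set_integral_zero_outside(1)[of ?L ?K]) (use z SR1 in auto)
    also have "\<dots> \<le> (real n * M * e') * measure lborel ?L"
    proof (rule abs_set_integral_le)
      show "compact ?L" by (intro compact_diff) auto
      show "\<bar>?f x\<bar> \<le> real n * M * e'" if "x \<in> ?L" for x
        unfolding abs_mult using gs[of x] that SR1 Sd s(1) M by (intro mult_mono) auto
    qed (use M e' in auto)
    also have "\<dots> = e' * (2 * pi * M)"
      unfolding measure_annulus[OF R(1) less_imp_le[OF SR]] S2 using n(3) by simp
    also have "\<dots> < e" by (rule e')
    finally show "norm ((LINT x:?K|lborel. ?f x) - 0) < e" by simp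
  qed
qed

text \<open>The weights are invariant under rotations, so only the average of \<open>g\<close>
  over rotations contributes, and it vanishes on the circle. With the tangential component of a
  one-form for \<open>g\<close> this average is the circulation.\<close>

lemma layer_limit_circulation:
  fixes g :: "real^2 \<Rightarrow> real"
  assumes R: "0 < R" "R < R1" and g: "continuous_on (cball 0 R1 - ball 0 R) g"
    and circ: "\<And>x. x \<in> sphere 0 R \<Longrightarrow> integral {0..2 * pi} (\<lambda>t. g (rot t x)) = 0"
    and s: "\<And>t. \<bar>s t\<bar> \<le> M" "\<And>t. t \<notin> {1..2} \<Longrightarrow> s t = (0::real)" "continuous_on UNIV s"
  shows "(\<lambda>n. LINT x:cball 0 R1 - ball 0 R|lborel. real n * s (real n * (x \<bullet> x - R\<^sup>2)) * g x) \<longlonglongrightarrow> 0"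
proof -
  let ?K = "cball (0::real^2) R1 - ball 0 R"
  define gb where "gb x = integral {0..2 * pi} (\<lambda>t. g (rot t x))" for x
  have K: "compact ?K" by (intro compact_diff) auto
  have cgb: "continuous_on ?K gb"
  proof -
    have "continuous_on (?K \<times> cbox 0 (2 * pi)) (\<lambda>(x, t). g (rot t x))"
      unfolding case_prod_beta
      by (rule continuous_on_compose2[OF g]) (auto intro!: continuous_on_rot continuous_intros)
    from integral_continuous_on_param[OF this] show ?thesis by (simp add: gb_def[abs_def])
  qed
  have "(\<lambda>n. LINT x:?K|lborel. real n * s (real n * (x \<bullet> x - R\<^sup>2)) * gb x) \<longlonglongrightarrow> 0"
    by (rule layer_limit[OF R cgb _ s(1,2)]) (simp_all add: gb_def circ)
  then have lim: "(\<lambda>n. (LINT x:?K|lborel. real n * s (real n * (x \<bullet> x - R\<^sup>2)) * gb x) / (2 * pi)) \<longlonglongrightarrow> 0"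
    using tendsto_divide_zero by blast
  obtain N where N: "real N > 2 / (R1\<^sup>2 - R\<^sup>2)" using reals_Archimedean2 by blast
  have RR: "R1\<^sup>2 - R\<^sup>2 > 0" using R by (simp add: power_strict_mono)
  show ?thesis
  proof (rule Lim_transform_eventually[OF lim], rule eventually_sequentiallyI[of N])
    fix n assume "N \<le> n"
    then have n: "real n > 2 / (R1\<^sup>2 - R\<^sup>2)" using N by (auto intro: less_le_trans)
    then have n0: "n > 0" using RR by (metis divide_pos_pos of_nat_0_less_iff order_less_trans zero_less_numeral)
    have nR: "R\<^sup>2 + 2 / real n < R1\<^sup>2" using n n0 RR by (simp add: field_simps)
    let ?\<rho> = "\<lambda>x::real^2. real n * s (real n * (x \<bullet> x - R\<^sup>2))"
    define h where "h x = (if x \<in> ?K then ?\<rho> x * g x else 0)" for x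
    have rz: "?\<rho> x = 0" if "x \<bullet> x < R\<^sup>2 + 1 / real n \<or> x \<bullet> x > R\<^sup>2 + 2 / real n" for x
    proof -
      have "real n * (x \<bullet> x - R\<^sup>2) < 1 \<or> real n * (x \<bullet> x - R\<^sup>2) > 2"
        using that n0 by (simp add: field_simps)
      then show ?thesis using s(2) by auto
    qed
    have c\<rho>: "continuous_on S ?\<rho>" for S
      by (intro continuous_intros continuous_on_compose2[OF s(3)]) auto
    \<comment> \<open>on \<open>?V\<close> the integrand is a product of continuous functions,
      on \<open>?W\<close> it is zero, and the two sets cover the plane: extended by zero, the
      integrand is continuous\<close>
    let ?V = "{x::real^2. R\<^sup>2 < x \<bullet> x} \<inter> {x. x \<bullet> x < R1\<^sup>2}"
    let ?W = "{x::real^2. x \<bullet> x < R\<^sup>2 + 1 / real n} \<union> {x. R\<^sup>2 + 2 / real n < x \<bullet> x}"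
    have VK: "?V \<subseteq> ?K"
      using R by (auto simp: dot_square_norm) (smt (verit) power2_less_imp_less power_mono norm_ge_zero)+
    have oV: "open ?V" "open ?W" by (intro open_Int open_Un open_Collect_less continuous_intros)+
    have "continuous_on ?V h"
    proof (rule continuous_on_eq)
      show "continuous_on ?V (\<lambda>x. ?\<rho> x * g x)"
        by (intro continuous_intros c\<rho> continuous_on_subset[OF g VK])
    qed (use VK in \<open>auto simp: h_def\<close>)
    moreover have "continuous_on ?W h"
      by (rule continuous_on_eq[of _ "\<lambda>x. 0"]) (use rz in \<open>auto simp: h_def\<close>)
    ultimately have "continuous_on (?V \<union> ?W) h" using continuous_on_open_Un[OF oV] by blast
    moreover have "?V \<union> ?W = UNIV"
    proof -
      have "0 < 1 / real n" using n0 by simp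
      then have "x \<in> ?V \<union> ?W" for x :: "real^2" using nR unfolding Un_iff Int_iff mem_Collect_eq by linarith
      then show ?thesis by blast
    qed
    ultimately have ch: "continuous_on UNIV h" by simp
    have hz: "h x = 0" if "x \<notin> cball 0 R1" for x using that by (simp add: h_def)
    have hr: "integral {0..2 * pi} (\<lambda>t. h (rot t x)) = (if x \<in> ?K then ?\<rho> x * gb x else 0)" for x
      by (auto simp: h_def gb_def)
    have LI: "(LINT x:?K|lborel. k x) = integral (cball 0 R1) (\<lambda>x. if x \<in> ?K then k x else 0)"
      if "continuous_on ?K k" for k :: "real^2 \<Rightarrow> real"
    proof -
      have "set_integrable lborel ?K k" unfolding set_integrable_def by (rule borel_integrable_compact[OF K that])
      from set_borel_integral_eq_integral(2)[OF this]
      have "(LINT x:?K|lborel. k x) = integral ?K k" .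
      also have "\<dots> = integral (cball 0 R1) (\<lambda>x. if x \<in> ?K then k x else 0)"
        by (simp only: integral_restrict_Int Int_absorb1[OF Diff_subset] Int_absorb2[OF Diff_subset])
      finally show ?thesis .
    qed
    have "2 * pi * (LINT x:?K|lborel. ?\<rho> x * g x) = 2 * pi * integral (cball 0 R1) h"
      unfolding h_def by (subst LI) (intro continuous_intros c\<rho> g | simp)+
    also have "\<dots> = integral (cball 0 R1) (\<lambda>x. integral {0..2 * pi} (\<lambda>t. h (rot t x)))"
      by (rule rot_average[OF ch hz])
    also have "\<dots> = integral (cball 0 R1) (\<lambda>x. if x \<in> ?K then ?\<rho> x * gb x else 0)"
      by (simp only: hr)
    also have "\<dots> = (LINT x:?K|lborel. ?\<rho> x * gb x)"
      by (rule LI[symmetric]) (intro continuous_intros c\<rho> cgb)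
    finally have "2 * pi * (LINT x:?K|lborel. ?\<rho> x * g x) = (LINT x:?K|lborel. ?\<rho> x * gb x)" .
    moreover have "b / (2 * pi) = a" if "2 * pi * a = b" for a b :: real using that by auto
    ultimately show "(LINT x:?K|lborel. ?\<rho> x * gb x) / (2 * pi) = (LINT x:?K|lborel. ?\<rho> x * g x)" by blast
  qed
qed

text \<open>The function is dominated by a sum of constants on dyadic discs. On the
  \<open>n\<close>-th disc, of area proportional to \<open>4\<^sup>n\<close>, the constant is
  proportional to \<open>8\<close> to the power \<open>-n\<close>, so that the integrals form a
  geometric series.\<close>

lemma integrable_inverse_cube:
  assumes "r > 0"
  shows "integrable lborel (\<lambda>x::real^2. indicator {x. r \<le> norm x} x / norm x ^ 3)"
proof -
  define f where "f n x = indicator (cball 0 (r * 2 ^ (n+1))) x *\<^sub>R (1 / (r * 2 ^ n) ^ 3)" for n and x :: "real^2"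
  have fi: "integrable lborel (f n)" for n unfolding f_def
    by (intro integrable_scaleR_left integrable_real_indicator) (use emeasure_compact_finite[OF compact_cball, of 0 "r * (2 * 2 ^ n)"] in auto)
  have nn: "0 \<le> f n x" for n x using assms by (simp add: f_def)
  have fint: "(\<integral>x. norm (f n x) \<partial>lborel) = (4 * pi / r) * (1/2) ^ n" for n
  proof -
    have m: "measure lborel (cball (0::real^2) (r * 2 ^ (n+1))) = (r * 2 ^ (n+1))\<^sup>2 * pi"
      using circle_area[of "r * 2 ^ (n+1)" 0] assms by (simp add: content_cball content_ball)
    have "(\<integral>x. norm (f n x) \<partial>lborel) = (\<integral>x. f n x \<partial>lborel)" using nn by simp
    also have "\<dots> = (r * 2 ^ (n+1))\<^sup>2 * pi * (1 / (r * 2 ^ n) ^ 3)" unfolding f_def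
      by (simp add: m[simplified])
    also have "\<dots> = (4 * pi / r) * (1/2) ^ n"
      using assms by (simp add: field_simps power2_eq_square power3_eq_cube)
    finally show ?thesis .
  qed
  have sm: "summable (\<lambda>n. f n x)" for x
  proof (rule summable_comparison_test')
    show "summable (\<lambda>n. (1 / r ^ 3) * (1/8::real) ^ n)" by (intro summable_mult summable_geometric) auto
    have "(8::real) ^ n = (2 ^ n) ^ 3" for n by (simp add: power_mult[symmetric] mult.commute[of n] power_mult)
    then show "norm (f n x) \<le> (1 / r ^ 3) * (1/8) ^ n" for n
      using assms by (simp add: f_def indicator_def power_mult_distrib power_divide)
  qed
  have "integrable lborel (\<lambda>x. \<Sum>n. f n x)"
  proof (rule integrable_suminf[OF fi])
    show "AE x in lborel. summable (\<lambda>n. norm (f n x))" using sm nn by simp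
    show "summable (\<lambda>n. \<integral>x. norm (f n x) \<partial>lborel)" unfolding fint by (intro summable_mult summable_geometric) auto
  qed
  then show ?thesis
  proof (rule Bochner_Integration.integrable_bound)
    have "closed {x::real^2. r \<le> norm x}" by (intro closed_Collect_le continuous_intros)
    then have [measurable]: "{x::real^2. r \<le> norm x} \<in> sets borel" by auto
    show "(\<lambda>x::real^2. indicator {x. r \<le> norm x} x / norm x ^ 3) \<in> borel_measurable lborel" by simp
    show "AE x::real^2 in lborel. norm (indicator {x. r \<le> norm x} x / norm x ^ 3) \<le> norm (\<Sum>n. f n x)"
    proof (rule AE_I2)
      fix x :: "real^2"
      show "norm (indicator {x. r \<le> norm x} x / norm x ^ 3) \<le> norm (\<Sum>n. f n x)"
      proof (cases "r \<le> norm x")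
        case True
        have "\<exists>n. norm x / r < 2 ^ n" by (rule real_arch_pow) simp
        then obtain n0 where "norm x / r < 2 ^ n0" by blast
        then have "norm x < r * 2 ^ n0" using assms by (simp add: pos_divide_less_eq mult.commute)
        also have "\<dots> \<le> r * 2 ^ (n0 + 1)" using assms by simp
        finally have n0: "norm x < r * 2 ^ (n0 + 1)" .
        \<comment> \<open>the dyadic annulus that contains \<open>x\<close>\<close>
        define n where "n = (LEAST n. norm x < r * 2 ^ (n + 1))"
        have n1: "norm x < r * 2 ^ (n + 1)" unfolding n_def by (rule LeastI[of _ n0]) (use n0 in simp)
        have n2: "r * 2 ^ n \<le> norm x"
        proof (cases n)
          case (Suc k)
          then show ?thesis using not_less_Least[of k "\<lambda>n. norm x < r * 2 ^ (n + 1)"] n_def by auto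
        qed (use True in simp)
        have "1 / norm x ^ 3 \<le> f n x"
        proof -
          have "norm x > 0" using True assms by linarith
          have "(r * 2 ^ n) ^ 3 \<le> norm x ^ 3" using n2 assms by (intro power_mono) auto
          then have "1 / norm x ^ 3 \<le> 1 / (r * 2 ^ n) ^ 3" using assms by (intro divide_left_mono) (use \<open>norm x > 0\<close> in auto)
          then show ?thesis using n1 by (simp add: f_def)
        qed
        also have "\<dots> \<le> (\<Sum>n. f n x)" using sum_le_suminf[OF sm[of x], of "{n}"] nn by simp
        finally show ?thesis using True by simp
      qed simp
    qed
  qed
qed

section \<open>Pairing the momentum with a Hamiltonian field\<close>

lemma continuous_on_compact_bound:
  assumes "compact K" "continuous_on K g"
  obtains M where "\<And>x. x \<in> K \<Longrightarrow> norm (g x) \<le> M"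
proof -
  have "bounded (g ` K)" by (rule compact_imp_bounded[OF compact_continuous_image[OF assms(2,1)]])
  then obtain M where "\<forall>y\<in>g ` K. norm y \<le> M" unfolding bounded_iff by (elim exE)
  then show ?thesis by (intro that[of M]) blast
qed

lemma smooth_derivative_bounded:
  fixes \<sigma> :: "real \<Rightarrow> real"
  assumes "smooth_on UNIV \<sigma>" "\<And>t. t \<le> 1 \<Longrightarrow> \<sigma> t = 0" "\<And>t. t \<ge> 2 \<Longrightarrow> \<sigma> t = 1"
  obtains s M where "\<And>t. (\<sigma> has_real_derivative s t) (at t)" "continuous_on UNIV s"
    "\<And>t. \<bar>s t\<bar> \<le> M" "\<And>t. t \<notin> {1..2} \<Longrightarrow> s t = 0"
proof -
  define s where "s t = frechet_derivative \<sigma> (at t) 1" for t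
  have D: "(\<sigma> has_real_derivative s t) (at t)" for t
  proof -
    have d: "(\<sigma> has_derivative frechet_derivative \<sigma> (at t)) (at t)"
      by (rule smooth_on_has_derivative[OF assms(1)]) simp
    have "frechet_derivative \<sigma> (at t) h = s t * h" for h
      using linear_scale[OF has_derivative_linear[OF d], of h 1] by (simp add: s_def)
    then show ?thesis unfolding has_field_derivative_def
      by (intro has_derivative_eq_rhs[OF d]) (simp add: fun_eq_iff)
  qed
  have c: "continuous_on UNIV s"
    using smooth_on_imp_continuous_on[OF smooth_on_deriv[OF assms(1)]] by (simp add: s_def[abs_def])
  have z: "s t = 0" if "t \<notin> {1..2}" for t
  proof (cases "t < 1")
    case True
    have "(\<sigma> has_real_derivative 0) (at t)"
      by (rule has_field_derivative_transform_within_open[of "\<lambda>_. 0" _ _ "{..<1}"]) (use assms(2) True in auto)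
    then show ?thesis using D DERIV_unique by blast
  next
    case False
    then have "t > 2" using that by auto
    have "(\<sigma> has_real_derivative 0) (at t)"
      by (rule has_field_derivative_transform_within_open[of "\<lambda>_. 1" _ _ "{2<..}"]) (use assms(3) \<open>t > 2\<close> in auto)
    then show ?thesis using D DERIV_unique by blast
  qed
  obtain M where M: "\<And>t. t \<in> {1..2} \<Longrightarrow> norm (s t) \<le> M"
    by (rule continuous_on_compact_bound[OF compact_Icc continuous_on_subset[OF c subset_UNIV]]) (rule that)
  have "\<bar>s t\<bar> \<le> \<bar>M\<bar>" for t using M[of t] z[of t] by (cases "t \<in> {1..2}") auto
  then show ?thesis using that D c z by blast
qed

locale vortex_momentum =
  fixes R :: real and \<Gamma> :: "real^'n" and xb :: "(real^2)^'n" and \<alpha> :: "real^2 \<Rightarrow> real^2"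
  assumes R: "R > 0" and xb: "\<And>i. xb $ i \<in> interior (fluid R)" and mom: "represents_momentum R \<Gamma> xb \<alpha>"
begin

lemma fluidR: "fluid R = - ball 0 R" "interior (fluid R) = - cball 0 R"
  using R by (simp_all add: fluid_eq interior_exterior)

lemma momentum_integrable_compact:
  assumes "compact K" "K \<subseteq> - ball 0 R" "continuous_on K g"
  shows "set_integrable lborel K (\<lambda>x. \<alpha> x \<bullet> g x)"
proof -
  have i: "set_integrable lborel K \<alpha>"
    using conjunct1[OF conjunct2[OF mom[unfolded represents_momentum_def]]] assms(1,2) fluidR(1) by simp
  obtain M where M: "\<And>x. x \<in> K \<Longrightarrow> norm (g x) \<le> M"
    using continuous_on_compact_bound[OF assms(1,3)] by metis
  have m1: "(\<lambda>x. indicator K x *\<^sub>R \<alpha> x) \<in> borel_measurable lborel"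
    using i unfolding set_integrable_def by auto
  have m2: "(\<lambda>x. indicator K x *\<^sub>R g x) \<in> borel_measurable lborel"
    using borel_measurable_continuous_on_indicator[OF borel_compact[OF assms(1)] assms(3)] by simp
  have e: "(\<lambda>x. indicator K x *\<^sub>R (\<alpha> x \<bullet> g x)) = (\<lambda>x. (indicator K x *\<^sub>R \<alpha> x) \<bullet> (indicator K x *\<^sub>R g x))"
    by (auto simp: indicator_def)
  have "integrable lborel (\<lambda>x. M *\<^sub>R norm (indicator K x *\<^sub>R \<alpha> x))"
    using i unfolding set_integrable_def by (intro integrable_scaleR_right integrable_norm)
  then show ?thesis unfolding set_integrable_def e
  proof (rule Bochner_Integration.integrable_bound)
    show "(\<lambda>x. (indicator K x *\<^sub>R \<alpha> x) \<bullet> (indicator K x *\<^sub>R g x)) \<in> borel_measurable lborel"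
      using m1 m2 by (rule borel_measurable_inner)
    show "AE x in lborel. norm ((indicator K x *\<^sub>R \<alpha> x) \<bullet> (indicator K x *\<^sub>R g x)) \<le> norm (M *\<^sub>R norm (indicator K x *\<^sub>R \<alpha> x))"
    proof (rule AE_I2)
      fix x
      show "norm ((indicator K x *\<^sub>R \<alpha> x) \<bullet> (indicator K x *\<^sub>R g x)) \<le> norm (M *\<^sub>R norm (indicator K x *\<^sub>R \<alpha> x))"
      proof (cases "x \<in> K")
        case True
        have "\<bar>\<alpha> x \<bullet> g x\<bar> \<le> norm (\<alpha> x) * norm (g x)" by (rule Cauchy_Schwarz_ineq2)
        also have "\<dots> \<le> norm (\<alpha> x) * \<bar>M\<bar>" using M[OF True] by (intro mult_left_mono) auto
        finally show ?thesis using True by (simp add: mult.commute)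
      qed simp
    qed
  qed
qed

lemma momentum_decay:
  obtains C r where "r > R" "C \<ge> 0" "\<And>x. norm x \<ge> r \<Longrightarrow> norm (\<alpha> x) * norm x \<le> C"
proof -
  obtain C r where "\<forall>x. norm x \<ge> r \<longrightarrow> norm (\<alpha> x) * norm x \<le> C"
    using conjunct1[OF conjunct2[OF conjunct2[OF mom[unfolded represents_momentum_def]]]] by (elim exE)
  then have "norm (\<alpha> x) * norm x \<le> \<bar>C\<bar>" if "norm x \<ge> max r (R + 1)" for x
    using that abs_ge_self[of C] order_trans by fastforce
  then show ?thesis using that[of "max r (R + 1)" "\<bar>C\<bar>"] by fastforce
qed

text \<open>The form decays like \<open>|x|\<^sup>-\<^sup>1\<close> and the field like
  \<open>|x|\<^sup>-\<^sup>2\<close>; near the vortices the form is only locally integrable, which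
  suffices as the field is bounded there.\<close>

lemma momentum_integrable:
  assumes "continuous_on (- ball 0 R) A" "\<And>x. x \<in> - ball 0 R \<Longrightarrow> norm (A x) * (norm x)\<^sup>2 \<le> C"
  shows "set_integrable lborel (fluid R) (\<lambda>x. \<alpha> x \<bullet> A x)"
proof -
  obtain Ca r where r: "r > R" "Ca \<ge> 0" and Ca: "\<And>x. norm x \<ge> r \<Longrightarrow> norm (\<alpha> x) * norm x \<le> Ca"
    using momentum_decay by blast
  let ?K = "\<lambda>s. cball (0::real^2) s - ball 0 R"
  let ?f = "\<lambda>x. indicator (fluid R) x *\<^sub>R (\<alpha> x \<bullet> A x)"
  have Ki: "set_integrable lborel (?K s) (\<lambda>x. \<alpha> x \<bullet> A x)" for s
    by (intro momentum_integrable_compact continuous_on_subset[OF assms(1)]) (auto intro: compact_diff)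
  have meas: "?f \<in> borel_measurable lborel"
  proof (rule borel_measurable_LIMSEQ_metric)
    show "(\<lambda>x. indicator (?K (real n)) x *\<^sub>R (\<alpha> x \<bullet> A x)) \<in> borel_measurable lborel" for n
      using Ki[of "real n"] unfolding set_integrable_def by auto
    fix x :: "real^2"
    obtain N where "norm x \<le> real N" using real_arch_simple by blast
    then have "\<forall>n\<ge>N. indicator (?K (real n)) x *\<^sub>R (\<alpha> x \<bullet> A x) = ?f x"
      unfolding fluidR by (auto simp: indicator_def)
    then show "(\<lambda>n. indicator (?K (real n)) x *\<^sub>R (\<alpha> x \<bullet> A x)) \<longlonglongrightarrow> ?f x"
      by (intro tendsto_eventually) (auto simp: eventually_sequentially)
  qed
  have "integrable lborel (\<lambda>x. norm (indicator (?K r) x *\<^sub>R (\<alpha> x \<bullet> A x)) + (Ca * C) *\<^sub>R (indicator {x. r \<le> norm x} x / norm x ^ 3))"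
    using Ki[of r] r R unfolding set_integrable_def
    by (intro Bochner_Integration.integrable_add integrable_norm integrable_scaleR_right integrable_inverse_cube) auto
  then show ?thesis unfolding set_integrable_def
  proof (rule Bochner_Integration.integrable_bound[OF _ meas], intro AE_I2)
    fix x :: "real^2"
    have "norm (?f x) \<le> norm (indicator (?K r) x *\<^sub>R (\<alpha> x \<bullet> A x)) + (Ca * C) *\<^sub>R (indicator {x. r \<le> norm x} x / norm x ^ 3)"
    proof (cases "r \<le> norm x")
      case True
      then have x: "x \<in> - ball 0 R" "norm x > 0" using r R by auto
      have "norm (\<alpha> x) * norm (A x) * norm x ^ 3 = (norm (\<alpha> x) * norm x) * (norm (A x) * (norm x)\<^sup>2)"
        by (simp add: power2_eq_square power3_eq_cube)
      also have "\<dots> \<le> Ca * C" using Ca[OF True] assms(2)[OF x(1)] r by (intro mult_mono) auto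
      finally have "norm (\<alpha> x) * norm (A x) \<le> Ca * C / norm x ^ 3" using x(2) by (simp add: pos_le_divide_eq)
      then have "\<bar>\<alpha> x \<bullet> A x\<bar> \<le> Ca * C / norm x ^ 3" using Cauchy_Schwarz_ineq2[of "\<alpha> x" "A x"] by linarith
      moreover from this have "0 \<le> Ca * C / norm x ^ 3" by linarith
      ultimately show ?thesis using True by (auto simp: indicator_def)
    next
      case False
      then show ?thesis unfolding fluidR by (simp add: indicator_def)
    qed
    then show "norm (?f x) \<le> norm (norm (indicator (?K r) x *\<^sub>R (\<alpha> x \<bullet> A x)) + (Ca * C) *\<^sub>R (indicator {x. r \<le> norm x} x / norm x ^ 3))"
      by simp
  qed
qed

lemma momentum_continuous_near_body:
  obtains R1 where "R < R1" "continuous_on (cball 0 R1 - ball 0 R) \<alpha>"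
proof -
  \<comment> \<open>at most half way between the circle and each vortex, so that the annulus
    contains no vortices\<close>
  define R1 where "R1 = Min (range (\<lambda>i. (R + norm (xb $ i)) / 2))"
  have n: "norm (xb $ i) > R" for i using xb[of i] by (simp add: fluidR(2))
  have fin: "finite (range (\<lambda>i. (R + norm (xb $ i)) / 2))" by simp
  have "R1 > R" unfolding R1_def using R n fin by (subst Min_gr_iff) auto
  moreover have "R1 \<le> (R + norm (xb $ i)) / 2" for i
    unfolding R1_def by (rule Min_le[OF fin]) blast
  ultimately have R1: "R1 > R" "R1 \<le> (R + norm (xb $ i)) / 2" for i by blast+
  obtain U where U: "open U" "fluid R - range (($) xb) \<subseteq> U" "smooth_on U \<alpha>"
    using conjunct1[OF mom[unfolded represents_momentum_def]] unfolding smooth_near_def by (elim exE conjE)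
  have "cball 0 R1 - ball 0 R \<subseteq> U"
  proof
    fix x :: "real^2" assume x: "x \<in> cball 0 R1 - ball 0 R"
    have "x \<noteq> xb $ i" for i using R1(2)[of i] n[of i] x by auto
    then have "x \<in> fluid R - range (($) xb)" using x unfolding fluidR by auto
    then show "x \<in> U" using U(2) by blast
  qed
  then show ?thesis using that[OF R1(1)] continuous_on_subset[OF smooth_on_imp_continuous_on[OF U(3)]] by blast
qed

text \<open>The circulation condition is a statement about one parametrisation of the circle.
  Starting at an arbitrary point shifts the parameter of a periodic function.\<close>

lemma momentum_circulation:
  assumes "continuous_on (cball 0 R1 - ball 0 R) \<alpha>" "R < R1" "x \<in> sphere 0 R"
  shows "integral {0..2 * pi} (\<lambda>t. area_form (\<alpha> (rot t x)) (rot t x)) = 0"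
proof -
  define F where "F t = \<alpha> (vector [R * cos t, R * sin t]) \<bullet> vector [- R * sin t, R * cos t]" for t
  have nR: "norm (vector [R * cos t, R * sin t] :: real^2) = R" for t
  proof -
    have "vector [R * cos t, R * sin t] = rot t (R *\<^sub>R axis 1 1)" by (simp add: vec2_eq_iff axis_def)
    then show ?thesis using R by simp
  qed
  have F0: "integral {0..2 * pi} F = 0" using mom unfolding represents_momentum_def F_def[abs_def] by (elim conjE)
  have cF: "continuous_on UNIV F" unfolding F_def
    by (intro continuous_intros continuous_on_compose2[OF assms(1)] continuous_on_vector2)
      (use nR assms in auto)
  obtain s where s: "0 \<le> s" "s \<le> 2 * pi" "x $ 1 / R = cos s" "x $ 2 / R = sin s"
  proof -
    have "(x $ 1 / R)\<^sup>2 + (x $ 2 / R)\<^sup>2 = (x \<bullet> x) / R\<^sup>2"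
      by (simp add: inner_vec2 power_divide power2_eq_square add_divide_distrib)
    also have "\<dots> = 1" using assms(3) R by (simp add: dot_square_norm)
    finally show ?thesis using sincos_total_2pi that by (metis less_imp_le)
  qed
  have x: "x $ 1 = R * cos s" "x $ 2 = R * sin s" using s R by (auto simp: field_simps)
  have "area_form (\<alpha> (rot t x)) (rot t x) = - F (s + t)" for t
  proof -
    have "rot t x = vector [R * cos (s + t), R * sin (s + t)]"
      by (simp add: vec2_eq_iff x cos_add sin_add algebra_simps)
    then show ?thesis by (simp add: F_def area_form_def inner_vec2 algebra_simps)
  qed
  then have "integral {0..2 * pi} (\<lambda>t. area_form (\<alpha> (rot t x)) (rot t x)) = - integral {0..2 * pi} (\<lambda>t. F (s + t))"
    by simp
  also have "integral {0..2 * pi} (\<lambda>t. F (s + t)) = 0"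
    using integral_periodic_shift[OF cF _ s(1,2)] F0 by (simp add: F_def)
  finally show ?thesis by simp
qed

text \<open>The vorticity of \<open>\<alpha>\<close> is known against test functions with compact
  support in the open exterior. The function \<open>a\<close> is made such a test function by a
  cutoff \<open>\<zeta> n\<close> in a layer at the body and a cutoff \<open>\<eta> n\<close> on
  the scale \<open>n\<close> far away; the product rule then produces three integrals.
  \<open>T1\<close> tends to the pairing by dominated convergence. \<open>T3\<close> contains the
  derivative of \<open>\<eta> n\<close>: on an area of order \<open>n\<^sup>2\<close> the factors
  \<open>a\<close>, the derivative of the cutoff and \<open>\<alpha> \<bullet> p\<close> are of
  order \<open>1/n\<close>, \<open>1/n\<^sup>2\<close> and \<open>1\<close>, so it is of order
  \<open>1/n\<close>. \<open>T2\<close> contains the derivative of \<open>\<zeta> n\<close>;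
  writing \<open>a = (a - c) + c\<close>, the first part vanishes on the circle, and the
  second one leads to the circulation.\<close>

lemma green_exterior:
  fixes a :: "real^2 \<Rightarrow> real" and A :: "real^2 \<Rightarrow> real^2"
  assumes sm: "smooth_on (- cball 0 R) a"
    and da: "\<And>x. x \<in> - cball 0 R \<Longrightarrow> (a has_derivative area_form (A x)) (at x)"
    and ca: "continuous_on (- ball 0 R) a" and cA: "continuous_on (- ball 0 R) A"
    and bd: "\<And>x. x \<in> sphere 0 R \<Longrightarrow> a x = c"
    and dec: "\<And>x. x \<in> - ball 0 R \<Longrightarrow> \<bar>a x\<bar> * norm x \<le> C" "\<And>x. x \<in> - ball 0 R \<Longrightarrow> norm (A x) * (norm x)\<^sup>2 \<le> C"
  shows "(LINT x:fluid R|lborel. \<alpha> x \<bullet> A x) = (\<Sum>i\<in>UNIV. \<Gamma> $ i * a (xb $ i))"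
proof -
  obtain \<sigma> :: "real \<Rightarrow> real" where \<sigma>: "smooth_on UNIV \<sigma>" "\<And>t. t \<le> 1 \<Longrightarrow> \<sigma> t = 0" "\<And>t. t \<ge> 2 \<Longrightarrow> \<sigma> t = 1"
    "\<And>t. 0 \<le> \<sigma> t" "\<And>t. \<sigma> t \<le> 1" using smooth_step_exists by blast
  obtain s M where s: "\<And>t. (\<sigma> has_real_derivative s t) (at t)" "continuous_on UNIV s"
    "\<And>t. \<bar>s t\<bar> \<le> M" "\<And>t. t \<notin> {1..2} \<Longrightarrow> s t = 0" using smooth_derivative_bounded[OF \<sigma>(1-3)] by blast
  have M0: "M \<ge> 0" using s(3)[of 0] by linarith
  obtain R1 where R1: "R < R1" and c\<alpha>: "continuous_on (cball 0 R1 - ball 0 R) \<alpha>" using momentum_continuous_near_body by blast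
  obtain Ca r where r: "r > R" "Ca \<ge> 0" and Ca: "\<And>x. norm x \<ge> r \<Longrightarrow> norm (\<alpha> x) * norm x \<le> Ca"
    using momentum_decay by blast
  have C0: "C \<ge> 0" using dec(1)[of "R *\<^sub>R axis 1 1"] R by (simp) (smt (verit) abs_ge_zero mult_nonneg_nonneg)
  define \<zeta> where "\<zeta> n x = \<sigma> (real n * (x \<bullet> x - R\<^sup>2))" for n and x :: "real^2"
  define \<eta> where "\<eta> n x = 1 - \<sigma> ((x \<bullet> x) / (real n)\<^sup>2)" for n and x :: "real^2"
  \<comment> \<open>the rotation with \<open>area_form v x = v \<bullet> p x\<close>,
    which turns the tangential component of \<open>\<alpha>\<close> into an inner
    product\<close>
  define p where "p x = (vector [x $ 2, - x $ 1] :: real^2)" for x :: "real^2"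
  have p: "area_form v x = v \<bullet> p x" "norm (p x) = norm x" for v x
    by (simp_all add: p_def area_form_def inner_vec2 norm_eq_sqrt_inner algebra_simps)
  have cp: "continuous_on S p" for S unfolding p_def by (intro continuous_on_vector2 continuous_intros)
  define T1 where "T1 n x = \<zeta> n x * \<eta> n x * (\<alpha> x \<bullet> A x)" for n x
  define T2 where "T2 n x = \<eta> n x * a x * (2 * real n * s (real n * (x \<bullet> x - R\<^sup>2))) * (\<alpha> x \<bullet> p x)" for n x
  define T3 where "T3 n x = - (a x * \<zeta> n x * (2 / (real n)\<^sup>2 * s ((x \<bullet> x) / (real n)\<^sup>2))) * (\<alpha> x \<bullet> p x)" for n x
  define f where "f n x = \<zeta> n x * \<eta> n x * a x" for n x
  have c\<sigma>: "continuous_on UNIV \<sigma>" by (rule smooth_on_imp_continuous_on[OF \<sigma>(1)])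
  have c\<zeta>: "continuous_on S (\<zeta> n)" and c\<eta>: "continuous_on S (\<eta> n)" for S n
    unfolding \<zeta>_def \<eta>_def divide_inverse
    by (intro continuous_intros continuous_on_compose2[OF c\<sigma>] subset_UNIV)+
  have cs: "continuous_on S (\<lambda>x::real^2. s (k * (x \<bullet> x - R\<^sup>2)))" "continuous_on S (\<lambda>x::real^2. s ((x \<bullet> x) / k))" for S k
    unfolding divide_inverse
    by (intro continuous_intros continuous_on_compose2[OF s(2)] subset_UNIV)+
  have \<zeta>0: "\<zeta> n x = 0" "s (real n * (x \<bullet> x - R\<^sup>2)) = 0" if "norm x \<le> R" for n x
  proof -
    have "x \<bullet> x \<le> R\<^sup>2" using that R by (simp add: dot_square_norm power_mono)
    then have "real n * (x \<bullet> x - R\<^sup>2) \<le> 0" by (simp add: mult_nonneg_nonpos)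
    then show "\<zeta> n x = 0" "s (real n * (x \<bullet> x - R\<^sup>2)) = 0" unfolding \<zeta>_def using \<sigma>(2) s(4) by auto
  qed
  have far: "\<eta> n x = 0" "s ((x \<bullet> x) / (real n)\<^sup>2) = 0" if "norm x > 2 * real n" "n > 0" for n x
  proof -
    have "x \<bullet> x > (2 * real n)\<^sup>2"
      unfolding dot_square_norm by (rule power_strict_mono) (use that in auto)
    then have "(x \<bullet> x) / (real n)\<^sup>2 > 4" using that(2) by (simp add: field_simps)
    then show "\<eta> n x = 0" "s ((x \<bullet> x) / (real n)\<^sup>2) = 0" unfolding \<eta>_def using \<sigma>(3) s(4) by auto
  qed
  \<comment> \<open>the distributional identity for the test function
    \<open>f n\<close>\<close>
  have main: "(LINT x:fluid R|lborel. T1 n x) + (LINT x:fluid R|lborel. T2 n x) + (LINT x:fluid R|lborel. T3 n x)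
      = (\<Sum>i\<in>UNIV. \<Gamma> $ i * f n (xb $ i))" if n: "n > 0" for n
  proof -
    let ?V = "- cball (0::real^2) R" let ?W = "{x::real^2. x \<bullet> x < R\<^sup>2 + 1 / real n}"
    have oV: "open ?V" by auto
    have oW: "open ?W" by (intro open_Collect_less continuous_intros)
    have fW: "f n x = 0" if "x \<in> ?W" for x
    proof -
      have "real n * (x \<bullet> x - R\<^sup>2) \<le> 1" using that n by (simp add: field_simps)
      then show ?thesis unfolding f_def \<zeta>_def using \<sigma>(2) by simp
    qed
    \<comment> \<open>\<open>f n\<close> is smooth on the whole plane: away from the body by
      the product rule, and near the body because it is zero there\<close>
    have VW: "?V \<union> ?W = UNIV"
    proof -
      have "x \<in> ?W" if "norm x \<le> R" for x :: "real^2"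
      proof -
        have "x \<bullet> x \<le> R\<^sup>2" unfolding dot_square_norm by (rule power_mono) (use that in auto)
        moreover have "0 < 1 / real n" using n by simp
        ultimately show ?thesis unfolding mem_Collect_eq by linarith
      qed
      then show ?thesis by auto
    qed
    have "smooth_on ?V (f n)" unfolding f_def[abs_def] \<zeta>_def \<eta>_def divide_inverse
      by (intro smooth_on_mult smooth_on_diff smooth_on_const smooth_on_inner smooth_on_id smooth_on_compose_UNIV[OF _ \<sigma>(1)] oV sm)
    moreover have "smooth_on ?W (f n)"
      by (subst smooth_on_cong[OF oW fW]) (auto intro: smooth_on_const oW)
    ultimately have "smooth_on (?V \<union> ?W) (f n)" by (rule smooth_on_Un)
    then have fs: "smooth_on UNIV (f n)" unfolding VW .
    define K where "K = {x::real^2. R\<^sup>2 + 1 / real n \<le> x \<bullet> x} \<inter> cball 0 (2 * real n)"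
    have "closed {x::real^2. R\<^sup>2 + 1 / real n \<le> x \<bullet> x}" by (intro closed_Collect_le continuous_intros)
    then have "compact K" unfolding K_def by (intro closed_Int_compact) auto
    moreover have "K \<subseteq> interior (fluid R)" unfolding K_def fluidR(2) using VW by (auto simp: not_le[symmetric])
    moreover have "f n x = 0" if "x \<notin> K" for x
      using that fW[of x] far(1)[of n x] n unfolding K_def by (auto simp: f_def)
    ultimately have "(LINT x:fluid R|lborel. area_form (\<alpha> x) (grad (f n) x)) = (\<Sum>i\<in>UNIV. \<Gamma> $ i * f n (xb $ i))"
      using conjunct1[OF conjunct2[OF conjunct2[OF conjunct2[OF mom[unfolded represents_momentum_def]]]]] fs by blast
    moreover have "area_form (\<alpha> x) (grad (f n) x) = T1 n x + T2 n x + T3 n x" if "x \<in> fluid R" for x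
    proof (cases "norm x \<le> R")
      case True
      have "x \<in> ?W" using True VW by auto
      have "frechet_derivative (f n) (at x) = frechet_derivative (\<lambda>_. 0) (at x)"
        by (rule frechet_derivative_cong_open[OF oW \<open>x \<in> ?W\<close> fW])
      then have "grad (f n) x = 0" by (simp add: grad_def vec_eq_iff)
      then show ?thesis using \<zeta>0[OF True, of n] by (simp add: T1_def T2_def T3_def area_form_simps)
    next
      case False
      then have x: "x \<in> ?V" by simp
      have D\<sigma>: "((\<lambda>x. \<sigma> (g x)) has_derivative (\<lambda>h. s (g x) * g' h)) (at x)"
        if "(g has_derivative g') (at x)" for g :: "real^2 \<Rightarrow> real" and g'
        using has_derivative_compose[OF that s(1)[unfolded has_field_derivative_def]] .
      have D1: "(\<zeta> n has_derivative (\<lambda>h. s (real n * (x \<bullet> x - R\<^sup>2)) * (real n * (2 * (x \<bullet> h))))) (at x)"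
        unfolding \<zeta>_def[abs_def]
        by (rule D\<sigma>, rule has_derivative_eq_rhs, (rule derivative_intros)+) (simp add: fun_eq_iff inner_commute)
      have D2: "(\<eta> n has_derivative (\<lambda>h. - (s ((x \<bullet> x) / (real n)\<^sup>2) * (2 * (x \<bullet> h) / (real n)\<^sup>2)))) (at x)"
      proof -
        have "((\<lambda>x::real^2. (x \<bullet> x) / (real n)\<^sup>2) has_derivative (\<lambda>h. 2 * (x \<bullet> h) / (real n)\<^sup>2)) (at x)"
          unfolding divide_inverse
          by (rule has_derivative_eq_rhs, (rule derivative_intros)+) (simp add: fun_eq_iff inner_commute)
        from has_derivative_diff[OF has_derivative_const D\<sigma>[OF this]] show ?thesis unfolding \<eta>_def[abs_def] by simp
      qed
      from has_derivative_mult[OF has_derivative_mult[OF D1 D2] da[OF x]]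
      have Df: "(f n has_derivative (\<lambda>h. \<zeta> n x * \<eta> n x * area_form (A x) h +
          (\<zeta> n x * - (s ((x \<bullet> x) / (real n)\<^sup>2) * (2 * (x \<bullet> h) / (real n)\<^sup>2)) +
           s (real n * (x \<bullet> x - R\<^sup>2)) * (real n * (2 * (x \<bullet> h))) * \<eta> n x) * a x)) (at x)"
        unfolding f_def[abs_def] .
      have cov: "area_form (\<alpha> x) (grad (f n) x) = D (- p (\<alpha> x))" if "(f n has_derivative D) (at x)" for D
        using grad_inner[OF that, of "- p (\<alpha> x)"] by (simp add: p_def area_form_def inner_vec2 algebra_simps)
      have "x \<bullet> (- p (\<alpha> x)) = \<alpha> x \<bullet> p x" "area_form (A x) (- p (\<alpha> x)) = \<alpha> x \<bullet> A x"
        by (simp_all add: p_def area_form_def inner_vec2 algebra_simps)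
      then show ?thesis unfolding cov[OF Df] T1_def T2_def T3_def by (simp add: algebra_simps)
    qed
    moreover have "set_integrable lborel (fluid R) (T1 n)" "set_integrable lborel (fluid R) (T2 n)" "set_integrable lborel (fluid R) (T3 n)"
    proof -
      let ?K = "cball (0::real^2) (2 * real n) - ball 0 R"
      have K: "compact ?K" "?K \<subseteq> - ball 0 R" "?K \<subseteq> fluid R" unfolding fluidR by (auto intro: compact_diff)
      have cont: "continuous_on ?K a" "continuous_on ?K A" using K continuous_on_subset ca cA by blast+
      have out: "norm x > 2 * real n" if "x \<in> fluid R" "x \<notin> ?K" for x using that unfolding fluidR by auto
      have e: "k * (u \<bullet> v) = u \<bullet> (k *\<^sub>R v)" for k and u v :: "real^2" by simp
      show "set_integrable lborel (fluid R) (T1 n)"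
        by (subst set_integral_zero_outside(2)[OF K(3)])
          (use out far(1) n in \<open>simp add: T1_def\<close>, unfold T1_def e,
            intro momentum_integrable_compact K continuous_intros c\<zeta> c\<eta> cont)
      show "set_integrable lborel (fluid R) (T2 n)"
        by (subst set_integral_zero_outside(2)[OF K(3)])
          (use out far(1) n in \<open>simp add: T2_def\<close>, unfold T2_def e,
            intro momentum_integrable_compact K continuous_intros c\<eta> cont cs cp)
      show "set_integrable lborel (fluid R) (T3 n)"
        by (subst set_integral_zero_outside(2)[OF K(3)])
          (use out far(2) n in \<open>simp add: T3_def\<close>, unfold T3_def e,
            intro momentum_integrable_compact K continuous_intros c\<zeta> cont cs cp)
    qed
    moreover have "(LINT x:fluid R|lborel. area_form (\<alpha> x) (grad (f n) x)) = (LINT x:fluid R|lborel. T1 n x + T2 n x + T3 n x)"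
      by (rule set_lebesgue_integral_cong) (use calculation(2) in \<open>auto simp: fluid_def\<close>)
    ultimately show ?thesis by (simp add: set_integral_add)
  qed
  have L1: "(\<lambda>n. LINT x:fluid R|lborel. T1 n x) \<longlonglongrightarrow> (LINT x:fluid R|lborel. \<alpha> x \<bullet> A x)"
    unfolding set_lebesgue_integral_def
  proof (rule integral_dominated_convergence[where w = "\<lambda>x. norm (indicator (fluid R) x *\<^sub>R (\<alpha> x \<bullet> A x))"])
    have i: "integrable lborel (\<lambda>x. indicator (fluid R) x *\<^sub>R (\<alpha> x \<bullet> A x))"
      using momentum_integrable[OF cA dec(2)] unfolding set_integrable_def .
    then show m: "(\<lambda>x. indicator (fluid R) x *\<^sub>R (\<alpha> x \<bullet> A x)) \<in> borel_measurable lborel" by auto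
    show "integrable lborel (\<lambda>x. norm (indicator (fluid R) x *\<^sub>R (\<alpha> x \<bullet> A x)))" using i by (rule integrable_norm)
    have e: "(\<lambda>x. indicator (fluid R) x *\<^sub>R T1 n x) = (\<lambda>x. (\<zeta> n x * \<eta> n x) * (indicator (fluid R) x *\<^sub>R (\<alpha> x \<bullet> A x)))" for n
      by (auto simp: T1_def)
    show "(\<lambda>x. indicator (fluid R) x *\<^sub>R T1 n x) \<in> borel_measurable lborel" for n unfolding e
      using borel_measurable_continuous_onI[OF c\<zeta>] borel_measurable_continuous_onI[OF c\<eta>] m
      by (intro borel_measurable_times) auto
    show "AE x in lborel. norm (indicator (fluid R) x *\<^sub>R T1 n x) \<le> norm (indicator (fluid R) x *\<^sub>R (\<alpha> x \<bullet> A x))" for n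
    proof (rule AE_I2)
      fix x
      have "\<bar>\<zeta> n x * \<eta> n x\<bar> \<le> 1 * 1" unfolding abs_mult
        by (intro mult_mono) (use \<sigma>(4,5) in \<open>auto simp: \<zeta>_def \<eta>_def\<close>)
      then have "\<bar>\<zeta> n x * \<eta> n x\<bar> * \<bar>\<alpha> x \<bullet> A x\<bar> \<le> 1 * \<bar>\<alpha> x \<bullet> A x\<bar>" by (intro mult_right_mono) auto
      then show "norm (indicator (fluid R) x *\<^sub>R T1 n x) \<le> norm (indicator (fluid R) x *\<^sub>R (\<alpha> x \<bullet> A x))"
        by (simp add: T1_def abs_mult indicator_def)
    qed
    have "sphere (0::real^2) R \<in> null_sets lborel"
      using negligible_sphere[of "0::real^2" R] by (auto simp: null_sets_completion_iff negligible_iff_null_sets)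
    then have "AE x in lborel. x \<notin> sphere (0::real^2) R" by (rule AE_not_in)
    then show "AE x in lborel. (\<lambda>n. indicator (fluid R) x *\<^sub>R T1 n x) \<longlonglongrightarrow> indicator (fluid R) x *\<^sub>R (\<alpha> x \<bullet> A x)"
    proof eventually_elim
      case (elim x)
      show ?case
      proof (cases "x \<in> fluid R")
        case True
        then have nx: "norm x > R" using elim unfolding fluidR by auto
        then have xx: "x \<bullet> x - R\<^sup>2 > 0" using R by (simp add: dot_square_norm power_strict_mono)
        obtain N where N: "real N > 2 / (x \<bullet> x - R\<^sup>2)" "real N > norm x"
          using reals_Archimedean2[of "max (2 / (x \<bullet> x - R\<^sup>2)) (norm x)"] by auto
        have "T1 n x = \<alpha> x \<bullet> A x" if "n \<ge> N" for n
        proof -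
          have n: "real n > 2 / (x \<bullet> x - R\<^sup>2)" "real n > norm x" using that N by linarith+
          have "real n * (x \<bullet> x - R\<^sup>2) \<ge> 2" using n(1) xx by (simp add: pos_divide_less_eq)
          moreover have "(x \<bullet> x) / (real n)\<^sup>2 \<le> 1" using n(2)
            by (simp add: dot_square_norm divide_le_eq power_mono)
          ultimately show ?thesis unfolding T1_def \<zeta>_def \<eta>_def using \<sigma>(2,3) by simp
        qed
        then show ?thesis by (intro tendsto_eventually) (auto simp: eventually_sequentially)
      qed simp
    qed
  qed
  have L3: "(\<lambda>n. LINT x:fluid R|lborel. T3 n x) \<longlonglongrightarrow> 0"
  proof (rule Lim_null_comparison)
    show "(\<lambda>n. (6 * pi * C * M * Ca) * (1 / real n)) \<longlonglongrightarrow> 0" using tendsto_mult_right_zero[OF lim_1_over_n] .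
    obtain N where N: "real N > r" "N > 0" using reals_Archimedean2[of "max r 0"] by auto
    show "\<forall>\<^sub>F n in sequentially. norm (LINT x:fluid R|lborel. T3 n x) \<le> (6 * pi * C * M * Ca) * (1 / real n)"
    proof (rule eventually_sequentiallyI[of N])
      fix n assume "N \<le> n"
      then have n: "real n > r" "n > 0" using N by auto
      let ?L = "cball (0::real^2) (2 * real n) - ball 0 (real n)"
      have LR: "?L \<subseteq> fluid R" unfolding fluidR using n r by auto
      have z: "T3 n x = 0" if "x \<in> fluid R" "x \<notin> ?L" for x
      proof (cases "norm x > 2 * real n")
        case True then show ?thesis using far(2)[OF True n(2)] by (simp add: T3_def)
      next
        case False
        then have "norm x < real n" using that by auto
        then have "(x \<bullet> x) / (real n)\<^sup>2 < 1" using n by (simp add: dot_square_norm power_strict_mono)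
        then show ?thesis using s(4) by (simp add: T3_def)
      qed
      have "\<bar>LINT x:fluid R|lborel. T3 n x\<bar> = \<bar>LINT x:?L|lborel. T3 n x\<bar>"
        by (subst set_integral_zero_outside(1)[OF LR z]) auto
      also have "\<dots> \<le> ((C / real n) * (2 / (real n)\<^sup>2 * M) * Ca) * measure lborel ?L"
      proof (rule abs_set_integral_le)
        fix x assume x: "x \<in> ?L"
        then have nx: "norm x \<ge> real n" "x \<in> - ball 0 R" using LR unfolding fluidR by auto
        have "\<bar>a x\<bar> * real n \<le> \<bar>a x\<bar> * norm x" using nx by (intro mult_left_mono) auto
        then have "\<bar>a x\<bar> \<le> C / real n" using dec(1)[OF nx(2)] n by (simp add: pos_le_divide_eq)
        moreover have "\<bar>\<zeta> n x\<bar> \<le> 1" using \<sigma>(4,5) by (simp add: \<zeta>_def)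
        moreover have "\<bar>\<alpha> x \<bullet> p x\<bar> \<le> Ca"
          using Cauchy_Schwarz_ineq2[of "\<alpha> x" "p x"] Ca[of x] nx n by (simp add: p)
        ultimately have "\<bar>a x\<bar> * \<bar>\<zeta> n x\<bar> * (2 / (real n)\<^sup>2 * \<bar>s ((x \<bullet> x) / (real n)\<^sup>2)\<bar>) * \<bar>\<alpha> x \<bullet> p x\<bar>
             \<le> (C / real n) * 1 * (2 / (real n)\<^sup>2 * M) * Ca"
          using s(3) M0 C0 r(2) by (intro mult_mono mult_nonneg_nonneg) auto
        then show "\<bar>T3 n x\<bar> \<le> (C / real n) * (2 / (real n)\<^sup>2 * M) * Ca" by (simp add: T3_def abs_mult)
      next
        show "compact ?L" by (intro compact_diff) auto
      qed (use C0 M0 r in auto)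
      also have "measure lborel ?L = pi * (3 * (real n)\<^sup>2)"
        by (subst measure_annulus) (use n in \<open>auto simp: power_mult_distrib\<close>)
      also have "((C / real n) * (2 / (real n)\<^sup>2 * M) * Ca) * (pi * (3 * (real n)\<^sup>2)) = 6 * pi * C * M * Ca * (1 / real n)"
        using n by (simp add: field_simps)
      finally show "norm (LINT x:fluid R|lborel. T3 n x) \<le> (6 * pi * C * M * Ca) * (1 / real n)" by simp
    qed
  qed
  have L2: "(\<lambda>n. LINT x:fluid R|lborel. T2 n x) \<longlonglongrightarrow> 0"
  proof -
    let ?K = "cball (0::real^2) R1 - ball 0 R"
    let ?w = "\<lambda>x. \<alpha> x \<bullet> p x"
    have K: "compact ?K" by (intro compact_diff) auto
    have cw: "continuous_on ?K ?w" by (intro continuous_intros c\<alpha> cp)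
    have caK: "continuous_on ?K a" by (rule continuous_on_subset[OF ca]) auto
    have A1: "(\<lambda>n. LINT x:?K|lborel. real n * s (real n * (x \<bullet> x - R\<^sup>2)) * ((a x - c) * ?w x)) \<longlonglongrightarrow> 0"
      by (rule layer_limit[OF R R1 _ _ s(3,4)]) (use bd in \<open>auto intro!: continuous_intros cw caK\<close>)
    have A2: "(\<lambda>n. LINT x:?K|lborel. real n * s (real n * (x \<bullet> x - R\<^sup>2)) * ?w x) \<longlonglongrightarrow> 0"
      by (rule layer_limit_circulation[OF R R1 cw _ s(3,4,2)])
        (use momentum_circulation[OF c\<alpha> R1] in \<open>simp add: p\<close>)
    have A: "(\<lambda>n. 2 * ((LINT x:?K|lborel. real n * s (real n * (x \<bullet> x - R\<^sup>2)) * ((a x - c) * ?w x)) +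
        c * (LINT x:?K|lborel. real n * s (real n * (x \<bullet> x - R\<^sup>2)) * ?w x))) \<longlonglongrightarrow> 0"
      using tendsto_mult[OF tendsto_const tendsto_add[OF A1 tendsto_mult[OF tendsto_const A2]], of 2 c] by simp
    have RR: "R1\<^sup>2 - R\<^sup>2 > 0" using R R1 by (simp add: power_strict_mono)
    \<comment> \<open>for large \<open>n\<close> the layer lies inside the annulus where
      \<open>\<alpha>\<close> is continuous, and \<open>\<eta> n\<close> is \<open>1\<close>
      on it\<close>
    obtain N where N: "real N > 2 / (R1\<^sup>2 - R\<^sup>2)" "real N > R1"
      using reals_Archimedean2[of "max (2 / (R1\<^sup>2 - R\<^sup>2)) R1"] by auto
    show ?thesis
    proof (rule Lim_transform_eventually[OF A], rule eventually_sequentiallyI[of N])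
      fix n assume "N \<le> n"
      then have n: "real n > 2 / (R1\<^sup>2 - R\<^sup>2)" "real n > R1" using N by linarith+
      have nR: "real n * (R1\<^sup>2 - R\<^sup>2) > 2" using n(1) RR by (simp only: pos_divide_less_eq)
      have z: "T2 n x = 0" if "x \<in> fluid R" "x \<notin> ?K" for x
      proof -
        have "norm x > R1" using that unfolding fluidR by auto
        then have "x \<bullet> x > R1\<^sup>2" using R R1 by (simp add: dot_square_norm power_strict_mono)
        then have "real n * (x \<bullet> x - R\<^sup>2) \<ge> real n * (R1\<^sup>2 - R\<^sup>2)" by (intro mult_left_mono) auto
        then show ?thesis using nR s(4) by (simp add: T2_def)
      qed
      have e: "T2 n x = 2 * (real n * s (real n * (x \<bullet> x - R\<^sup>2)) * ((a x - c) * ?w x) +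
          c * (real n * s (real n * (x \<bullet> x - R\<^sup>2)) * ?w x))" if "x \<in> ?K" for x
      proof -
        have "norm x \<le> real n" using that n by auto
        then have "(x \<bullet> x) / (real n)\<^sup>2 \<le> 1" by (simp add: dot_square_norm divide_le_eq power_mono)
        then have "\<eta> n x = 1" unfolding \<eta>_def using \<sigma>(2) by simp
        then show ?thesis by (simp add: T2_def algebra_simps)
      qed
      have i: "set_integrable lborel ?K g" if "continuous_on ?K g" for g :: "real^2 \<Rightarrow> real"
        unfolding set_integrable_def by (rule borel_integrable_compact[OF K that])
      have "(LINT x:fluid R|lborel. T2 n x) = (LINT x:?K|lborel. T2 n x)"
        by (rule set_integral_zero_outside(1)) (use z fluidR in auto)
      also have "\<dots> = (LINT x:?K|lborel. 2 * (real n * s (real n * (x \<bullet> x - R\<^sup>2)) * ((a x - c) * ?w x) +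
          c * (real n * s (real n * (x \<bullet> x - R\<^sup>2)) * ?w x)))"
        by (rule set_lebesgue_integral_cong) (use e in auto)
      also have "\<dots> = 2 * ((LINT x:?K|lborel. real n * s (real n * (x \<bullet> x - R\<^sup>2)) * ((a x - c) * ?w x)) +
        c * (LINT x:?K|lborel. real n * s (real n * (x \<bullet> x - R\<^sup>2)) * ?w x))"
        by (simp only: set_integral_mult_right, subst set_integral_add)
          (intro i continuous_intros cs cw caK | simp only: set_integral_mult_right)+
      finally show "2 * ((LINT x:?K|lborel. real n * s (real n * (x \<bullet> x - R\<^sup>2)) * ((a x - c) * ?w x)) +
        c * (LINT x:?K|lborel. real n * s (real n * (x \<bullet> x - R\<^sup>2)) * ?w x)) = (LINT x:fluid R|lborel. T2 n x)" by simp
    qed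
  qed
  have Lf: "(\<lambda>n. \<Sum>i\<in>UNIV. \<Gamma> $ i * f n (xb $ i)) \<longlonglongrightarrow> (\<Sum>i\<in>UNIV. \<Gamma> $ i * a (xb $ i))"
  proof (intro tendsto_sum tendsto_mult tendsto_const)
    fix i
    let ?x = "xb $ i"
    have "norm ?x > R" using xb[of i] by (simp add: fluidR(2))
    then have xx: "?x \<bullet> ?x - R\<^sup>2 > 0" using R by (simp add: dot_square_norm power_strict_mono)
    obtain N where N: "real N > 2 / (?x \<bullet> ?x - R\<^sup>2)" "real N > norm ?x"
      using reals_Archimedean2[of "max (2 / (?x \<bullet> ?x - R\<^sup>2)) (norm ?x)"] by auto
    have "f n ?x = a ?x" if "n \<ge> N" for n
    proof -
      have n: "real n > 2 / (?x \<bullet> ?x - R\<^sup>2)" "real n > norm ?x" using that N by linarith+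
      have "real n * (?x \<bullet> ?x - R\<^sup>2) \<ge> 2" using n(1) xx by (simp add: pos_divide_less_eq)
      moreover have "(?x \<bullet> ?x) / (real n)\<^sup>2 \<le> 1" using n(2)
        by (simp add: dot_square_norm divide_le_eq power_mono)
      ultimately show ?thesis unfolding f_def \<zeta>_def \<eta>_def using \<sigma>(2,3) by simp
    qed
    then show "(\<lambda>n. f n ?x) \<longlonglongrightarrow> a ?x" by (intro tendsto_eventually) (auto simp: eventually_sequentially)
  qed
  have "(\<lambda>n. (LINT x:fluid R|lborel. T1 n x) + (LINT x:fluid R|lborel. T2 n x) + (LINT x:fluid R|lborel. T3 n x))
      \<longlonglongrightarrow> (LINT x:fluid R|lborel. \<alpha> x \<bullet> A x) + 0 + 0"
    by (intro tendsto_add L1 L2 L3)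
  moreover have "(\<lambda>n. (LINT x:fluid R|lborel. T1 n x) + (LINT x:fluid R|lborel. T2 n x) + (LINT x:fluid R|lborel. T3 n x))
      \<longlonglongrightarrow> (\<Sum>i\<in>UNIV. \<Gamma> $ i * a (xb $ i))"
    by (rule Lim_transform_eventually[OF Lf]) (use main in \<open>auto intro!: eventually_sequentiallyI[of 1]\<close>)
  ultimately show ?thesis using LIMSEQ_unique by fastforce
qed

end

section \<open>Improper integrals depending on a parameter\<close>

text \<open>A bound for the values on a basis gives a bound for the operator norm; decay of
  derivatives is assumed in each direction separately.\<close>

lemma linear_decay_uniform:
  fixes L :: "'i \<Rightarrow> 'a::euclidean_space \<Rightarrow> 'b::real_normed_vector"
  assumes "\<And>b. b \<in> Basis \<Longrightarrow> \<exists>C. \<forall>i\<in>I. norm (L i b) * s i \<le> C"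
    and "\<And>i. i \<in> I \<Longrightarrow> linear (L i)" and "\<And>i. i \<in> I \<Longrightarrow> 0 \<le> s i"
  shows "\<exists>C\<ge>0. \<forall>i\<in>I. \<forall>w. norm (L i w) * s i \<le> C * norm w"
proof -
  obtain C where C: "\<And>b i. b \<in> Basis \<Longrightarrow> i \<in> I \<Longrightarrow> norm (L i b) * s i \<le> C b"
    using assms(1) by metis
  have "norm (L i w) * s i \<le> (\<Sum>b\<in>Basis. \<bar>C b\<bar>) * norm w" if "i \<in> I" for i w
  proof -
    have l: "linear (L i)" by (rule assms(2)[OF that])
    have "L i w = (\<Sum>b\<in>Basis. (w \<bullet> b) *\<^sub>R L i b)"
      by (subst euclidean_representation[of w, symmetric]) (simp only: linear_sum[OF l] linear_scale[OF l])
    then have "norm (L i w) * s i \<le> (\<Sum>b\<in>Basis. \<bar>w \<bullet> b\<bar> * norm (L i b)) * s i"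
      using norm_sum[of "\<lambda>b. (w \<bullet> b) *\<^sub>R L i b" Basis] assms(3)[OF that] by (intro mult_right_mono) auto
    also have "\<dots> = (\<Sum>b\<in>Basis. \<bar>w \<bullet> b\<bar> * (norm (L i b) * s i))" by (simp add: sum_distrib_right mult.assoc)
    also have "\<dots> \<le> (\<Sum>b\<in>Basis. norm w * \<bar>C b\<bar>)"
    proof (rule sum_mono)
      fix b :: 'a assume b: "b \<in> Basis"
      show "\<bar>w \<bullet> b\<bar> * (norm (L i b) * s i) \<le> norm w * \<bar>C b\<bar>"
        using C[OF b that] Basis_le_norm[OF b, of w] assms(3)[OF that]
        by (intro mult_mono) auto
    qed
    finally show ?thesis by (simp add: sum_distrib_left mult.commute)
  qed
  then show ?thesis by (intro exI[of _ "\<Sum>b\<in>Basis. \<bar>C b\<bar>"]) (simp add: sum_nonneg)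
qed

text \<open>Improper integrals are limits along the integers, which loses nothing since the
  integrands are absolutely integrable. The explicit remainder provides uniform convergence in
  parameters.\<close>

lemma integral_tail:
  fixes k :: "real \<Rightarrow> real"
  assumes "continuous_on {1..} k" "\<And>t. 1 \<le> t \<Longrightarrow> \<bar>k t\<bar> \<le> C / t\<^sup>2"
  shows "convergent (\<lambda>n. integral {1..real (Suc n)} k)"
    and "\<bar>integral {1..real (Suc n)} k - lim (\<lambda>n. integral {1..real (Suc n)} k)\<bar> \<le> C / real (Suc n)"
    and "\<bar>lim (\<lambda>n. integral {1..real (Suc n)} k)\<bar> \<le> C"
proof -
  let ?I = "\<lambda>n. integral {1..real (Suc n)} k"
  have C: "C \<ge> 0" using assms(2)[of 1] by auto
  have i: "k integrable_on {a..b}" if "1 \<le> a" for a b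
    by (rule integrable_continuous_real[OF continuous_on_subset[OF assms(1)]]) (use that in auto)
  have seg: "\<bar>integral {a..b} k\<bar> \<le> C / a" if "1 \<le> a" "a \<le> b" for a b
  proof -
    have h: "((\<lambda>t. C / t\<^sup>2) has_integral (- C / b - - C / a)) {a..b}"
      by (rule fundamental_theorem_of_calculus[OF that(2)])
        (use that in \<open>auto intro!: derivative_eq_intros simp: has_real_derivative_iff_has_vector_derivative[symmetric] power2_eq_square\<close>)
    have "norm (integral {a..b} k) \<le> integral {a..b} (\<lambda>t. C / t\<^sup>2)"
      by (rule integral_norm_bound_integral[OF i[OF that(1)]]) (use h assms(2) that in \<open>auto simp: integrable_on_def\<close>)
    also have "\<dots> = C / a - C / b" using h by (simp add: integral_unique)
    also have "\<dots> \<le> C / a" using C that by simp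
    finally show ?thesis by simp
  qed
  have diff: "\<bar>?I m - ?I n\<bar> \<le> C / real (Suc n)" if "n \<le> m" for m n
  proof -
    have "?I n + integral {real (Suc n)..real (Suc m)} k = ?I m"
      by (rule Henstock_Kurzweil_Integration.integral_combine) (use that i in auto)
    then show ?thesis using seg[of "real (Suc n)" "real (Suc m)"] that by simp
  qed
  have "Cauchy ?I"
  proof (rule CauchyI')
    fix e :: real assume "0 < e"
    obtain N where N: "real N > C / e" using reals_Archimedean2 by blast
    show "\<exists>M. \<forall>m\<ge>M. \<forall>n>m. dist (?I m) (?I n) < e"
    proof (intro exI allI impI)
      fix m n assume mn: "N \<le> m" "m < n"
      have "\<bar>?I n - ?I m\<bar> \<le> C / real (Suc m)" using diff[of m n] mn by simp
      also have "C / real (Suc m) < e"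
      proof -
        have "C / e < real (Suc m)" using N mn by simp
        then show ?thesis using \<open>0 < e\<close> by (simp add: field_simps)
      qed
      finally show "dist (?I m) (?I n) < e" by (simp add: dist_real_def abs_minus_commute)
    qed
  qed
  then show cv: "convergent ?I" by (simp add: Cauchy_convergent_iff)
  then have L: "?I \<longlonglongrightarrow> lim ?I" by (simp add: convergent_LIMSEQ_iff)
  have t: "\<bar>?I n - lim ?I\<bar> \<le> C / real (Suc n)" for n
  proof (rule Lim_bounded)
    show "(\<lambda>m. \<bar>?I n - ?I m\<bar>) \<longlonglongrightarrow> \<bar>?I n - lim ?I\<bar>" by (intro tendsto_intros L)
    show "\<forall>m\<ge>n. \<bar>?I n - ?I m\<bar> \<le> C / real (Suc n)" using diff[of n] by (metis abs_minus_commute)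
  qed
  show "\<bar>?I n - lim ?I\<bar> \<le> C / real (Suc n)" by (rule t)
  show "\<bar>lim ?I\<bar> \<le> C" using t[of 0] by simp
qed

text \<open>Differentiation under the integral is the Leibniz rule on bounded intervals, followed
  by the theorem on sequences whose derivatives converge uniformly. The uniform remainder for the
  derivatives is a hypothesis on \<open>g'\<close>, because the limit of the derivatives may be
  known in closed form.\<close>

lemma has_derivative_improper_integral:
  fixes f :: "'a::euclidean_space \<Rightarrow> real \<Rightarrow> real"
  assumes U: "open U" "convex U"
    and D: "\<And>y t. y \<in> U \<Longrightarrow> 1 \<le> t \<Longrightarrow> ((\<lambda>y. f y t) has_derivative f' y t) (at y)"
    and cf: "\<And>y. y \<in> U \<Longrightarrow> continuous_on {1..} (f y)"
    and cf': "\<And>h. continuous_on (U \<times> {1..}) (\<lambda>(y, t). f' y t h)"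
    and tail: "\<And>n y h. y \<in> U \<Longrightarrow> \<bar>integral {1..real (Suc n)} (\<lambda>t. f' y t h) - g' y h\<bar> \<le> C * norm h / real (Suc n)"
    and conv: "\<And>y. y \<in> U \<Longrightarrow> convergent (\<lambda>n. integral {1..real (Suc n)} (f y))" and y: "y \<in> U"
  shows "((\<lambda>y. lim (\<lambda>n. integral {1..real (Suc n)} (f y))) has_derivative g' y) (at y)"
proof -
  let ?F = "\<lambda>n y. integral {1..real (Suc n)} (f y)"
  let ?F' = "\<lambda>n y h. integral {1..real (Suc n)} (\<lambda>t. f' y t h)"
  have bl: "bounded_linear (f' y t)" if "y \<in> U" "1 \<le> t" for y t using D[OF that] has_derivative_bounded_linear by blast
  have DF: "(?F n has_derivative ?F' n y) (at y within U)" if y: "y \<in> U" for n y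
  proof -
    \<comment> \<open>the derivative as an element of the normed space of bounded operators,
      in which it can be integrated\<close>
    let ?b = "\<lambda>y t. Blinfun (f' y t)"
    have app: "blinfun_apply (?b y t) = f' y t" if "y \<in> U" "1 \<le> t" for y t using bl[OF that] by (simp add: bounded_linear_Blinfun_apply)
    have cb: "continuous_on (U \<times> cbox 1 (real (Suc n))) (\<lambda>(y, t). ?b y t)"
    proof (rule continuous_on_blinfun_componentwise)
      fix i :: 'a
      have "continuous_on (U \<times> cbox 1 (real (Suc n))) (\<lambda>(y, t). f' y t i)"
        by (rule continuous_on_subset[OF cf']) auto
      then show "continuous_on (U \<times> cbox 1 (real (Suc n))) (\<lambda>x. blinfun_apply (case x of (y, t) \<Rightarrow> ?b y t) i)"
        by (rule continuous_on_eq) (auto simp: app)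
    qed
    have L: "(?F n has_derivative integral {1..real (Suc n)} (?b y)) (at y within U)"
      unfolding cbox_interval[symmetric]
    proof (rule leibniz_rule[OF _ _ cb y U(2)])
      show "((\<lambda>y. f y t) has_derivative blinfun_apply (?b y t)) (at y within U)"
        if "y \<in> U" "t \<in> cbox 1 (real (Suc n))" for y t
        using D[of y t] app[of y t] that by (auto intro: has_derivative_at_withinI)
      show "f y integrable_on cbox 1 (real (Suc n))" if "y \<in> U" for y
        by (rule integrable_continuous[OF continuous_on_subset[OF cf[OF that]]]) auto
    qed
    have int: "?b y integrable_on {1..real (Suc n)}"
    proof (rule integrable_continuous_real)
      have "continuous_on {1..real (Suc n)} (\<lambda>t. case (y, t) of (y, t) \<Rightarrow> ?b y t)"
        by (rule continuous_on_compose2[OF cb]) (use y in \<open>auto intro!: continuous_intros\<close>)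
      then show "continuous_on {1..real (Suc n)} (?b y)" by simp
    qed
    have "blinfun_apply (integral {1..real (Suc n)} (?b y)) = ?F' n y"
    proof
      fix h
      have "blinfun_apply (integral {1..real (Suc n)} (?b y)) h = integral {1..real (Suc n)} (\<lambda>t. blinfun_apply (?b y t) h)"
        using integral_linear[OF int blinfun.bounded_linear_left[of h]] by (simp add: o_def)
      also have "\<dots> = ?F' n y h" by (rule Henstock_Kurzweil_Integration.integral_cong) (use app[OF y] in auto)
      finally show "blinfun_apply (integral {1..real (Suc n)} (?b y)) h = ?F' n y h" .
    qed
    then show ?thesis using L by simp
  qed
  have unif: "\<forall>\<^sub>F n in sequentially. \<forall>y\<in>U. \<forall>h::'a. norm (?F' n y h - g' y h) \<le> e * norm h" if "e > 0" for e
  proof -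
    obtain N where N: "real N > C / e" using reals_Archimedean2 by blast
    show ?thesis
    proof (rule eventually_sequentiallyI[of N], intro ballI allI)
      fix n y and h :: 'a assume n: "N \<le> n" and y: "y \<in> U"
      have "C / e < real (Suc n)" using N n by simp
      then have "C / real (Suc n) \<le> e" using that by (simp add: field_simps)
      then have "C / real (Suc n) * norm h \<le> e * norm h" by (intro mult_right_mono) auto
      then show "norm (?F' n y h - g' y h) \<le> e * norm h" using tail[OF y, of n h] by simp
    qed
  qed
  have lim: "(\<lambda>n. ?F n y) \<longlonglongrightarrow> lim (\<lambda>n. ?F n y)" using conv[OF y] by (simp add: convergent_LIMSEQ_iff)
  obtain g where g: "\<And>y. y \<in> U \<Longrightarrow> (\<lambda>n. ?F n y) \<longlonglongrightarrow> g y \<and> (g has_derivative g' y) (at y within U)"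
    using has_derivative_sequence[OF U(2) DF unif y lim] by blast
  have "(g has_derivative g' y) (at y)" using g[OF y] U(1) y at_within_open by metis
  moreover have "g x = lim (\<lambda>n. ?F n x)" if "x \<in> U" for x using limI[OF conjunct1[OF g[OF that]]] by simp
  ultimately show ?thesis by (rule has_derivative_transform_within_open[OF _ U(1) y])
qed

section \<open>Smooth families of embeddings\<close>

locale fluid_family =
  fixes R :: real and q :: "real \<times> real \<Rightarrow> se2 \<times> (real^2 \<Rightarrow> real^2)"
  assumes R: "R > 0" and fam: "smooth_family R q"
begin

text \<open>Points of \<open>Dom\<close> are pairs of a parameter and a particle. The letter
  \<open>P\<close> stands for the position of the particle, \<open>V h\<close> for the derivative
  of the position in the parameter direction \<open>h\<close> and \<open>J w\<close> for its
  derivative with respect to the particle in the direction \<open>w\<close>; the second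
  derivatives are \<open>W\<close>, \<open>M\<close> and \<open>N\<close> for two parameter
  directions, one of each kind, and two spatial directions. The motion of the body is
  \<open>G\<close>.\<close>

definition P :: "(real \<times> real) \<times> (real^2) \<Rightarrow> real^2" where "P = (\<lambda>(p, x). snd (q p) x)"
definition G :: "real \<times> real \<Rightarrow> se2" where "G p = fst (q p)"
definition Dom :: "((real \<times> real) \<times> (real^2)) set" where
  "Dom = (SOME U. open U \<and> UNIV \<times> fluid R \<subseteq> U \<and> smooth_on U P)"

lemma fluidR: "fluid R = - ball 0 R" "interior (fluid R) = - cball 0 R"
  using R by (simp_all add: fluid_eq interior_exterior)

lemma Dom: "open Dom" "\<And>p x. x \<in> - ball 0 R \<Longrightarrow> (p, x) \<in> Dom" "smooth_on Dom P"
proof -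
  have "\<exists>U. open U \<and> UNIV \<times> fluid R \<subseteq> U \<and> smooth_on U P"
    using fam unfolding smooth_family_def smooth_near_def P_def by blast
  from someI_ex[OF this] have "open Dom \<and> UNIV \<times> fluid R \<subseteq> Dom \<and> smooth_on Dom P" unfolding Dom_def .
  then show "open Dom" "\<And>p x. x \<in> - ball 0 R \<Longrightarrow> (p, x) \<in> Dom" "smooth_on Dom P" unfolding fluidR by auto
qed

definition V :: "real \<times> real \<Rightarrow> (real \<times> real) \<times> (real^2) \<Rightarrow> real^2" where
  "V h z = frechet_derivative P (at z) (h, 0)"
definition J :: "real^2 \<Rightarrow> (real \<times> real) \<times> (real^2) \<Rightarrow> real^2" where
  "J w z = frechet_derivative P (at z) (0, w)"

lemma smooth_V: "smooth_on Dom (V h)" and smooth_J: "smooth_on Dom (J w)"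
  unfolding V_def[abs_def] J_def[abs_def] by (rule smooth_on_deriv[OF Dom(3)])+

lemma has_derivative_P: "z \<in> Dom \<Longrightarrow> (P has_derivative (\<lambda>(a, b). V a z + J b z)) (at z)"
proof -
  assume z: "z \<in> Dom"
  have d: "(P has_derivative frechet_derivative P (at z)) (at z)" by (rule smooth_on_has_derivative[OF Dom(3) z])
  have "frechet_derivative P (at z) (a, b) = V a z + J b z" for a b
    using linear_add[OF has_derivative_linear[OF d], of "(a, 0)" "(0, b)"] by (simp add: V_def J_def)
  then show ?thesis by (intro has_derivative_eq_rhs[OF d]) auto
qed

definition W where "W h a z = frechet_derivative (V h) (at z) (a, 0)"
definition M where "M h w z = frechet_derivative (V h) (at z) (0, w)"

lemma has_derivative_V: "z \<in> Dom \<Longrightarrow> (V h has_derivative (\<lambda>(a, b). W h a z + M h b z)) (at z)"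
proof -
  assume z: "z \<in> Dom"
  have d: "(V h has_derivative frechet_derivative (V h) (at z)) (at z)" by (rule smooth_on_has_derivative[OF smooth_V z])
  have "frechet_derivative (V h) (at z) (a, b) = W h a z + M h b z" for a b
    using linear_add[OF has_derivative_linear[OF d], of "(a, 0)" "(0, b)"] by (simp add: W_def M_def)
  then show ?thesis by (intro has_derivative_eq_rhs[OF d]) auto
qed

definition N where "N w w' z = frechet_derivative (J w) (at z) (0, w')"

lemma partials_commute: "z \<in> Dom \<Longrightarrow> W h a z = W a h z" "z \<in> Dom \<Longrightarrow> frechet_derivative (J w) (at z) (a, 0) = M a w z"
  "z \<in> Dom \<Longrightarrow> N w w' z = N w' w z"
  using iter_deriv_symmetric[OF Dom(1,3), of z "(a,0)" "(h,0)"] iter_deriv_symmetric[OF Dom(1,3), of z "(a,0)" "(0,w)"]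
    iter_deriv_symmetric[OF Dom(1,3), of z "(0,w')" "(0,w)"]
  by (simp_all add: W_def M_def N_def V_def[abs_def] J_def[abs_def])

lemma has_derivative_J: "z \<in> Dom \<Longrightarrow> (J w has_derivative (\<lambda>(a, b). M a w z + N w b z)) (at z)"
proof -
  assume z: "z \<in> Dom"
  have d: "(J w has_derivative frechet_derivative (J w) (at z)) (at z)" by (rule smooth_on_has_derivative[OF smooth_J z])
  have "frechet_derivative (J w) (at z) (a, b) = M a w z + N w b z" for a b
    using linear_add[OF has_derivative_linear[OF d], of "(a, 0)" "(0, b)"] partials_commute(2)[OF z] by (simp add: N_def)
  then show ?thesis by (intro has_derivative_eq_rhs[OF d]) auto
qed

lemma smooth_W: "smooth_on Dom (W h a)" and smooth_M: "smooth_on Dom (M h w)" and smooth_N: "smooth_on Dom (N w w')"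
  unfolding W_def[abs_def] M_def[abs_def] N_def[abs_def] by (rule smooth_on_deriv[OF smooth_V] smooth_on_deriv[OF smooth_J])+

lemma linear_partials:
  assumes "z \<in> Dom"
  shows "linear (\<lambda>h. V h z)" "linear (\<lambda>w. J w z)" "linear (\<lambda>a. W h a z)" "linear (\<lambda>w. M h w z)" "linear (\<lambda>h. M h w z)"
    "linear (\<lambda>w'. N w w' z)"
proof -
  have p: "linear (\<lambda>a. D (a, 0))" "linear (\<lambda>b. D (0, b))" if "linear D" for D :: "(real \<times> real) \<times> (real^2) \<Rightarrow> real^2"
    using linear_compose[OF _ that, of "\<lambda>a. (a, 0)"] linear_compose[OF _ that, of "\<lambda>a. (0, a)"]
    by (auto simp: o_def linear_iff)
  note l = has_derivative_linear[OF smooth_on_has_derivative[OF Dom(3) assms]]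
    has_derivative_linear[OF smooth_on_has_derivative[OF smooth_V assms]]
    has_derivative_linear[OF smooth_on_has_derivative[OF smooth_J assms]]
  show "linear (\<lambda>h. V h z)" "linear (\<lambda>w. J w z)" unfolding V_def J_def by (rule p[OF l(1)])+
  show "linear (\<lambda>a. W h a z)" "linear (\<lambda>w. M h w z)" "linear (\<lambda>w'. N w w' z)"
    unfolding W_def M_def N_def by (rule p[OF l(2)] p[OF l(3)])+
  have "linear (\<lambda>h. frechet_derivative (J w) (at z) (h, 0))" by (rule p(1)[OF l(3)])
  then show "linear (\<lambda>h. M h w z)" using partials_commute(2)[OF assms] by simp
qed

lemma area_J: assumes "x \<in> - ball 0 R" shows "area_form (J a (p, x)) (J b (p, x)) = area_form a b"
  and derivative_slice: "(snd (q p) has_derivative (\<lambda>w. J w (p, x))) (at x)"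
proof -
  have z: "(p, x) \<in> Dom" by (rule Dom(2)[OF assms])
  have c: "((\<lambda>x. (p, x)) has_derivative (\<lambda>w. (0, w))) (at x)"
    by (rule has_derivative_eq_rhs, (rule derivative_intros)+) simp
  have "((\<lambda>x. P (p, x)) has_derivative (\<lambda>w. case (0, w) of (a, b) \<Rightarrow> V a (p, x) + J b (p, x))) (at x)"
    by (rule has_derivative_compose[OF c has_derivative_P[OF z]])
  then show d: "(snd (q p) has_derivative (\<lambda>w. J w (p, x))) (at x)"
    using linear_0[OF linear_partials(1)[OF z]] by (simp add: P_def eta_contract_eq)
  have "q p \<in> Qspace R" using fam unfolding smooth_family_def by blast
  then have "area_form (frechet_derivative (snd (q p)) (at x) a) (frechet_derivative (snd (q p)) (at x) b) = area_form a b"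
    using assms unfolding Qspace_def fluidR by (auto simp: case_prod_beta)
  then show "area_form (J a (p, x)) (J b (p, x)) = area_form a b"
    by (simp add: frechet_derivative_at[OF d, symmetric])
qed

text \<open>The derivative in the parameters of the condition that the embeddings preserve area:
  the velocity field is divergence free.\<close>

lemma area_J_M:
  assumes x: "x \<in> - ball 0 R"
  shows "area_form (M h a (p, x)) (J b (p, x)) + area_form (J a (p, x)) (M h b (p, x)) = 0"
proof -
  have z: "(p, x) \<in> Dom" by (rule Dom(2)[OF x])
  have c: "((\<lambda>p. (p, x)) has_derivative (\<lambda>h. (h, 0))) (at p)"
    by (rule has_derivative_eq_rhs, (rule derivative_intros)+) simp
  have d: "((\<lambda>p. J w (p, x)) has_derivative (\<lambda>h. M h w (p, x))) (at p)" for w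
    using has_derivative_compose[OF c has_derivative_J[OF z, of w]] linear_0[OF linear_partials(6)[OF z]] by simp
  have "((\<lambda>p. area_form (J a (p, x)) (J b (p, x))) has_derivative
      (\<lambda>h. area_form (J a (p, x)) (M h b (p, x)) + area_form (M h a (p, x)) (J b (p, x)))) (at p)"
    by (rule has_derivative_area_form[OF d d])
  moreover have "((\<lambda>p. area_form (J a (p, x)) (J b (p, x))) has_derivative (\<lambda>h. 0)) (at p)"
    unfolding area_J[OF x] by (rule has_derivative_const)
  ultimately have "(\<lambda>h. area_form (J a (p, x)) (M h b (p, x)) + area_form (M h a (p, x)) (J b (p, x))) = (\<lambda>h. 0)"
    by (rule has_derivative_unique)
  from fun_cong[OF this, of h] show ?thesis by (simp add: add.commute)
qed

lemma P_diff: "z \<in> Dom \<Longrightarrow> frechet_derivative (\<lambda>(p, x). P (p, x) - x) (at z) d = frechet_derivative P (at z) d - snd d"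
proof -
  assume z: "z \<in> Dom"
  have "((\<lambda>z. P z - snd z) has_derivative (\<lambda>d. frechet_derivative P (at z) d - snd d)) (at z)"
    by (intro derivative_intros smooth_on_has_derivative[OF Dom(3) z])
  moreover have "(\<lambda>(p, x). P (p, x) - x) = (\<lambda>z. P z - snd z)" by auto
  ultimately show ?thesis using fun_cong[OF frechet_derivative_at, of "\<lambda>z. P z - snd z" _ z d] by simp
qed

lemma family_decay:
  assumes "compact K"
  obtains C where "C \<ge> 0" "\<And>p x. p \<in> K \<Longrightarrow> x \<in> - ball 0 R \<Longrightarrow> norm (iter_deriv ds (\<lambda>(p, x). P (p, x) - x) (p, x)) * (norm x)\<^sup>2 \<le> C"
proof -
  obtain C where "\<forall>p\<in>K. \<forall>x\<in>fluid R. norm (iter_deriv ds (\<lambda>(p, x). snd (q p) x - x) (p, x)) * (norm x)\<^sup>2 \<le> C"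
    using fam assms unfolding smooth_family_def by blast
  then have "norm (iter_deriv ds (\<lambda>(p, x). P (p, x) - x) (p, x)) * (norm x)\<^sup>2 \<le> C" if "p \<in> K" "x \<in> - ball 0 R" for p x
    using that unfolding P_def fluidR by simp
  from order_trans[OF this abs_ge_self] show ?thesis by (intro that[of "\<bar>C\<bar>"]) auto
qed

text \<open>The displacement and all derivatives except \<open>J\<close> decay like
  \<open>|x|\<^sup>-\<^sup>2\<close>; \<open>J\<close> tends to the identity and is only bounded.
  One constant for all of them, uniform over a compact set of parameters, keeps later estimates
  short.\<close>

definition decay_const where
  "decay_const C K h0 \<longleftrightarrow> 0 \<le> C \<and> (\<forall>p\<in>K. \<forall>x\<in>- ball 0 R.
     (\<forall>h. norm (V h (p, x)) * (norm x)\<^sup>2 \<le> C * norm h) \<and> (\<forall>w. norm (J w (p, x)) \<le> C * norm w) \<and>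
     (\<forall>a. norm (W h0 a (p, x)) * (norm x)\<^sup>2 \<le> C * norm a) \<and> (\<forall>w. norm (M h0 w (p, x)) * (norm x)\<^sup>2 \<le> C * norm w) \<and>
     norm (P (p, x) - x) * (norm x)\<^sup>2 \<le> C \<and> (\<forall>a w. norm (M a w (p, x)) * (norm x)\<^sup>2 \<le> C * norm a * norm w))"

lemma decay_const_exists:
  assumes K: "compact K" shows "\<exists>C. decay_const C K h0"
proof -
  let ?I = "K \<times> (- ball (0::real^2) R)" let ?s = "\<lambda>i::(real\<times>real)\<times>(real^2). (norm (snd i))\<^sup>2"
  have inD: "i \<in> Dom" if "i \<in> ?I" for i using that Dom(2) by auto
  have id: "iter_deriv (ds @ [d]) (\<lambda>(p, x). P (p, x) - x) i = iter_deriv ds (\<lambda>z. frechet_derivative P (at z) d - snd d) i"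
    if "i \<in> ?I" for ds d i
    unfolding iter_deriv_snoc by (rule iter_deriv_cong_open[OF Dom(1) P_diff inD[OF that]])
  have D0: "\<exists>C. \<forall>i\<in>?I. norm (iter_deriv ds (\<lambda>(p, x). P (p, x) - x) i) * ?s i \<le> C" for ds
  proof (rule family_decay[OF K, of ds])
    fix C assume C: "\<And>p x. p \<in> K \<Longrightarrow> x \<in> - ball 0 R \<Longrightarrow> norm (iter_deriv ds (\<lambda>(p, x). P (p, x) - x) (p, x)) * (norm x)\<^sup>2 \<le> C"
    show ?thesis
    proof (intro exI[of _ C] ballI, elim SigmaE)
      fix i :: "(real \<times> real) \<times> (real^2)" and p x assume "p \<in> K" "x \<in> - ball 0 R" "i = (p, x)"
      then show "norm (iter_deriv ds (\<lambda>(p, x). P (p, x) - x) i) * ?s i \<le> C" using C by simp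
    qed
  qed
  have B: "\<exists>C. \<forall>i\<in>?I. norm (f i) * ?s i \<le> C"
    if "\<And>i. i \<in> ?I \<Longrightarrow> iter_deriv ds (\<lambda>(p, x). P (p, x) - x) i = f i" for ds and f :: "(real \<times> real) \<times> (real^2) \<Rightarrow> real^2"
  proof -
    obtain C where C: "\<forall>i\<in>?I. norm (iter_deriv ds (\<lambda>(p, x). P (p, x) - x) i) * ?s i \<le> C" using D0 by blast
    show ?thesis
    proof (intro exI[of _ C] ballI)
      fix i :: "(real \<times> real) \<times> (real^2)" assume i: "i \<in> ?I"
      show "norm (f i) * ?s i \<le> C" using C i unfolding that[OF i, symmetric] by blast
    qed
  qed
  have VB: "\<exists>C. \<forall>i\<in>?I. norm (V b i) * ?s i \<le> C" for b
    by (rule B[of "[(b, 0)]"]) (use id[of _ "[]" "(b, 0)"] in \<open>simp add: V_def\<close>)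
  have JB: "\<exists>C. \<forall>i\<in>?I. norm (J b i - b) * ?s i \<le> C" for b
    by (rule B[of "[(0, b)]"]) (use id[of _ "[]" "(0, b)"] in \<open>simp add: J_def\<close>)
  have WB: "\<exists>C. \<forall>i\<in>?I. norm (W h b i) * ?s i \<le> C" for b h
    by (rule B[of "[(b, 0), (h, 0)]"]) (use id[of _ "[(b, 0)]" "(h, 0)"] in \<open>simp add: W_def V_def[abs_def]\<close>)
  have MB: "\<exists>C. \<forall>i\<in>?I. norm (M h b i) * ?s i \<le> C" for b h
    by (rule B[of "[(0, b), (h, 0)]"]) (use id[of _ "[(0, b)]" "(h, 0)"] in \<open>simp add: M_def V_def[abs_def]\<close>)
  have PB: "\<exists>C. \<forall>i\<in>?I. norm (P i - snd i) * ?s i \<le> C"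
    by (rule B[of "[]"]) (simp add: case_prod_beta)
  \<comment> \<open>\<open>J b - b\<close> decays, hence \<open>J b\<close> is
    bounded\<close>
  have JB': "\<exists>C. \<forall>i\<in>?I. norm (J b i) * 1 \<le> C" for b
  proof -
    obtain C where C: "\<forall>i\<in>?I. norm (J b i - b) * ?s i \<le> C" using JB by blast
    have "norm (J b i) \<le> norm b + C / R\<^sup>2" if "i \<in> ?I" for i
    proof -
      have "R\<^sup>2 \<le> ?s i" using that R by (intro power_mono) auto
      then have "norm (J b i - b) * R\<^sup>2 \<le> norm (J b i - b) * ?s i" by (intro mult_left_mono) auto
      then have "norm (J b i - b) \<le> C / R\<^sup>2" using C that R by (auto simp: pos_le_divide_eq intro: order_trans)
      then show ?thesis using norm_triangle_ineq[of b "J b i - b"] by simp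
    qed
    then show ?thesis by (intro exI[of _ "norm b + C / R\<^sup>2"] ballI) (simp only: mult_1_right)
  qed
  obtain C1 where C1: "C1 \<ge> 0" "\<forall>i\<in>?I. \<forall>w. norm (V w i) * ?s i \<le> C1 * norm w"
    using linear_decay_uniform[of ?I "\<lambda>i h. V h i" ?s] VB linear_partials(1)[OF inD] by auto
  obtain C2 where C2: "C2 \<ge> 0" "\<forall>i\<in>?I. \<forall>w. norm (J w i) * 1 \<le> C2 * norm w"
    using linear_decay_uniform[of ?I "\<lambda>i w. J w i" "\<lambda>_. 1"] JB' linear_partials(2)[OF inD] by auto
  obtain C3 where C3: "C3 \<ge> 0" "\<forall>i\<in>?I. \<forall>w. norm (W h0 w i) * ?s i \<le> C3 * norm w"
    using linear_decay_uniform[of ?I "\<lambda>i h. W h0 h i" ?s] WB linear_partials(3)[OF inD] by auto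
  obtain C4 where C4: "C4 \<ge> 0" "\<forall>i\<in>?I. \<forall>w. norm (M h0 w i) * ?s i \<le> C4 * norm w"
    using linear_decay_uniform[of ?I "\<lambda>i w. M h0 w i" ?s] MB linear_partials(4)[OF inD] by auto
  obtain C5 where C5: "\<forall>i\<in>?I. norm (P i - snd i) * ?s i \<le> C5" using PB by blast
  have MM: "\<exists>C\<ge>0. \<forall>i\<in>?I. \<forall>w. norm (M h w i) * ?s i \<le> C * norm w" for h
    using linear_decay_uniform[of ?I "\<lambda>i w. M h w i" ?s] MB linear_partials(4)[OF inD] by auto
  obtain C6 where C6: "\<And>h. C6 h \<ge> 0" "\<And>h i w. i \<in> ?I \<Longrightarrow> norm (M h w i) * ?s i \<le> C6 h * norm w" using MM by metis
  define C7 where "C7 = C6 (1, 0) + C6 (0, 1)"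
  have M7: "norm (M a w i) * ?s i \<le> C7 * norm a * norm w" if "i \<in> ?I" for a w i
  proof -
    note l = linear_partials(5)[OF inD[OF that], of w]
    have "M a w i = fst a *\<^sub>R M (1, 0) w i + snd a *\<^sub>R M (0, 1) w i"
      using linear_add[OF l, of "fst a *\<^sub>R (1, 0)" "snd a *\<^sub>R (0, 1)"] linear_scale[OF l, of "fst a" "(1, 0)"]
        linear_scale[OF l, of "snd a" "(0, 1)"] by simp
    then have "norm (M a w i) \<le> \<bar>fst a\<bar> * norm (M (1, 0) w i) + \<bar>snd a\<bar> * norm (M (0, 1) w i)"
      using norm_triangle_ineq[of "fst a *\<^sub>R M (1, 0) w i" "snd a *\<^sub>R M (0, 1) w i"] by simp
    then have "norm (M a w i) * ?s i \<le> (\<bar>fst a\<bar> * norm (M (1, 0) w i) + \<bar>snd a\<bar> * norm (M (0, 1) w i)) * ?s i"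
      by (intro mult_right_mono) auto
    also have "\<dots> = \<bar>fst a\<bar> * (norm (M (1, 0) w i) * ?s i) + \<bar>snd a\<bar> * (norm (M (0, 1) w i) * ?s i)"
      by (simp add: algebra_simps)
    also have "\<dots> \<le> norm a * (C6 (1, 0) * norm w) + norm a * (C6 (0, 1) * norm w)"
    proof (rule add_mono)
      show "\<bar>fst a\<bar> * (norm (M (1, 0) w i) * ?s i) \<le> norm a * (C6 (1, 0) * norm w)"
        using norm_fst_le[of "fst a" "snd a"] by (intro mult_mono[OF _ C6(2)[OF that]]) auto
      show "\<bar>snd a\<bar> * (norm (M (0, 1) w i) * ?s i) \<le> norm a * (C6 (0, 1) * norm w)"
        using norm_snd_le[of "snd a" "fst a"] by (intro mult_mono[OF _ C6(2)[OF that]]) auto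
    qed
    finally show ?thesis by (simp add: C7_def algebra_simps)
  qed
  let ?C = "C1 + C2 + C3 + C4 + \<bar>C5\<bar> + C7"
  have C7: "C7 \<ge> 0" using C6(1) by (simp add: C7_def)
  have le: "c * norm w \<le> ?C * norm w" if "c \<le> ?C" for c and w :: "'z::real_normed_vector" using that by (intro mult_right_mono) auto
  show ?thesis unfolding decay_const_def
  proof (intro exI[of _ ?C] conjI ballI allI)
    show "?C \<ge> 0" using C1 C2 C3 C4 C7 by auto
    fix p and x :: "real^2" assume px: "p \<in> K" "x \<in> - ball 0 R"
    then have i: "(p, x) \<in> ?I" by auto
    show "norm (V h (p, x)) * (norm x)\<^sup>2 \<le> ?C * norm h" for h
      using C1(2)[rule_format, OF i, of h] le[of C1 h] C1 C2 C3 C4 C7 by simp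
    show "norm (J w (p, x)) \<le> ?C * norm w" for w
      using C2(2)[rule_format, OF i, of w] le[of C2 w] C1 C2 C3 C4 C7 by simp
    show "norm (W h0 w (p, x)) * (norm x)\<^sup>2 \<le> ?C * norm w" for w
      using C3(2)[rule_format, OF i, of w] le[of C3 w] C1 C2 C3 C4 C7 by simp
    show "norm (M h0 w (p, x)) * (norm x)\<^sup>2 \<le> ?C * norm w" for w
      using C4(2)[rule_format, OF i, of w] le[of C4 w] C1 C2 C3 C4 C7 by simp
    show "norm (P (p, x) - x) * (norm x)\<^sup>2 \<le> ?C"
      using C5[rule_format, OF i] C1 C2 C3 C4 C7 by simp
    show "norm (M a w (p, x)) * (norm x)\<^sup>2 \<le> ?C * norm a * norm w" for a w
    proof -
      have "C7 * norm a * norm w \<le> ?C * norm a * norm w" using C1 C2 C3 C4 C7 by (intro mult_right_mono) auto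
      then show ?thesis using M7[OF i, of a w] by simp
    qed
  qed
qed

lemma decay_constD:
  assumes "decay_const C K h0"
  shows "C \<ge> 0"
    "\<And>p x h. p \<in> K \<Longrightarrow> x \<in> - ball 0 R \<Longrightarrow> norm (V h (p, x)) * (norm x)\<^sup>2 \<le> C * norm h"
    "\<And>p x w. p \<in> K \<Longrightarrow> x \<in> - ball 0 R \<Longrightarrow> norm (J w (p, x)) \<le> C * norm w"
    "\<And>p x a. p \<in> K \<Longrightarrow> x \<in> - ball 0 R \<Longrightarrow> norm (W h0 a (p, x)) * (norm x)\<^sup>2 \<le> C * norm a"
    "\<And>p x w. p \<in> K \<Longrightarrow> x \<in> - ball 0 R \<Longrightarrow> norm (M h0 w (p, x)) * (norm x)\<^sup>2 \<le> C * norm w"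
    "\<And>p x. p \<in> K \<Longrightarrow> x \<in> - ball 0 R \<Longrightarrow> norm (P (p, x) - x) * (norm x)\<^sup>2 \<le> C"
    "\<And>p x a w. p \<in> K \<Longrightarrow> x \<in> - ball 0 R \<Longrightarrow> norm (M a w (p, x)) * (norm x)\<^sup>2 \<le> C * norm a * norm w"
  using assms unfolding decay_const_def by blast+

lemma J_vec2: "z \<in> Dom \<Longrightarrow> J w z = w $ 1 *\<^sub>R J (axis 1 1) z + w $ 2 *\<^sub>R J (axis 2 1) z"
  using linear_vec2[OF linear_partials(2)] by blast

lemma continuous_on_linear_family:
  fixes L :: "real^2 \<Rightarrow> (real \<times> real) \<times> (real^2) \<Rightarrow> real^2" and g :: "'c::t2_space \<Rightarrow> real^2"
  assumes "\<And>z. z \<in> Dom \<Longrightarrow> linear (\<lambda>w. L w z)" "\<And>w. smooth_on Dom (L w)"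
    and "continuous_on S g" "continuous_on S z" "\<And>s. s \<in> S \<Longrightarrow> z s \<in> Dom"
  shows "continuous_on S (\<lambda>s. L (g s) (z s))"
proof -
  have c: "continuous_on S (\<lambda>s. L w (z s))" for w
    by (rule continuous_on_compose2[OF smooth_on_imp_continuous_on[OF assms(2)] assms(4)]) (use assms(5) in auto)
  have "continuous_on S (\<lambda>s. g s $ 1 *\<^sub>R L (axis 1 1) (z s) + g s $ 2 *\<^sub>R L (axis 2 1) (z s))"
    by (intro continuous_intros assms(3) c)
  then show ?thesis
    by (rule continuous_on_eq) (use linear_vec2[OF assms(1)[OF assms(5)]] in metis)
qed

lemma continuous_on_Dom_compose:
  "smooth_on Dom f \<Longrightarrow> continuous_on S z \<Longrightarrow> (\<And>s. s \<in> S \<Longrightarrow> z s \<in> Dom) \<Longrightarrow> continuous_on S (\<lambda>s. f (z s))"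
  by (rule continuous_on_compose2[OF smooth_on_imp_continuous_on]) auto

section \<open>The stream function of the flow velocity\<close>

text \<open>The contraction of the area form with the velocity, pulled back to the reference
  region.\<close>

definition flow_form where "flow_form h w z = area_form (V h z) (J w z)"

lemma ray: "x \<in> - ball 0 R \<Longrightarrow> 1 \<le> t \<Longrightarrow> t *\<^sub>R x \<in> - ball (0::real^2) R"
  using R mult_mono[of 1 t R "norm x"] by simp

lemma ray_in_Dom: "x \<in> - ball 0 R \<Longrightarrow> 1 \<le> t \<Longrightarrow> (p, t *\<^sub>R x) \<in> Dom"
  using ray Dom(2) by blast

lemma flow_form_bound:
  assumes "compact K"
  obtains C where "C \<ge> 0" "\<And>p x w h. p \<in> K \<Longrightarrow> x \<in> - ball 0 R \<Longrightarrow> \<bar>flow_form h w (p, x)\<bar> * (norm x)\<^sup>2 \<le> C * norm h * norm w"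
proof -
  obtain C where dec: "decay_const C K 0" using decay_const_exists[of "K" 0] assms by auto
  note C = decay_constD[OF dec]
  have "\<bar>flow_form h w (p, x)\<bar> * (norm x)\<^sup>2 \<le> C * C * norm h * norm w" if "p \<in> K" "x \<in> - ball 0 R" for p x w h
  proof -
    have "\<bar>flow_form h w (p, x)\<bar> * (norm x)\<^sup>2 \<le> (norm (V h (p, x)) * norm (J w (p, x))) * (norm x)\<^sup>2"
      unfolding flow_form_def by (intro mult_right_mono area_form_bound) auto
    also have "\<dots> = (norm (V h (p, x)) * (norm x)\<^sup>2) * norm (J w (p, x))" by simp
    also have "\<dots> \<le> (C * norm h) * (C * norm w)" by (rule mult_mono[OF C(2)[OF that] C(3)[OF that]]) (use C(1) in auto)
    finally show ?thesis by (simp add: mult_ac)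
  qed
  then show ?thesis using that[of "C * C"] C(1) by simp
qed

lemma flow_form_continuous:
  fixes g :: "'c::t2_space \<Rightarrow> real^2"
  assumes "continuous_on S g" "continuous_on S z" "\<And>s. s \<in> S \<Longrightarrow> z s \<in> Dom"
  shows "continuous_on S (\<lambda>s. flow_form h (g s) (z s))"
  unfolding flow_form_def
  by (intro bounded_bilinear.continuous_on[OF bounded_bilinear_area_form] continuous_on_Dom_compose[OF smooth_V]
      continuous_on_linear_family[where L = J, OF linear_partials(2) smooth_J] assms)

text \<open>The primitive of the closed form \<open>flow_form h\<close> that vanishes at
  infinity: minus its integral along the radial ray from \<open>x\<close> to infinity.\<close>

definition flow_stream where "flow_stream h = (\<lambda>(p, x). lim (\<lambda>n. integral {1..real (Suc n)} (\<lambda>t. - flow_form h x (p, t *\<^sub>R x))))"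

lemma flow_stream_limit:
  assumes "compact K"
  obtains C where "C \<ge> 0"
    "\<And>p x h. p \<in> K \<Longrightarrow> x \<in> - ball 0 R \<Longrightarrow> convergent (\<lambda>n. integral {1..real (Suc n)} (\<lambda>t. - flow_form h x (p, t *\<^sub>R x)))"
    "\<And>p x h n. p \<in> K \<Longrightarrow> x \<in> - ball 0 R \<Longrightarrow>
       \<bar>integral {1..real (Suc n)} (\<lambda>t. - flow_form h x (p, t *\<^sub>R x)) - flow_stream h (p, x)\<bar> \<le> C * norm h / norm x / real (Suc n)"
    "\<And>p x h. p \<in> K \<Longrightarrow> x \<in> - ball 0 R \<Longrightarrow> \<bar>flow_stream h (p, x)\<bar> \<le> C * norm h / norm x"
proof -
  obtain C where C: "C \<ge> 0"
    "\<And>p x w h. p \<in> K \<Longrightarrow> x \<in> - ball 0 R \<Longrightarrow> \<bar>flow_form h w (p, x)\<bar> * (norm x)\<^sup>2 \<le> C * norm h * norm w"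
    using flow_form_bound[OF assms] by blast
  have c: "continuous_on {1..} (\<lambda>t. - flow_form h x (p, t *\<^sub>R x))" if "x \<in> - ball 0 R" for h p x
    by (intro continuous_intros flow_form_continuous) (use ray_in_Dom[OF that] in auto)
  have b: "\<bar>- flow_form h x (p, t *\<^sub>R x)\<bar> \<le> (C * norm h / norm x) / t\<^sup>2"
    if "p \<in> K" "x \<in> - ball 0 R" "1 \<le> t" for p x h t
  proof -
    have nx: "norm x > 0" using that R by auto
    have "\<bar>flow_form h x (p, t *\<^sub>R x)\<bar> * (t\<^sup>2 * (norm x)\<^sup>2) \<le> C * norm h * norm x"
      using C(2)[OF that(1) ray[OF that(2,3)], of h x] by (simp add: power_mult_distrib)
    then have "\<bar>flow_form h x (p, t *\<^sub>R x)\<bar> \<le> C * norm h * norm x / (t\<^sup>2 * (norm x)\<^sup>2)"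
      using nx that(3) by (subst pos_le_divide_eq) auto
    also have "\<dots> = (C * norm h / norm x) / t\<^sup>2" using nx by (simp add: power2_eq_square)
    finally show ?thesis by simp
  qed
  show ?thesis
    by (rule that[OF C(1)]) (use integral_tail[OF c b] in \<open>simp_all add: flow_stream_def\<close>)
qed

lemma flow_stream_convergent:
  assumes "x \<in> - ball 0 R"
  shows "convergent (\<lambda>n. integral {1..real (Suc n)} (\<lambda>t. - flow_form h x (p, t *\<^sub>R x)))"
proof (rule flow_stream_limit[of "{p}"])
  fix C
  assume "\<And>p' x h. p' \<in> {p} \<Longrightarrow> x \<in> - ball 0 R \<Longrightarrow> convergent (\<lambda>n. integral {1..real (Suc n)} (\<lambda>t. - flow_form h x (p', t *\<^sub>R x)))"
  from this[OF singletonI assms] show ?thesis .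
qed simp

text \<open>The direction and the base point of \<open>J\<close> vary together, so the direction
  is expanded in the standard basis before differentiating.\<close>

lemma deriv_J_ray:
  assumes "x \<in> - ball 0 R" "1 \<le> t"
  shows "((\<lambda>y. J y (p, t *\<^sub>R y)) has_derivative (\<lambda>w. J w (p, t *\<^sub>R x) + t *\<^sub>R N w x (p, t *\<^sub>R x))) (at x)"
proof -
  let ?z = "(p, t *\<^sub>R x)"
  have z: "?z \<in> Dom" by (rule ray_in_Dom[OF assms])
  have c: "((\<lambda>y. (p, t *\<^sub>R y)) has_derivative (\<lambda>w. (0, t *\<^sub>R w))) (at x)"
    by (rule has_derivative_eq_rhs, (rule derivative_intros)+) simp
  have d: "((\<lambda>y. J w (p, t *\<^sub>R y)) has_derivative (\<lambda>b. N w (t *\<^sub>R b) ?z)) (at x)" for w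
    using has_derivative_compose[OF c has_derivative_J[OF z, of w]] linear_0[OF linear_partials(5)[OF z]] by simp
  have n: "bounded_linear (\<lambda>y::real^2. y $ i)" for i by (rule bounded_linear_vec_nth)
  have "((\<lambda>y. y $ 1 *\<^sub>R J (axis 1 1) (p, t *\<^sub>R y) + y $ 2 *\<^sub>R J (axis 2 1) (p, t *\<^sub>R y)) has_derivative
      (\<lambda>w. (x $ 1 *\<^sub>R N (axis 1 1) (t *\<^sub>R w) ?z + w $ 1 *\<^sub>R J (axis 1 1) ?z)
         + (x $ 2 *\<^sub>R N (axis 2 1) (t *\<^sub>R w) ?z + w $ 2 *\<^sub>R J (axis 2 1) ?z))) (at x)"
    by (intro has_derivative_add has_derivative_scaleR d bounded_linear_imp_has_derivative n)
  moreover have "(x $ 1 *\<^sub>R N (axis 1 1) (t *\<^sub>R w) ?z + w $ 1 *\<^sub>R J (axis 1 1) ?z)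
         + (x $ 2 *\<^sub>R N (axis 2 1) (t *\<^sub>R w) ?z + w $ 2 *\<^sub>R J (axis 2 1) ?z) = J w ?z + t *\<^sub>R N w x ?z" for w
  proof -
    have "N v (t *\<^sub>R w) ?z = t *\<^sub>R N w v ?z" for v
      using linear_scale[OF linear_partials(6)[OF z, of v], of t w] partials_commute(3)[OF z] by simp
    then show ?thesis using linear_vec2[OF linear_partials(2)[OF z], of w] linear_vec2[OF linear_partials(6)[OF z, of w], of x]
      by (simp add: algebra_simps)
  qed
  ultimately have D: "((\<lambda>y. y $ 1 *\<^sub>R J (axis 1 1) (p, t *\<^sub>R y) + y $ 2 *\<^sub>R J (axis 2 1) (p, t *\<^sub>R y)) has_derivative
      (\<lambda>w. J w ?z + t *\<^sub>R N w x ?z)) (at x)" by simp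
  define U where "U = (\<lambda>y. (p, t *\<^sub>R y)) -` Dom"
  have "open U" unfolding U_def by (intro open_vimage Dom(1) continuous_intros)
  moreover have "x \<in> U" using z by (simp add: U_def)
  ultimately show ?thesis
    by (rule has_derivative_transform_within_open[OF D]) (simp add: U_def J_vec2[symmetric])
qed

text \<open>This is the lemma of Poincare on a ray: since the form is closed
  (\<open>area_J_M\<close>), the derivative of the radial integrand in the direction
  \<open>w\<close> is the derivative with respect to \<open>t\<close> of \<open>t\<close> times
  the form in the direction \<open>w\<close>. So its integral along the ray is a boundary
  term.\<close>

lemma flow_form_ray_derivative:
  assumes x: "x \<in> - ball 0 R" and t: "1 \<le> t"
  shows "((\<lambda>y. flow_form h y (p, t *\<^sub>R y)) has_derivative
     (\<lambda>w. flow_form h w (p, t *\<^sub>R x) + t * (area_form (V h (p, t *\<^sub>R x)) (N w x (p, t *\<^sub>R x)) + area_form (M h x (p, t *\<^sub>R x)) (J w (p, t *\<^sub>R x))))) (at x)" (is ?A)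
    and "((\<lambda>s. s * flow_form h w (p, s *\<^sub>R x)) has_real_derivative
     flow_form h w (p, t *\<^sub>R x) + t * (area_form (V h (p, t *\<^sub>R x)) (N w x (p, t *\<^sub>R x)) + area_form (M h x (p, t *\<^sub>R x)) (J w (p, t *\<^sub>R x)))) (at t)" (is ?B)
proof -
  let ?z = "(p, t *\<^sub>R x)"
  have z: "?z \<in> Dom" by (rule ray_in_Dom[OF x t])
  have c: "((\<lambda>y. (p, t *\<^sub>R y)) has_derivative (\<lambda>w. (0, t *\<^sub>R w))) (at x)"
    by (rule has_derivative_eq_rhs, (rule derivative_intros)+) simp
  have dV: "((\<lambda>y. V h (p, t *\<^sub>R y)) has_derivative (\<lambda>w. t *\<^sub>R M h w ?z)) (at x)"
    using has_derivative_compose[OF c has_derivative_V[OF z, of h]] linear_0[OF linear_partials(3)[OF z]] linear_scale[OF linear_partials(4)[OF z]]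
    by simp
  have e: "area_form (M h w ?z) (J x ?z) = area_form (M h x ?z) (J w ?z)" for w
    using area_J_M[OF ray[OF x t], of h w p x] area_form_commute[of "J w ?z" "M h x ?z"] by simp
  show ?A unfolding flow_form_def
    by (rule has_derivative_eq_rhs[OF has_derivative_area_form[OF dV deriv_J_ray[OF x t]]])
      (simp add: fun_eq_iff area_form_simps e algebra_simps)
  have ct: "((\<lambda>s. (p, s *\<^sub>R x)) has_derivative (\<lambda>s. (0, s *\<^sub>R x))) (at t)"
    by (rule has_derivative_eq_rhs, (rule derivative_intros)+) simp
  have tV: "((\<lambda>s. V h (p, s *\<^sub>R x)) has_derivative (\<lambda>s. s *\<^sub>R M h x ?z)) (at t)"
    using has_derivative_compose[OF ct has_derivative_V[OF z, of h]] linear_0[OF linear_partials(3)[OF z]] linear_scale[OF linear_partials(4)[OF z]]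
    by simp
  have tJ: "((\<lambda>s. J w (p, s *\<^sub>R x)) has_derivative (\<lambda>s. s *\<^sub>R N w x ?z)) (at t)"
    using has_derivative_compose[OF ct has_derivative_J[OF z, of w]] linear_0[OF linear_partials(5)[OF z]] linear_scale[OF linear_partials(6)[OF z]]
    by simp
  show ?B unfolding has_field_derivative_def flow_form_def
    by (rule has_derivative_eq_rhs[OF has_derivative_mult[OF has_derivative_ident has_derivative_area_form[OF tV tJ]]])
      (simp add: fun_eq_iff area_form_simps algebra_simps)
qed

text \<open>The boundary term at the far end is of order \<open>1/n\<close>, as the form decays
  quadratically and the ray grows linearly.\<close>

lemma flow_stream_derivative_x:
  assumes x: "x \<in> - cball 0 R"
  shows "((\<lambda>x. flow_stream h (p, x)) has_derivative (\<lambda>w. flow_form h w (p, x))) (at x)"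
proof -
  obtain d where d: "d > 0" "ball x d \<subseteq> - cball 0 R" using x openE[of "- cball 0 R" x] by auto
  let ?U = "ball x d"
  have U: "y \<in> - ball 0 R" if "y \<in> ?U" for y using d that by auto
  obtain C where C: "C \<ge> 0"
    "\<And>p' x w h. p' \<in> {p} \<Longrightarrow> x \<in> - ball 0 R \<Longrightarrow> \<bar>flow_form h w (p', x)\<bar> * (norm x)\<^sup>2 \<le> C * norm h * norm w"
    using flow_form_bound[of "{p}"] by auto
  have conv: "convergent (\<lambda>n. integral {1..real (Suc n)} (\<lambda>t. - flow_form h y (p, t *\<^sub>R y)))" if "y \<in> ?U" for y
    by (rule flow_stream_convergent[OF U[OF that]])
  let ?D = "\<lambda>y t w. flow_form h w (p, t *\<^sub>R y) + t * (area_form (V h (p, t *\<^sub>R y)) (N w y (p, t *\<^sub>R y)) + area_form (M h y (p, t *\<^sub>R y)) (J w (p, t *\<^sub>R y)))"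
  have "((\<lambda>y. lim (\<lambda>n. integral {1..real (Suc n)} (\<lambda>t. - flow_form h y (p, t *\<^sub>R y)))) has_derivative (\<lambda>w. flow_form h w (p, x))) (at x)"
  proof (rule has_derivative_improper_integral[where U = ?U and f' = "\<lambda>y t w. - ?D y t w" and C = "C * norm h / R\<^sup>2"
        and g' = "\<lambda>y w. flow_form h w (p, y)"])
    show "open ?U" "convex ?U" "x \<in> ?U" using d by auto
    show "((\<lambda>y. - flow_form h y (p, t *\<^sub>R y)) has_derivative (\<lambda>w. - ?D y t w)) (at y)" if "y \<in> ?U" "1 \<le> t" for y t
      by (rule has_derivative_minus[OF flow_form_ray_derivative(1)[OF U[OF that(1)] that(2)]])
    show "continuous_on {1..} (\<lambda>t. - flow_form h y (p, t *\<^sub>R y))" if "y \<in> ?U" for y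
      by (intro continuous_intros flow_form_continuous) (use ray_in_Dom[OF U[OF that]] in auto)
    show "continuous_on (?U \<times> {1..}) (\<lambda>(y, t). - ?D y t w)" for w
    proof -
      have i: "(p, snd s *\<^sub>R fst s) \<in> Dom" if "s \<in> ?U \<times> {1..}" for s
        by (rule ray_in_Dom[OF U]) (use that in auto)
      show ?thesis unfolding case_prod_beta
        by (intro continuous_intros flow_form_continuous bounded_bilinear.continuous_on[OF bounded_bilinear_area_form]
            continuous_on_Dom_compose[OF smooth_V] continuous_on_Dom_compose[OF smooth_J]
            continuous_on_linear_family[where L = "N w", OF linear_partials(6) smooth_N] continuous_on_linear_family[where L = "M h", OF linear_partials(4) smooth_M] i)
    qed
    show "convergent (\<lambda>n. integral {1..real (Suc n)} (\<lambda>t. - flow_form h y (p, t *\<^sub>R y)))" if "y \<in> ?U" for y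
      by (rule conv[OF that])
    fix n y w assume y: "y \<in> ?U"
    have yR: "norm y \<ge> R" using U[OF y] by simp
    let ?n = "real (Suc n)"
    have H: "((\<lambda>t. ?D y t w) has_integral (?n * flow_form h w (p, ?n *\<^sub>R y) - 1 * flow_form h w (p, 1 *\<^sub>R y))) {1..?n}"
      by (rule fundamental_theorem_of_calculus)
        (use flow_form_ray_derivative(2)[OF U[OF y], of _ h w p] in
          \<open>auto simp: has_real_derivative_iff_has_vector_derivative[symmetric] intro: DERIV_subset\<close>)
    have "integral {1..?n} (\<lambda>t. - ?D y t w) = flow_form h w (p, y) - ?n * flow_form h w (p, ?n *\<^sub>R y)"
      using integral_unique[OF has_integral_neg[OF H]] by (simp only: minus_diff_eq scaleR_one mult_1)
    then have "\<bar>integral {1..?n} (\<lambda>t. - ?D y t w) - flow_form h w (p, y)\<bar> = ?n * \<bar>flow_form h w (p, ?n *\<^sub>R y)\<bar>"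
      by (simp add: abs_mult)
    also have "\<dots> \<le> C * norm h / R\<^sup>2 * norm w / ?n"
    proof -
      have "\<bar>flow_form h w (p, ?n *\<^sub>R y)\<bar> * (norm (?n *\<^sub>R y))\<^sup>2 \<le> C * norm h * norm w"
        by (rule C(2)[OF singletonI ray[OF U[OF y]]]) simp
      moreover have "R\<^sup>2 * ?n\<^sup>2 \<le> (norm (?n *\<^sub>R y))\<^sup>2"
        using yR R by (simp add: power_mult_distrib mult.commute power_mono mult_right_mono)
      ultimately have "\<bar>flow_form h w (p, ?n *\<^sub>R y)\<bar> * (R\<^sup>2 * ?n\<^sup>2) \<le> C * norm h * norm w"
        by (meson abs_ge_zero mult_left_mono order_trans)
      then have "(?n * \<bar>flow_form h w (p, ?n *\<^sub>R y)\<bar>) * (R\<^sup>2 * ?n) \<le> C * norm h * norm w"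
        by (simp add: power2_eq_square mult_ac)
      then have "?n * \<bar>flow_form h w (p, ?n *\<^sub>R y)\<bar> \<le> C * norm h * norm w / (R\<^sup>2 * ?n)"
        using R by (subst pos_le_divide_eq) auto
      then show ?thesis by (simp add: divide_divide_eq_left)
    qed
    finally show "\<bar>integral {1..?n} (\<lambda>t. - ?D y t w) - flow_form h w (p, y)\<bar> \<le> C * norm h / R\<^sup>2 * norm w / ?n" .
  qed
  then show ?thesis by (simp add: flow_stream_def)
qed

text \<open>The derivative of the integrand of the stream function in the parameter direction
  \<open>a\<close>.\<close>

definition flow_stream_rate where
  "flow_stream_rate h x p a t = - (area_form (V h (p, t *\<^sub>R x)) (M a x (p, t *\<^sub>R x)) + area_form (W h a (p, t *\<^sub>R x)) (J x (p, t *\<^sub>R x)))"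

lemma flow_stream_rate_continuous:
  assumes "continuous_on S p" "continuous_on S z" "\<And>s. s \<in> S \<Longrightarrow> (p s, z s *\<^sub>R x) \<in> Dom"
  shows "continuous_on S (\<lambda>s. flow_stream_rate h x (p s) a (z s))"
  unfolding flow_stream_rate_def
  by (intro continuous_intros bounded_bilinear.continuous_on[OF bounded_bilinear_area_form]
      continuous_on_Dom_compose[OF smooth_V] continuous_on_Dom_compose[OF smooth_J]
      continuous_on_Dom_compose[OF smooth_M] continuous_on_Dom_compose[OF smooth_W] assms)

lemma flow_stream_derivative_p:
  assumes x: "x \<in> - ball 0 R"
  shows "((\<lambda>p. flow_stream h (p, x)) has_derivative (\<lambda>a. lim (\<lambda>n. integral {1..real (Suc n)} (flow_stream_rate h x p a)))) (at p)"
    and "convergent (\<lambda>n. integral {1..real (Suc n)} (flow_stream_rate h x p a))"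
proof -
  let ?U = "ball p 1"
  have nx: "norm x \<ge> R" "norm x > 0" using x R by auto
  obtain C where dec: "decay_const C (cball p 1) h" using decay_const_exists[of "cball p 1" h] by auto
  note C = decay_constD[OF dec]
  define E where "E = (C * norm h / (norm x)\<^sup>2) * (C * norm x / R\<^sup>2) + (C / (norm x)\<^sup>2) * (C * norm x)"
  have E0: "E \<ge> 0" using C(1) by (simp add: E_def)
  have bnd: "\<bar>flow_stream_rate h x y a t\<bar> \<le> (E * norm a) / t\<^sup>2" if y: "y \<in> cball p 1" and t: "1 \<le> t" for y a t
  proof -
    let ?z = "(y, t *\<^sub>R x)"
    have rx: "t *\<^sub>R x \<in> - ball 0 R" by (rule ray[OF x t])
    have nt: "(norm (t *\<^sub>R x))\<^sup>2 = t\<^sup>2 * (norm x)\<^sup>2" "t\<^sup>2 * (norm x)\<^sup>2 > 0"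
      using t nx by (auto simp: power_mult_distrib)
    have v: "norm (V h ?z) \<le> C * norm h / (t\<^sup>2 * (norm x)\<^sup>2)" using C(2)[OF y rx, of h] nt by (simp add: pos_le_divide_eq)
    have w: "norm (W h a ?z) \<le> C * norm a / (t\<^sup>2 * (norm x)\<^sup>2)" using C(4)[OF y rx, of a] nt by (simp add: pos_le_divide_eq)
    have "R\<^sup>2 \<le> (norm (t *\<^sub>R x))\<^sup>2" using rx R by (intro power_mono) auto
    then have "norm (M a x ?z) * R\<^sup>2 \<le> norm (M a x ?z) * (norm (t *\<^sub>R x))\<^sup>2" by (intro mult_left_mono) auto
    also have "\<dots> \<le> C * norm a * norm x" by (rule C(7)[OF y rx])
    finally have m: "norm (M a x ?z) \<le> C * norm a * norm x / R\<^sup>2" using R by (simp add: pos_le_divide_eq)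
    have "\<bar>flow_stream_rate h x y a t\<bar> \<le> \<bar>area_form (V h ?z) (M a x ?z)\<bar> + \<bar>area_form (W h a ?z) (J x ?z)\<bar>" by (simp add: flow_stream_rate_def)
    also have "\<dots> \<le> norm (V h ?z) * norm (M a x ?z) + norm (W h a ?z) * norm (J x ?z)"
      by (intro add_mono area_form_bound)
    also have "\<dots> \<le> (C * norm h / (t\<^sup>2 * (norm x)\<^sup>2)) * (C * norm a * norm x / R\<^sup>2) + (C * norm a / (t\<^sup>2 * (norm x)\<^sup>2)) * (C * norm x)"
      by (intro add_mono mult_mono v m w C(3)[OF y rx]) (use C(1) in auto)
    also have "\<dots> = (E * norm a) / t\<^sup>2"
    proof -
      have "(c * H / (s * y)) * (c * u * n / r) + (c * u / (s * y)) * (c * n) = ((c * H / y) * (c * n / r) + (c / y) * (c * n)) * u / s"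
        if "s \<noteq> 0" "y \<noteq> 0" "r \<noteq> 0" for c H s y u n r :: real
        using that by (simp add: field_simps)
      then show ?thesis unfolding E_def using t nx R by simp
    qed
    finally show ?thesis .
  qed
  have cD: "continuous_on {1..} (flow_stream_rate h x y a)" for y a
    by (rule flow_stream_rate_continuous) (use ray_in_Dom[OF x] in \<open>auto intro: continuous_intros\<close>)
  note tails = integral_tail[OF cD bnd]
  show "convergent (\<lambda>n. integral {1..real (Suc n)} (flow_stream_rate h x p a))" by (rule tails(1)) simp_all
  have "((\<lambda>y. lim (\<lambda>n. integral {1..real (Suc n)} (\<lambda>t. - flow_form h x (y, t *\<^sub>R x)))) has_derivative
     (\<lambda>a. lim (\<lambda>n. integral {1..real (Suc n)} (flow_stream_rate h x p a)))) (at p)"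
  proof (rule has_derivative_improper_integral[where U = ?U and f' = "\<lambda>y t a. flow_stream_rate h x y a t" and C = E
        and g' = "\<lambda>y a. lim (\<lambda>n. integral {1..real (Suc n)} (flow_stream_rate h x y a))"])
    show "open ?U" "convex ?U" "p \<in> ?U" by auto
    show "((\<lambda>y. - flow_form h x (y, t *\<^sub>R x)) has_derivative (\<lambda>a. flow_stream_rate h x y a t)) (at y)" if "y \<in> ?U" "1 \<le> t" for y t
    proof -
      let ?z = "(y, t *\<^sub>R x)"
      have z: "?z \<in> Dom" by (rule ray_in_Dom[OF x that(2)])
      have c: "((\<lambda>y. (y, t *\<^sub>R x)) has_derivative (\<lambda>a. (a, 0))) (at y)"
        by (rule has_derivative_eq_rhs, (rule derivative_intros)+) simp
      have dV: "((\<lambda>y. V h (y, t *\<^sub>R x)) has_derivative (\<lambda>a. W h a ?z)) (at y)"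
        using has_derivative_compose[OF c has_derivative_V[OF z, of h]] linear_0[OF linear_partials(4)[OF z]] by simp
      have dJ: "((\<lambda>y. J x (y, t *\<^sub>R x)) has_derivative (\<lambda>a. M a x ?z)) (at y)"
        using has_derivative_compose[OF c has_derivative_J[OF z, of x]] linear_0[OF linear_partials(6)[OF z]] by simp
      show ?thesis unfolding flow_form_def flow_stream_rate_def by (rule has_derivative_minus[OF has_derivative_area_form[OF dV dJ]])
    qed
    show "continuous_on {1..} (\<lambda>t. - flow_form h x (y, t *\<^sub>R x))" for y
      by (intro continuous_intros flow_form_continuous) (use ray_in_Dom[OF x] in auto)
    show "continuous_on (?U \<times> {1..}) (\<lambda>(y, t). flow_stream_rate h x y a t)" for a
    proof -
      have i: "(fst s, snd s *\<^sub>R x) \<in> Dom" if "s \<in> ?U \<times> {1..}" for s using that ray_in_Dom[OF x] by auto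
      show ?thesis unfolding case_prod_beta
        by (rule flow_stream_rate_continuous) (use i in \<open>auto intro: continuous_intros\<close>)
    qed
    show "\<bar>integral {1..real (Suc n)} (\<lambda>t. flow_stream_rate h x y a t) - lim (\<lambda>n. integral {1..real (Suc n)} (flow_stream_rate h x y a))\<bar> \<le> E * norm a / real (Suc n)"
      if "y \<in> ?U" for n y a
      by (rule tails(2)) (use that in auto)
    show "convergent (\<lambda>n. integral {1..real (Suc n)} (\<lambda>t. - flow_form h x (y, t *\<^sub>R x)))" if "y \<in> ?U" for y
      by (rule flow_stream_convergent[OF x])
  qed
  then show "((\<lambda>p. flow_stream h (p, x)) has_derivative (\<lambda>a. lim (\<lambda>n. integral {1..real (Suc n)} (flow_stream_rate h x p a)))) (at p)"
    by (simp add: flow_stream_def)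
qed

text \<open>Antisymmetrising the rate in the two parameter directions cancels the second
  derivatives in the parameters, and what remains is the derivative along the ray of
  \<open>area_form (V h1) (V h2)\<close>, which vanishes at infinity. It expresses that the
  commutator of two Hamiltonian fields has their symplectic product as Hamiltonian, up to the
  sign.\<close>

lemma flow_stream_curl:
  assumes x: "x \<in> - ball 0 R"
  shows "frechet_derivative (\<lambda>p. flow_stream h2 (p, x)) (at p) h1 - frechet_derivative (\<lambda>p. flow_stream h1 (p, x)) (at p) h2
     = - area_form (V h1 (p, x)) (V h2 (p, x))"
proof -
  let ?D = "\<lambda>h a t. flow_stream_rate h x p a t"
  let ?I = "\<lambda>h a n. integral {1..real (Suc n)} (?D h a)"
  have e: "frechet_derivative (\<lambda>p. flow_stream h (p, x)) (at p) a = lim (?I h a)" for h a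
    by (simp add: frechet_derivative_at[OF flow_stream_derivative_p(1)[OF x], symmetric])
  have L: "?I h a \<longlonglongrightarrow> lim (?I h a)" for h a
    using flow_stream_derivative_p(2)[OF x, of h p a] by (simp add: convergent_LIMSEQ_iff)
  let ?G = "\<lambda>t. area_form (V h1 (p, t *\<^sub>R x)) (V h2 (p, t *\<^sub>R x))"
  have cD: "continuous_on {1..b} (?D h a)" for h a b
    by (rule flow_stream_rate_continuous) (use ray_in_Dom[OF x] in \<open>auto intro: continuous_intros\<close>)
  have int: "?D h a integrable_on {1..b}" for h a b by (rule integrable_continuous_real[OF cD])
  have diff: "?I h2 h1 n - ?I h1 h2 n = ?G (real (Suc n)) - area_form (V h1 (p, x)) (V h2 (p, x))" for n
  proof -
    have "((\<lambda>t. ?D h2 h1 t - ?D h1 h2 t) has_integral (?G (real (Suc n)) - ?G 1)) {1..real (Suc n)}"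
    proof (rule fundamental_theorem_of_calculus)
      fix t assume t: "t \<in> {1..real (Suc n)}"
      let ?z = "(p, t *\<^sub>R x)"
      have z: "?z \<in> Dom" by (rule ray_in_Dom[OF x]) (use t in auto)
      have ct: "((\<lambda>s. (p, s *\<^sub>R x)) has_derivative (\<lambda>s. (0, s *\<^sub>R x))) (at t)"
        by (rule has_derivative_eq_rhs, (rule derivative_intros)+) simp
      have tV: "((\<lambda>s. V h (p, s *\<^sub>R x)) has_derivative (\<lambda>s. s *\<^sub>R M h x ?z)) (at t)" for h
        using has_derivative_compose[OF ct has_derivative_V[OF z, of h]] linear_0[OF linear_partials(3)[OF z]] linear_scale[OF linear_partials(4)[OF z]]
        by simp
      have eq: "?D h2 h1 t - ?D h1 h2 t = area_form (V h1 ?z) (M h2 x ?z) + area_form (M h1 x ?z) (V h2 ?z)"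
        unfolding flow_stream_rate_def using partials_commute(1)[OF z, of h1 h2] area_form_commute[of "V h2 ?z" "M h1 x ?z"] by simp
      have "(?G has_real_derivative ?D h2 h1 t - ?D h1 h2 t) (at t)"
        unfolding has_field_derivative_def eq
        by (rule has_derivative_eq_rhs[OF has_derivative_area_form[OF tV tV]])
          (simp add: fun_eq_iff area_form_simps algebra_simps)
      then show "(?G has_vector_derivative ?D h2 h1 t - ?D h1 h2 t) (at t within {1..real (Suc n)})"
        by (simp add: has_real_derivative_iff_has_vector_derivative has_vector_derivative_at_within)
    qed simp
    then have "integral {1..real (Suc n)} (\<lambda>t. ?D h2 h1 t - ?D h1 h2 t) = ?G (real (Suc n)) - area_form (V h1 (p, x)) (V h2 (p, x))"
      by (simp add: integral_unique)
    then show ?thesis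
      using Henstock_Kurzweil_Integration.integral_diff[OF int int] by simp
  qed
  obtain C where dec: "decay_const C {p} 0" using decay_const_exists[of "{p}" 0] by auto
  note C = decay_constD[OF dec]
    have nx: "norm x \<ge> R" using x by simp
    have V: "norm (V h (p, t *\<^sub>R x)) \<le> C * norm h / R\<^sup>2 / t" if "1 \<le> t" for h t
    proof -
      have "norm (V h (p, t *\<^sub>R x)) * (norm (t *\<^sub>R x))\<^sup>2 \<le> C * norm h" by (rule C(2)[OF singletonI ray[OF x that]])
      moreover have "R\<^sup>2 * t \<le> (norm (t *\<^sub>R x))\<^sup>2"
      proof -
        have "R\<^sup>2 * t \<le> (norm x)\<^sup>2 * t\<^sup>2" using nx R that by (intro mult_mono power_mono) (auto simp: power2_eq_square)
        then show ?thesis by (simp add: power_mult_distrib mult.commute)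
      qed
      ultimately have "norm (V h (p, t *\<^sub>R x)) * (R\<^sup>2 * t) \<le> C * norm h" by (meson norm_ge_zero mult_left_mono order_trans)
      then have "norm (V h (p, t *\<^sub>R x)) \<le> C * norm h / (R\<^sup>2 * t)" using R that by (simp add: pos_le_divide_eq)
      then show ?thesis by (simp add: divide_divide_eq_left)
    qed
    let ?c = "(C * norm h1 / R\<^sup>2) * (C * norm h2 / R\<^sup>2)"
  have "(\<lambda>n. ?G (real (Suc n))) \<longlonglongrightarrow> 0"
  proof (rule Lim_null_comparison)
    show "\<forall>\<^sub>F n in sequentially. norm (?G (real (Suc n))) \<le> ?c * (1 / real (Suc n))"
    proof (rule always_eventually, rule allI)
      fix n
      have "norm (?G (real (Suc n))) \<le> norm (V h1 (p, real (Suc n) *\<^sub>R x)) * norm (V h2 (p, real (Suc n) *\<^sub>R x))"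
        by (simp only: real_norm_def area_form_bound)
      also have "\<dots> \<le> (C * norm h1 / R\<^sup>2 / real (Suc n)) * (C * norm h2 / R\<^sup>2 / 1)"
      proof (rule mult_mono)
        have "C * norm h2 / R\<^sup>2 / real (Suc n) \<le> C * norm h2 / R\<^sup>2 / 1"
          using C(1) by (intro divide_left_mono) auto
        then show "norm (V h2 (p, real (Suc n) *\<^sub>R x)) \<le> C * norm h2 / R\<^sup>2 / 1"
          using V[of "real (Suc n)" h2] by simp
      qed (use V C(1) in auto)
      also have "\<dots> = ?c * (1 / real (Suc n))"
      proof -
        have "(a / s) * (b / 1) = a * b * (1 / s)" for a b s :: real by simp
        then show ?thesis .
      qed
      finally show "norm (?G (real (Suc n))) \<le> ?c * (1 / real (Suc n))" .
    qed
    show "(\<lambda>n. ?c * (1 / real (Suc n))) \<longlonglongrightarrow> 0"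
      using tendsto_mult_right_zero[OF LIMSEQ_Suc[OF lim_1_over_n]] .
  qed
  then have "(\<lambda>n. ?I h2 h1 n - ?I h1 h2 n) \<longlonglongrightarrow> 0 - area_form (V h1 (p, x)) (V h2 (p, x))"
    unfolding diff by (intro tendsto_intros)
  moreover have "(\<lambda>n. ?I h2 h1 n - ?I h1 h2 n) \<longlonglongrightarrow> lim (?I h2 h1) - lim (?I h1 h2)"
    by (intro tendsto_diff L)
  ultimately show ?thesis unfolding e using LIMSEQ_unique by fastforce
qed

end

section \<open>Existence of lifts\<close>

text \<open>Families of area-preserving maps of the whole plane that are the identity far away,
  with a bound that does not depend on the parameter. They act on the reference region by
  restriction and the decay conditions are trivial for them.\<close>

definition area_family :: "(real \<times> real \<Rightarrow> real^2 \<Rightarrow> real^2) \<Rightarrow> bool" where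
  "area_family \<Psi> \<longleftrightarrow> smooth_on UNIV (\<lambda>(p, x). \<Psi> p x) \<and> (\<forall>p. inj (\<Psi> p)) \<and>
     (\<forall>p x a b. area_form (frechet_derivative (\<Psi> p) (at x) a) (frechet_derivative (\<Psi> p) (at x) b) = area_form a b) \<and>
     (\<exists>\<rho>. \<forall>p x. norm x \<ge> \<rho> \<longrightarrow> \<Psi> p x = x)"

lemma smooth_slice:
  assumes "smooth_on UNIV (\<lambda>(p, x). \<Psi> p x)" shows "smooth_on UNIV (\<Psi> p)"
proof -
  have "smooth_on UNIV (\<lambda>x. (\<lambda>(p, x). \<Psi> p x) (p, x))"
    by (rule smooth_on_compose_UNIV[OF open_UNIV assms]) (intro smooth_intros open_UNIV)
  then show ?thesis by simp
qed

lemma area_family_inj: "area_family \<Psi> \<Longrightarrow> inj (\<Psi> p)"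
  unfolding area_family_def by blast

lemma area_family_area:
  "area_family \<Psi> \<Longrightarrow>
   area_form (frechet_derivative (\<Psi> p) (at x) a) (frechet_derivative (\<Psi> p) (at x) b) = area_form a b"
  unfolding area_family_def by blast

lemma area_family_comp:
  assumes "area_family \<Psi>" "area_family \<Omega>" shows "area_family (\<lambda>p x. \<Psi> p (\<Omega> p x))"
proof -
  have s: "smooth_on UNIV (\<lambda>(p, x). \<Psi> p x)" "smooth_on UNIV (\<lambda>(p, x). \<Omega> p x)"
    using assms unfolding area_family_def by blast+
  have "smooth_on UNIV (\<lambda>z. (\<lambda>(p, x). \<Psi> p x) (fst z, (\<lambda>(p, x). \<Omega> p x) z))"
    by (rule smooth_on_compose_UNIV[OF open_UNIV s(1)]) (intro smooth_on_Pair smooth_on_fst smooth_on_id s(2) open_UNIV)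
  moreover have "(\<lambda>z. (\<lambda>(p, x). \<Psi> p x) (fst z, (\<lambda>(p, x). \<Omega> p x) z)) = (\<lambda>(p, x). \<Psi> p (\<Omega> p x))"
    by (simp add: fun_eq_iff)
  ultimately have 1: "smooth_on UNIV (\<lambda>(p, x). \<Psi> p (\<Omega> p x))" by simp
  have 2: "inj (\<lambda>x. \<Psi> p (\<Omega> p x))" for p
    using inj_compose[OF area_family_inj[OF assms(1)] area_family_inj[OF assms(2)]] by (simp add: o_def)
  have D: "frechet_derivative (\<lambda>x. \<Psi> p (\<Omega> p x)) (at x) a =
      frechet_derivative (\<Psi> p) (at (\<Omega> p x)) (frechet_derivative (\<Omega> p) (at x) a)" for p x a
    by (simp add: frechet_derivative_at[OF has_derivative_compose[OF smooth_on_has_derivative[OF smooth_slice[OF s(2)] UNIV_I]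
      smooth_on_has_derivative[OF smooth_slice[OF s(1)] UNIV_I]], symmetric])
  obtain \<rho>1 where \<rho>1: "\<And>p x. norm x \<ge> \<rho>1 \<Longrightarrow> \<Psi> p x = x" using assms(1) unfolding area_family_def by blast
  obtain \<rho>2 where \<rho>2: "\<And>p x. norm x \<ge> \<rho>2 \<Longrightarrow> \<Omega> p x = x" using assms(2) unfolding area_family_def by blast
  have 3: "\<exists>\<rho>. \<forall>p x. norm x \<ge> \<rho> \<longrightarrow> \<Psi> p (\<Omega> p x) = x" by (rule exI[of _ "max \<rho>1 \<rho>2"]) (simp add: \<rho>1 \<rho>2)
  show ?thesis unfolding area_family_def
  proof (intro conjI allI 1 2 3)
    show "area_form (frechet_derivative (\<lambda>x. \<Psi> p (\<Omega> p x)) (at x) a) (frechet_derivative (\<lambda>x. \<Psi> p (\<Omega> p x)) (at x) b) = area_form a b" for p x a b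
      unfolding D by (simp only: area_family_area[OF assms(1)] area_family_area[OF assms(2)])
  qed
qed

lemma area_family_id: "area_family (\<lambda>p x. x)"
proof -
  have "frechet_derivative (\<lambda>x::real^2. x) (at x) = (\<lambda>h. h)" for x
    by (rule frechet_derivative_at[symmetric]) (rule has_derivative_ident)
  moreover have "smooth_on UNIV (\<lambda>(p::real\<times>real, x::real^2). x)"
    unfolding case_prod_beta by (intro smooth_intros open_UNIV)
  ultimately show ?thesis unfolding area_family_def by auto
qed

definition twist :: "real^2 \<Rightarrow> (real \<Rightarrow> real) \<Rightarrow> real^2 \<Rightarrow> real^2" where
  "twist c h x = c + rot (h ((x - c) \<bullet> (x - c))) (x - c)"

lemma twist_inverse: "twist c (\<lambda>s. - h s) (twist c h x) = x"
  by (simp add: twist_def rot_rot)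

text \<open>A twist rotates each circle about \<open>c p\<close> by its own angle. Its derivative
  is a rotation composed with the shear \<open>w \<mapsto> w + k(w) J y\<close>, where
  \<open>y\<close> is the radius vector, \<open>J y\<close> the orthogonal direction and
  \<open>k(w)\<close> is proportional to \<open>y \<bullet> w\<close>. Both preserve
  area.\<close>

lemma area_family_twist:
  fixes c :: "real \<times> real \<Rightarrow> real^2"
  assumes c: "smooth_on UNIV c" "\<And>p. norm (c p) \<le> B" and h: "smooth_on UNIV h" "\<And>s. S\<^sup>2 \<le> s \<Longrightarrow> h s = 0" and S: "0 \<le> S"
  shows "area_family (\<lambda>p. twist (c p) h)"
  unfolding area_family_def
proof (intro conjI allI)
  have cs: "smooth_on UNIV (\<lambda>z::(real\<times>real)\<times>(real^2). c (fst z))"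
    by (rule smooth_on_compose_UNIV[OF open_UNIV c(1)]) (intro smooth_intros open_UNIV)
  show "smooth_on UNIV (\<lambda>(p, x). twist (c p) h x)"
    unfolding twist_def rot_def case_prod_beta
    by (intro smooth_on_add smooth_on_vector2 smooth_on_diff smooth_on_mult smooth_on_cos smooth_on_sin
        smooth_on_compose_UNIV[OF _ h(1)] smooth_on_inner smooth_on_nth smooth_on_snd smooth_on_id cs open_UNIV)
  show "inj (twist (c p) h)" for p by (metis injI twist_inverse)
  show "\<exists>\<rho>. \<forall>p x. norm x \<ge> \<rho> \<longrightarrow> twist (c p) h x = x"
  proof (intro exI allI impI)
    fix p and x :: "real^2" assume "norm x \<ge> B + S"
    then have "norm (x - c p) \<ge> S" using c(2)[of p] norm_triangle_ineq2[of x "c p"] by linarith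
    then have "S\<^sup>2 \<le> (x - c p) \<bullet> (x - c p)" unfolding dot_square_norm by (rule power_mono[OF _ S])
    then show "twist (c p) h x = x" by (simp add: twist_def h(2))
  qed
  fix p and x a b :: "real^2"
  define y where "y = x - c p"
  define s where "s = y \<bullet> y"
  \<comment> \<open>quarter turn\<close>
  define J where "J v = (vector [- v $ 2, v $ 1] :: real^2)" for v :: "real^2"
  define h' where "h' = frechet_derivative h (at s) 1"
  have dh: "(h has_derivative (\<lambda>r. r * h')) (at s)"
  proof -
    have d: "(h has_derivative frechet_derivative h (at s)) (at s)" by (rule smooth_on_has_derivative[OF h(1)]) simp
    have "frechet_derivative h (at s) r = r * h'" for r
      using linear_scale[OF has_derivative_linear[OF d], of r 1] by (simp add: h'_def)
    then show ?thesis by (intro has_derivative_eq_rhs[OF d]) (simp add: fun_eq_iff)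
  qed
  have lJ: "bounded_linear J"
    unfolding linear_conv_bounded_linear[symmetric] J_def by (rule linearI) (simp_all add: vec2_eq_iff)
  let ?k = "\<lambda>w. (2 * (y \<bullet> w)) * h'"
  have dk: "((\<lambda>x. h ((x - c p) \<bullet> (x - c p))) has_derivative ?k) (at x)"
    using has_derivative_compose[OF has_derivative_square_dist[of "c p" x] dh[unfolded s_def y_def]] by (simp add: y_def)
  have dy: "((\<lambda>x. x - c p) has_derivative (\<lambda>w. w)) (at x)" by (auto intro!: derivative_eq_intros)
  have D: "(twist (c p) h has_derivative (\<lambda>w. rot (h s) (w + ?k w *\<^sub>R J y))) (at x)"
  proof -
    have "((\<lambda>x. c p + (cos (h ((x - c p) \<bullet> (x - c p))) *\<^sub>R (x - c p) + sin (h ((x - c p) \<bullet> (x - c p))) *\<^sub>R J (x - c p))) has_derivative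
       (\<lambda>w. 0 + ((cos (h s) *\<^sub>R w + (?k w * - sin (h s)) *\<^sub>R y) + (sin (h s) *\<^sub>R J w + (?k w * cos (h s)) *\<^sub>R J y)))) (at x)"
      using has_derivative_add[OF has_derivative_const has_derivative_add[OF
          has_derivative_scaleR[OF has_derivative_cos[OF dk] dy]
          has_derivative_scaleR[OF has_derivative_sin[OF dk] bounded_linear.has_derivative[OF lJ dy]]]]
      by (simp add: y_def s_def)
    moreover have "0 + ((cos (h s) *\<^sub>R w + (?k w * - sin (h s)) *\<^sub>R y) + (sin (h s) *\<^sub>R J w + (?k w * cos (h s)) *\<^sub>R J y))
        = rot (h s) (w + ?k w *\<^sub>R J y)" for w
      by (simp add: vec2_eq_iff J_def algebra_simps)
    moreover have "twist (c p) h = (\<lambda>x. c p + (cos (h ((x - c p) \<bullet> (x - c p))) *\<^sub>R (x - c p) + sin (h ((x - c p) \<bullet> (x - c p))) *\<^sub>R J (x - c p)))"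
      by (simp add: fun_eq_iff twist_def vec2_eq_iff J_def algebra_simps)
    ultimately show ?thesis by (simp only:)
  qed
  have e: "area_form a (J y) = a \<bullet> y" "area_form (J y) b = - (y \<bullet> b)" for a b
    by (simp_all add: area_form_def J_def inner_vec2 algebra_simps)
  have J0: "J y \<bullet> y = 0" "y \<bullet> J y = 0" by (simp_all add: J_def inner_vec2)
  show "area_form (frechet_derivative (twist (c p) h) (at x) a) (frechet_derivative (twist (c p) h) (at x) b) = area_form a b"
    unfolding frechet_derivative_at[OF D, symmetric] area_form_rot
    by (simp add: area_form_simps e J0 inner_commute[of a y] algebra_simps)
qed

lemma bump_exists:
  fixes A B :: real
  assumes "A < B"
  obtains \<beta> :: "real \<Rightarrow> real" where "smooth_on UNIV \<beta>" "\<And>s. s \<le> A \<Longrightarrow> \<beta> s = 1" "\<And>s. B \<le> s \<Longrightarrow> \<beta> s = 0"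
proof -
  obtain \<sigma> :: "real \<Rightarrow> real" where \<sigma>: "smooth_on UNIV \<sigma>" "\<And>t. t \<le> 1 \<Longrightarrow> \<sigma> t = 0" "\<And>t. t \<ge> 2 \<Longrightarrow> \<sigma> t = 1"
    "\<And>t. 0 \<le> \<sigma> t" "\<And>t. \<sigma> t \<le> 1" using smooth_step_exists by blast
  show ?thesis
  proof (rule that[of "\<lambda>s. 1 - \<sigma> (1 + (s - A) * inverse (B - A))"])
    show "smooth_on UNIV (\<lambda>s. 1 - \<sigma> (1 + (s - A) * inverse (B - A)))"
      by (intro smooth_intros smooth_on_compose_UNIV[OF _ \<sigma>(1)] open_UNIV)
    show "1 - \<sigma> (1 + (s - A) * inverse (B - A)) = 1" if "s \<le> A" for s
      using that assms \<sigma>(2) by (simp add: mult_nonpos_nonneg)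
    show "1 - \<sigma> (1 + (s - A) * inverse (B - A)) = 0" if "B \<le> s" for s
    proof -
      have "(s - A) * inverse (B - A) \<ge> (B - A) * inverse (B - A)" using that assms by (intro mult_right_mono) auto
      then show ?thesis using assms \<sigma>(3) by simp
    qed
  qed
qed

lemma rot_pi: "rot pi x = - x" "rot (- pi) x = - x"
  by (simp_all add: vec2_eq_iff)

text \<open>The composition of two half-turns is a translation by twice the difference of their
  centres. A twist by the angle \<open>-\<pi>\<close> about \<open>c\<close> is followed by one by
  \<open>\<pi>\<close> about \<open>c + e/2\<close>, both with angles cut off at a distance. Far
  away each of them is the identity. The margins account for the displaced centre, whose distance
  from \<open>c\<close> is at most \<open>\<delta>/2\<close>.\<close>

lemma local_translation:
  fixes e :: "real \<times> real \<Rightarrow> real^2"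
  assumes e: "smooth_on UNIV e" "\<And>p. norm (e p) \<le> \<delta>" and d: "0 < \<delta>" "0 \<le> r"
  obtains \<Psi> where "area_family \<Psi>" "\<And>p x. norm (x - c) \<le> r \<Longrightarrow> \<Psi> p x = x + e p"
    "\<And>p x. norm (x - c) \<ge> r + 3 * \<delta> \<Longrightarrow> \<Psi> p x = x"
proof -
  have "(r + \<delta>)\<^sup>2 < (r + 2 * \<delta>)\<^sup>2" using d by (intro power_strict_mono) auto
  from bump_exists[OF this] obtain \<beta> :: "real \<Rightarrow> real" where \<beta>: "smooth_on UNIV \<beta>" "\<And>s. s \<le> (r + \<delta>)\<^sup>2 \<Longrightarrow> \<beta> s = 1" "\<And>s. (r + 2 * \<delta>)\<^sup>2 \<le> s \<Longrightarrow> \<beta> s = 0"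
    by metis
  have near: "\<beta> (y \<bullet> y) = 1" if "norm y \<le> r + \<delta>" for y :: "real^2"
    using \<beta>(2) that by (simp add: dot_square_norm power_mono)
  have far: "\<beta> (y \<bullet> y) = 0" if "r + 2 * \<delta> \<le> norm y" for y :: "real^2"
    using \<beta>(3) power_mono[OF that, of 2] d by (simp add: dot_square_norm)
  define m where "m p = c + (1/2) *\<^sub>R e p" for p
  have mb: "norm (m p) \<le> norm c + \<delta>" for p
    using norm_triangle_ineq[of c "(1/2) *\<^sub>R e p"] e(2)[of p] d by (simp add: m_def)
  have F1: "area_family (\<lambda>p. twist (m p) (\<lambda>s. pi * \<beta> s))"
    by (rule area_family_twist[of _ "norm c + \<delta>" _ "r + 2 * \<delta>"])
      (use mb d \<beta>(3) in \<open>auto simp: m_def[abs_def] intro!: smooth_intros e(1) \<beta>(1)\<close>)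
  have F2: "area_family (\<lambda>p. twist c (\<lambda>s. - (pi * \<beta> s)))"
    by (rule area_family_twist[of _ "norm c" _ "r + 2 * \<delta>"])
      (use d \<beta>(3) in \<open>auto intro!: smooth_intros \<beta>(1)\<close>)
  define \<Psi> where "\<Psi> p x = twist (m p) (\<lambda>s. pi * \<beta> s) (twist c (\<lambda>s. - (pi * \<beta> s)) x)" for p x
  show ?thesis
  proof (rule that[of \<Psi>])
    show "area_family \<Psi>" unfolding \<Psi>_def[abs_def] by (rule area_family_comp[OF F1 F2])
    fix p and x :: "real^2"
    show "\<Psi> p x = x + e p" if x: "norm (x - c) \<le> r"
    proof -
      have "norm (x - c) \<le> r + \<delta>" using x d by simp
      then have 1: "twist c (\<lambda>s. - (pi * \<beta> s)) x = c - (x - c)"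
        unfolding twist_def by (simp add: near rot_pi)
      have eq: "c - (x - c) - m p = - ((x - c) + (1/2) *\<^sub>R e p)" by (simp add: m_def)
      have "norm ((x - c) + (1/2) *\<^sub>R e p) \<le> r + \<delta>"
        using norm_triangle_ineq[of "x - c" "(1/2) *\<^sub>R e p"] x e(2)[of p] d by simp
      then have n: "norm (c - (x - c) - m p) \<le> r + \<delta>" unfolding eq norm_minus_cancel .
      have "\<Psi> p x = twist (m p) (\<lambda>s. pi * \<beta> s) (c - (x - c))" unfolding \<Psi>_def 1 ..
      also have "\<dots> = m p - (c - (x - c) - m p)" unfolding twist_def near[OF n] by (simp add: rot_pi)
      also have "\<dots> = x + e p"
        unfolding eq m_def by (simp add: scaleR_2[symmetric] algebra_simps) (simp add: vec2_eq_iff)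
      finally show ?thesis .
    qed
    show "\<Psi> p x = x" if x: "norm (x - c) \<ge> r + 3 * \<delta>"
    proof -
      have "r + 2 * \<delta> \<le> norm (x - c)" using x d by simp
      then have 1: "twist c (\<lambda>s. - (pi * \<beta> s)) x = x" unfolding twist_def by (simp add: far)
      have eq: "x - m p = (x - c) - (1/2) *\<^sub>R e p" by (simp add: m_def)
      have "norm (x - m p) \<ge> norm (x - c) - norm ((1/2) *\<^sub>R e p)" unfolding eq by (rule norm_triangle_ineq2)
      then have "r + 2 * \<delta> \<le> norm (x - m p)" using x e(2)[of p] d by simp
      then have "twist (m p) (\<lambda>s. pi * \<beta> s) x = x" unfolding twist_def by (simp add: far)
      then show ?thesis unfolding \<Psi>_def 1 .
    qed
  qed
qed

text \<open>A constant family expresses that the single map \<open>f\<close> is smooth, preserves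
  area and is the identity far away.\<close>

definition movable :: "(real^2) set \<Rightarrow> real^2 \<Rightarrow> real^2 \<Rightarrow> bool" where
  "movable U a b \<longleftrightarrow> (\<exists>f. area_family (\<lambda>p. f) \<and> f a = b \<and> (\<forall>x. x \<notin> U \<longrightarrow> f x = x))"

lemma movable_near:
  assumes "ball a (4 * \<delta>) \<subseteq> U" "norm (b - a) \<le> \<delta>" "\<delta> > 0"
  shows "movable U a b"
proof -
  obtain \<Psi> where \<Psi>: "area_family \<Psi>" "\<And>p x. norm (x - a) \<le> 0 \<Longrightarrow> \<Psi> p x = x + (b - a)"
    "\<And>p x. norm (x - a) \<ge> 0 + 3 * \<delta> \<Longrightarrow> \<Psi> p x = x"
    using local_translation[of "\<lambda>p. b - a" \<delta> 0 a] assms by (auto intro: smooth_on_const)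
  have "area_family (\<lambda>p. \<Psi> 0)"
  proof -
    have s: "smooth_on UNIV (\<lambda>(p, x). \<Psi> p x)" using \<Psi>(1) unfolding area_family_def by blast
    have "smooth_on UNIV (\<lambda>(p::real\<times>real, x). \<Psi> 0 x)"
      unfolding case_prod_beta by (rule smooth_on_compose_UNIV[OF open_UNIV smooth_slice[OF s]]) (intro smooth_intros open_UNIV)
    then show ?thesis using \<Psi>(1) unfolding area_family_def by blast
  qed
  moreover have "\<Psi> 0 x = x" if "x \<notin> U" for x
  proof -
    have "x \<notin> ball a (4 * \<delta>)" using assms(1) that by blast
    then have "norm (x - a) \<ge> 0 + 3 * \<delta>" using assms(3) by (simp add: dist_norm norm_minus_commute)
    then show ?thesis by (rule \<Psi>(3))
  qed
  ultimately show ?thesis unfolding movable_def using \<Psi>(2)[of a 0] by auto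
qed

lemma movable_trans: "movable U a b \<Longrightarrow> movable U b c \<Longrightarrow> movable U a c"
  unfolding movable_def
proof (elim exE conjE)
  fix f g assume f: "area_family (\<lambda>p. f)" "f a = b" "\<forall>x. x \<notin> U \<longrightarrow> f x = x"
    and g: "area_family (\<lambda>p. g)" "g b = c" "\<forall>x. x \<notin> U \<longrightarrow> g x = x"
  show "\<exists>f. area_family (\<lambda>p. f) \<and> f a = c \<and> (\<forall>x. x \<notin> U \<longrightarrow> f x = x)"
    by (rule exI[of _ "\<lambda>x. g (f x)"]) (use f g area_family_comp[OF g(1) f(1)] in auto)
qed

text \<open>Local translations inside \<open>U\<close> move nearby points to each other, and a
  locally constant equivalence relation on a connected set is trivial.\<close>

lemma movable_connected:
  assumes "open U" "connected U" "a \<in> U" "b \<in> U"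
  shows "movable U a b"
proof -
  have "movable U a b \<and> movable U b a"
  proof (rule connected_equivalence_relation[OF assms(2-4), of "\<lambda>a b. movable U a b \<and> movable U b a"])
    fix a assume a: "a \<in> U"
    obtain d where d: "d > 0" "ball a d \<subseteq> U" using assms(1) a openE by blast
    define \<delta> where "\<delta> = d / 5"
    have \<delta>: "\<delta> > 0" "5 * \<delta> = d" using d by (auto simp: \<delta>_def)
    show "\<exists>T. openin (top_of_set U) T \<and> a \<in> T \<and> (\<forall>x\<in>T. movable U a x \<and> movable U x a)"
    proof (intro exI[of _ "ball a \<delta>"] conjI ballI)
      have "ball a \<delta> \<subseteq> U" using d \<delta> by (auto intro: less_trans)
      then show "openin (top_of_set U) (ball a \<delta>)" by (simp add: open_subset)
      show "a \<in> ball a \<delta>" using \<delta> by simp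
      fix x assume x: "x \<in> ball a \<delta>"
      then have n: "norm (x - a) \<le> \<delta>" "norm (a - x) \<le> \<delta>" by (auto simp: dist_norm norm_minus_commute)
      show "movable U a x" by (rule movable_near[OF _ n(1) \<delta>(1)]) (use d \<delta> in auto)
      have "ball x (4 * \<delta>) \<subseteq> ball a d"
      proof
        fix y assume "y \<in> ball x (4 * \<delta>)"
        then show "y \<in> ball a d" using x \<delta> dist_triangle[of a y x] by simp
      qed
      then show "movable U x a" by (intro movable_near[OF _ n(2) \<delta>(1)]) (use d in auto)
    qed
  qed (use movable_trans in blast)+
  then show ?thesis ..
qed

text \<open>The points are moved one after another. The complement of the disc and of finitely
  many points is still connected, so the next point travels without disturbing those already
  placed.\<close>

lemma move_points:
  fixes y x :: "'i \<Rightarrow> real^2"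
  assumes "finite K" and y: "inj y" "\<And>i. y i \<notin> cball c R" and x: "inj x" "\<And>i. x i \<notin> cball c R"
  shows "\<exists>f. area_family (\<lambda>p. f) \<and> (\<forall>z\<in>cball c R. f z = z) \<and> (\<forall>i\<in>K. f (y i) = x i)"
  using assms(1)
proof (induction K)
  case empty
  show ?case using area_family_id by (intro exI[of _ "\<lambda>x. x"]) auto
next
  case (insert k K)
  then obtain f where f: "area_family (\<lambda>p. f)" "\<And>z. z \<in> cball c R \<Longrightarrow> f z = z" "\<And>i. i \<in> K \<Longrightarrow> f (y i) = x i" by blast
  have inj: "inj f" using f(1) unfolding area_family_def by blast
  let ?U = "- cball c R - x ` K"
  have o: "open ?U" using insert(1) by (intro open_Diff finite_imp_closed) auto
  have con: "connected ?U"
    by (rule connected_open_delete_finite[OF _ connected_exterior]) (use insert(1) in auto)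
  have 1: "f (y k) \<in> ?U"
  proof -
    have "f (y k) \<notin> cball c R"
    proof
      assume a: "f (y k) \<in> cball c R"
      then have "f (f (y k)) = f (y k)" by (rule f(2))
      then have "f (y k) = y k" using inj by (simp add: inj_eq)
      then show False using a y(2)[of k] by simp
    qed
    moreover have "f (y k) \<noteq> x i" if "i \<in> K" for i
      using f(3)[OF that] inj y(1) insert(2) that by (metis injD)
    ultimately show ?thesis by auto
  qed
  have 2: "x k \<in> ?U" using x insert(2) by (auto dest: injD)
  obtain g where g: "area_family (\<lambda>p. g)" "g (f (y k)) = x k" "\<And>z. z \<notin> ?U \<Longrightarrow> g z = z"
    using movable_connected[OF o con 1 2] unfolding movable_def by blast
  show ?case
    by (rule exI[of _ "\<lambda>z. g (f z)"])
      (use f g area_family_comp[OF g(1) f(1)] in auto)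
qed

text \<open>The half-turn about the midpoint of the two centres carries the disc to the disc; it
  is cut off outside a circle that encloses both. The vortices are then moved to their places in
  the exterior of the second disc.\<close>

lemma initial_map:
  fixes xb x :: "'i::finite \<Rightarrow> real^2"
  assumes R: "R > 0" and xb: "inj xb" "\<And>i. xb i \<notin> cball 0 R" and x: "inj x" "\<And>i. x i \<notin> cball c R"
  obtains f where "area_family (\<lambda>p. f)" "f ` sphere 0 R = sphere c R" "\<And>i. f (xb i) = x i"
proof -
  \<comment> \<open>the disc of this radius about \<open>c/2\<close> contains the original
    body\<close>
  define r where "r = R + norm c"
  have r: "0 \<le> r" using R by (simp add: r_def)
  have "r\<^sup>2 < (r + 1)\<^sup>2" using r by (intro power_strict_mono) auto
  from bump_exists[OF this] obtain \<beta> :: "real \<Rightarrow> real" where \<beta>: "smooth_on UNIV \<beta>" "\<And>s. s \<le> r\<^sup>2 \<Longrightarrow> \<beta> s = 1" "\<And>s. (r + 1)\<^sup>2 \<le> s \<Longrightarrow> \<beta> s = 0"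
    by metis
  define m where "m = (1/2) *\<^sub>R c"
  define t where "t = twist m (\<lambda>s. pi * \<beta> s)"
  have at: "area_family (\<lambda>p. t)" unfolding t_def
    by (rule area_family_twist[of "\<lambda>p. m" "norm m" _ "r + 1"])
      (use r \<beta>(3) in \<open>auto intro!: smooth_intros \<beta>(1)\<close>)
  have injt: "inj t" using at unfolding area_family_def by blast
  have tz: "t z = c - z" if "z \<in> cball 0 R" for z
  proof -
    have "norm m = norm c / 2" by (simp add: m_def)
    then have "norm (z - m) \<le> r" using norm_triangle_ineq4[of z m] that norm_ge_zero[of c]
      unfolding r_def mem_cball_0 by linarith
    then have "\<beta> ((z - m) \<bullet> (z - m)) = 1" using \<beta>(2) by (simp add: dot_square_norm power_mono)
    then have "t z = m - (z - m)" by (simp add: t_def twist_def rot_pi)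
    also have "\<dots> = c - z" by (simp add: m_def vec2_eq_iff)
    finally show ?thesis .
  qed
  have ts: "t ` sphere 0 R = sphere c R"
  proof -
    have "t ` sphere 0 R = (\<lambda>z. c - z) ` sphere 0 R" by (rule image_cong) (auto intro: tz)
    also have "\<dots> = sphere c R"
    proof
      show "(\<lambda>z. c - z) ` sphere 0 R \<subseteq> sphere c R" by (auto simp: dist_norm)
      show "sphere c R \<subseteq> (\<lambda>z. c - z) ` sphere 0 R"
      proof
        fix w assume "w \<in> sphere c R"
        then have "w = c - (c - w)" "c - w \<in> sphere 0 R" by (simp_all add: dist_norm norm_minus_commute)
        then show "w \<in> (\<lambda>z. c - z) ` sphere 0 R" by (rule image_eqI)
      qed
    qed
    finally show ?thesis .
  qed
  have ty: "t (xb i) \<notin> cball c R" for i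
  proof
    assume a: "t (xb i) \<in> cball c R"
    let ?z = "c - t (xb i)"
    have z: "?z \<in> cball 0 R" using a by (simp add: dist_norm norm_minus_commute)
    then have "t ?z = t (xb i)" using tz[OF z] by simp
    then have "?z = xb i" using injt by (simp add: inj_eq)
    then show False using z xb(2)[of i] by metis
  qed
  have iy: "inj (\<lambda>i. t (xb i))" using inj_compose[OF injt xb(1)] by (simp add: o_def)
  obtain g where g: "area_family (\<lambda>p. g)" "\<And>z. z \<in> cball c R \<Longrightarrow> g z = z" "\<And>i. g (t (xb i)) = x i"
    using move_points[where K = UNIV, OF finite iy ty x] by blast
  show ?thesis
  proof (rule that[of "\<lambda>z. g (t z)"])
    show "area_family (\<lambda>p z. g (t z))" by (rule area_family_comp[OF g(1) at])
    have "(\<lambda>z. g (t z)) ` sphere 0 R = g ` sphere c R" unfolding ts[symmetric] by (simp add: image_image)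
    also have "\<dots> = id ` sphere c R" by (rule image_cong) (auto simp: g(2))
    finally show "(\<lambda>z. g (t z)) ` sphere 0 R = sphere c R" by simp
  qed (rule g(3))
qed

text \<open>The maps that move single vortices have supports of radius \<open>3 \<delta>\<close>.
  Because of the separation by \<open>4 \<delta>\<close> each of them fixes a
  \<open>\<delta>\<close>-neighbourhood of the body and of the other vortices, which contains all
  displaced positions. These fixed neighbourhoods have to be part of the induction.\<close>

lemma local_moves:
  fixes x :: "'i \<Rightarrow> real^2" and e :: "'i \<Rightarrow> real \<times> real \<Rightarrow> real^2"
  assumes "finite I" and d: "0 < \<delta>" and sep: "\<And>i j. i \<noteq> j \<Longrightarrow> norm (x i - x j) > 4 * \<delta>" "\<And>i. norm (x i - c) > R + 4 * \<delta>"
    and e: "\<And>i. smooth_on UNIV (e i)" "\<And>i p. norm (e i p) \<le> \<delta>"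
  shows "\<exists>\<Psi>. area_family \<Psi> \<and> (\<forall>p. \<forall>i\<in>I. \<Psi> p (x i) = x i + e i p) \<and>
     (\<forall>p j y. j \<notin> I \<longrightarrow> norm (y - x j) \<le> \<delta> \<longrightarrow> \<Psi> p y = y) \<and> (\<forall>p y. norm (y - c) \<le> R + \<delta> \<longrightarrow> \<Psi> p y = y)"
  using assms(1)
proof (induction I)
  case empty
  show ?case using area_family_id by (intro exI[of _ "\<lambda>p x. x"]) auto
next
  case (insert k I)
  then obtain \<Psi> where \<Psi>: "area_family \<Psi>" "\<And>p i. i \<in> I \<Longrightarrow> \<Psi> p (x i) = x i + e i p"
    "\<And>p j y. j \<notin> I \<Longrightarrow> norm (y - x j) \<le> \<delta> \<Longrightarrow> \<Psi> p y = y" "\<And>p y. norm (y - c) \<le> R + \<delta> \<Longrightarrow> \<Psi> p y = y" by blast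
  obtain T where T: "area_family T" "\<And>p y. norm (y - x k) \<le> 0 \<Longrightarrow> T p y = y + e k p"
    "\<And>p y. norm (y - x k) \<ge> 0 + 3 * \<delta> \<Longrightarrow> T p y = y"
    using local_translation[OF e(1,2) d order_refl] by metis
  have far: "T p y = y" if "norm (y - z) \<le> r" "norm (z - x k) > r + 3 * \<delta>" for p y z r
    using T(3)[of y p] that norm_triangle_ineq[of "z - y" "y - x k"] by (simp add: norm_minus_commute)
  show ?case
  proof (rule exI[of _ "\<lambda>p y. \<Psi> p (T p y)"], intro conjI allI ballI impI)
    show "area_family (\<lambda>p y. \<Psi> p (T p y))" by (rule area_family_comp[OF \<Psi>(1) T(1)])
    show "\<Psi> p (T p (x i)) = x i + e i p" if "i \<in> insert k I" for p i
    proof (cases "i = k")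
      case True
      then show ?thesis using T(2)[of "x k" p] \<Psi>(3)[OF insert(2), of "x k + e k p" p] e(2)[of k p] by simp
    next
      case False
      then show ?thesis using \<Psi>(2)[of i p] that far[of "x i" "x i" 0 p] sep(1)[of i k] d by simp
    qed
    show "\<Psi> p (T p y) = y" if "j \<notin> insert k I" "norm (y - x j) \<le> \<delta>" for p j y
    proof -
      have "T p y = y" by (rule far[OF that(2)]) (use sep(1)[of j k] that(1) in auto)
      then show ?thesis using \<Psi>(3)[of j y p] that by auto
    qed
    show "\<Psi> p (T p y) = y" if "norm (y - c) \<le> R + \<delta>" for p y
    proof -
      have "T p y = y" by (rule far[OF that]) (use sep(2)[of k] d in \<open>auto simp: norm_minus_commute\<close>)
      then show ?thesis using \<Psi>(4)[of y p] that by simp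
    qed
  qed
qed

lemma iter_deriv_zero: "iter_deriv ds (\<lambda>x. 0) = (\<lambda>x. 0)"
  by (induction ds) (simp_all add: frechet_derivative_at[OF has_derivative_const, symmetric])

text \<open>The map \<open>L\<close> selects the variable in which the support is bounded: the
  point itself, or the spatial component of a pair of parameter and point.\<close>

lemma compact_support_decay:
  fixes F :: "'a::euclidean_space \<Rightarrow> 'b::euclidean_space" and L :: "'a \<Rightarrow> real^2"
  assumes "smooth_on UNIV F" "continuous_on UNIV L" "\<And>z. \<rho> \<le> norm (L z) \<Longrightarrow> F z = 0"
    and "compact (T \<inter> {z. norm (L z) \<le> \<rho>})"
  shows "\<exists>C. \<forall>z\<in>T. norm (iter_deriv ds F z) * (norm (L z))\<^sup>2 \<le> C"
proof -
  let ?K = "T \<inter> {z. norm (L z) \<le> \<rho>}"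
  have c: "continuous_on ?K (\<lambda>z. norm (iter_deriv ds F z) * (norm (L z))\<^sup>2)"
    by (intro continuous_intros continuous_on_subset[OF smooth_on_imp_continuous_on[OF smooth_on_iter_deriv[OF assms(1)]]]
        continuous_on_subset[OF assms(2)]) auto
  obtain C where C: "\<And>z. z \<in> ?K \<Longrightarrow> norm (norm (iter_deriv ds F z) * (norm (L z))\<^sup>2) \<le> C"
    using continuous_on_compact_bound[OF assms(4) c] by metis
  have "norm (iter_deriv ds F z) * (norm (L z))\<^sup>2 \<le> \<bar>C\<bar>" if "z \<in> T" for z
  proof (cases "norm (L z) \<le> \<rho>")
    case True
    then show ?thesis using C[of z] that by simp
  next
    case False
    let ?U = "{z. \<rho> < norm (L z)}"
    have "open ?U" by (intro open_Collect_less continuous_intros assms(2))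
    moreover have "F z = 0" if "z \<in> ?U" for z using assms(3) that by simp
    moreover have "z \<in> ?U" using False by simp
    ultimately have "iter_deriv ds F z = iter_deriv ds (\<lambda>_. 0) z" by (rule iter_deriv_cong_open)
    then show ?thesis by (simp add: iter_deriv_zero)
  qed
  then show ?thesis by blast
qed

lemma area_family_smooth_family:
  assumes R: "R > 0" and \<Psi>: "area_family \<Psi>" and g: "smooth_on UNIV g"
    and bd: "\<And>p. \<Psi> p ` sphere 0 R = sphere (snd (g p)) R"
  shows "smooth_family R (\<lambda>p. (g p, \<Psi> p))"
proof -
  have s: "smooth_on UNIV (\<lambda>(p, x). \<Psi> p x)" using \<Psi> unfolding area_family_def by blast
  obtain \<rho> where \<rho>: "\<And>p x. norm x \<ge> \<rho> \<Longrightarrow> \<Psi> p x = x" using \<Psi> unfolding area_family_def by blast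
  have fr: "frontier (fluid R) = sphere 0 R" using R by (simp add: fluid_eq frontier_exterior)
  have Q: "(g p, \<Psi> p) \<in> Qspace R" for p
    unfolding Qspace_def mem_Collect_eq prod.case fr se2_act_frontier_body[OF R]
  proof (intro conjI ballI allI)
    show "smooth_near (fluid R) (\<Psi> p)" unfolding smooth_near_def
      by (rule exI[of _ UNIV]) (use smooth_slice[OF s] in auto)
    show "inj_on (\<Psi> p) (fluid R)" by (rule inj_on_subset[OF area_family_inj[OF \<Psi>] subset_UNIV])
    show "area_form (frechet_derivative (\<Psi> p) (at x) a) (frechet_derivative (\<Psi> p) (at x) b) = area_form a b" for x a b
      using \<Psi> unfolding area_family_def by blast
    show "\<exists>C. \<forall>x\<in>fluid R. norm (iter_deriv ds (\<lambda>x. \<Psi> p x - x) x) * (norm x)\<^sup>2 \<le> C" for ds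
    proof -
      have "\<exists>C. \<forall>x. norm (iter_deriv ds (\<lambda>x. \<Psi> p x - x) x) * (norm x)\<^sup>2 \<le> C"
        using compact_support_decay[OF smooth_on_diff[OF open_UNIV smooth_slice[OF s] smooth_on_id[OF open_UNIV]],
            of "\<lambda>x. x" \<rho> p UNIV ds] compact_cball[of "0::real^2" \<rho>] by (simp add: \<rho> cball_def)
      then show ?thesis by blast
    qed
    show "\<Psi> p ` sphere 0 R = sphere (snd (g p)) R" by (rule bd)
  qed
  have d: "smooth_on UNIV (\<lambda>(p, x). \<Psi> p x - x)"
  proof -
    have "(\<lambda>z. (\<lambda>(p, x). \<Psi> p x) z - snd z) = (\<lambda>(p, x). \<Psi> p x - x)" by (simp add: fun_eq_iff)
    then show ?thesis
      using smooth_on_diff[OF open_UNIV s smooth_on_snd[OF open_UNIV smooth_on_id[OF open_UNIV]]] by simp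
  qed
  show ?thesis unfolding smooth_family_def
  proof (intro conjI allI impI)
    show "(g p, \<Psi> p) \<in> Qspace R" for p by (rule Q)
    show "smooth_on UNIV (\<lambda>p. fst (g p, \<Psi> p))" using g by simp
    show "smooth_near (UNIV \<times> fluid R) (\<lambda>(p, x). snd (g p, \<Psi> p) x)" unfolding smooth_near_def
      by (rule exI[of _ UNIV]) (use s in auto)
    fix ds :: "((real \<times> real) \<times> (real^2)) list" and K :: "(real \<times> real) set" assume K: "compact K"
    have "K \<times> (UNIV :: (real^2) set) \<inter> {z. norm (snd z) \<le> \<rho>} = K \<times> cball 0 \<rho>" by auto
    then have "compact (K \<times> (UNIV :: (real^2) set) \<inter> {z. norm (snd z) \<le> \<rho>})" using K by (simp add: compact_Times)
    from compact_support_decay[OF d continuous_on_snd[OF continuous_on_id] _ this, of ds]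
    have "\<exists>C. \<forall>z\<in>K \<times> UNIV. norm (iter_deriv ds (\<lambda>(p, x). \<Psi> p x - x) z) * (norm (snd z))\<^sup>2 \<le> C"
      using \<rho> by fastforce
    then show "\<exists>C. \<forall>p\<in>K. \<forall>x\<in>fluid R. norm (iter_deriv ds (\<lambda>(p, x). snd (g p, \<Psi> p) x - x) (p, x)) * (norm x)\<^sup>2 \<le> C"
      by fastforce
  qed
qed

lemma finite_positive_lower_bound:
  fixes S :: "real set" assumes "finite S" "\<And>s. s \<in> S \<Longrightarrow> 0 < s"
  shows "\<exists>m>0. \<forall>s\<in>S. m \<le> s"
proof (intro exI[of _ "Min (insert 1 S)"] conjI ballI)
  show "0 < Min (insert 1 S)" using assms by (subst Min_gr_iff) auto
qed (use assms in \<open>auto intro: Min_le\<close>)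

text \<open>A fixed map first brings the body and the vortices to their positions. It is followed
  by a local translation of the body, which fixes the vortices, and by local moves of the
  vortices, which fix the translated body; both depend on the parameters. To have them defined for
  all parameters, the displacements are bounded functions of the parameters with the prescribed
  derivative at the origin.\<close>

lemma lifts_nonempty:
  fixes x xb v w :: "(real^2)^'n"
  assumes R: "R > 0" and xb: "inj (($) xb)" "\<And>i. xb $ i \<notin> cball 0 R" and conf: "(x, g) \<in> configurations R"
  shows "lifts R xb (x, g) (v, gd1) (w, gd2) \<noteq> {}"
proof -
  let ?c = "snd g"
  have x: "inj (($) x)" "\<And>i. x $ i \<notin> cball ?c R"
    using conf unfolding configurations_def se2_act_body by auto
  \<comment> \<open>the gaps between vortices and between vortices and body\<close>
  let ?S = "(\<lambda>(i, j). norm (x $ i - x $ j)) ` {(i, j). i \<noteq> j} \<union> range (\<lambda>i. norm (x $ i - ?c) - R)"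
  have "finite ?S" by (intro finite_UnI finite_imageI) auto
  moreover have "0 < s" if "s \<in> ?S" for s
    using that
  proof
    assume "s \<in> (\<lambda>(i, j). norm (x $ i - x $ j)) ` {(i, j). i \<noteq> j}"
    then obtain i j where ij: "i \<noteq> j" "s = norm (x $ i - x $ j)" by auto
    then show "0 < s" using x(1) by (auto dest: injD)
  next
    assume "s \<in> range (\<lambda>i. norm (x $ i - ?c) - R)"
    then obtain i where "s = norm (x $ i - ?c) - R" by blast
    then show "0 < s" using x(2)[of i] by (simp add: dist_norm norm_minus_commute)
  qed
  ultimately have "\<exists>m>0. \<forall>s\<in>?S. m \<le> s" by (rule finite_positive_lower_bound)
  then obtain m where m: "0 < m" "\<forall>s\<in>?S. m \<le> s" by (elim exE conjE)
  define \<delta> where "\<delta> = m / 5"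
  have \<delta>: "0 < \<delta>" "4 * \<delta> < m" using m(1) by (auto simp: \<delta>_def)
  have sep1: "norm (x $ i - x $ j) > 4 * \<delta>" if "i \<noteq> j" for i j
  proof -
    have "norm (x $ i - x $ j) \<in> ?S" using that by force
    from m(2)[rule_format, OF this] show ?thesis using \<delta>(2) by linarith
  qed
  have sep2: "norm (x $ i - ?c) > R + 4 * \<delta>" for i
  proof -
    have "norm (x $ i - ?c) - R \<in> ?S" by blast
    from m(2)[rule_format, OF this] show ?thesis using \<delta>(2) by linarith
  qed
  \<comment> \<open>bounds all prescribed velocities; the summand \<open>1\<close> makes it
    positive\<close>
  define L where "L = (\<Sum>i\<in>UNIV. norm (v $ i) + norm (w $ i)) + norm (snd gd1) + norm (snd gd2) + 1"
  have vL: "norm (v $ i) + norm (w $ i) \<le> L" for i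
    using member_le_sum[of i UNIV "\<lambda>i. norm (v $ i) + norm (w $ i)"] unfolding L_def
    by (simp add: add_increasing2)
  have sL: "0 \<le> (\<Sum>i\<in>UNIV. norm (v $ i) + norm (w $ i))" by (intro sum_nonneg) simp
  have gL: "norm (snd gd1) + norm (snd gd2) \<le> L" unfolding L_def using sL by simp
  have L: "L > 0" unfolding L_def using sL norm_ge_zero[of "snd gd1"] norm_ge_zero[of "snd gd2"] by linarith
  define \<epsilon> where "\<epsilon> = \<delta> / L"
  have \<epsilon>: "\<epsilon> > 0" "\<epsilon> * L = \<delta>" using \<delta> L by (auto simp: \<epsilon>_def)
  \<comment> \<open>a bounded function with derivative \<open>1\<close> at the origin\<close>
  define s where "s t = \<epsilon> * sin (t * inverse \<epsilon>)" for t
  have sb: "\<bar>s t\<bar> \<le> \<epsilon>" for t using \<epsilon> abs_sin_le_one[of "t * inverse \<epsilon>"] by (simp add: s_def abs_mult mult_left_le)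
  define E where "E u u' p = s (fst p) *\<^sub>R u + s (snd p) *\<^sub>R u'" for u u' :: "real^2" and p :: "real \<times> real"
  have Es: "smooth_on UNIV (E u u')" for u u' unfolding E_def[abs_def] s_def by (intro smooth_intros open_UNIV)
  have Eb: "norm (E u u' p) \<le> \<delta>" if "norm u + norm u' \<le> L" for u u' p
  proof -
    have "norm (E u u' p) \<le> \<bar>s (fst p)\<bar> * norm u + \<bar>s (snd p)\<bar> * norm u'"
      unfolding E_def using norm_triangle_ineq[of "s (fst p) *\<^sub>R u" "s (snd p) *\<^sub>R u'"] by simp
    also have "\<dots> \<le> \<epsilon> * norm u + \<epsilon> * norm u'" by (intro add_mono mult_right_mono sb) auto
    also have "\<dots> \<le> \<epsilon> * L" using mult_left_mono[OF that, of \<epsilon>] \<epsilon> by (simp add: distrib_left)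
    finally show ?thesis using \<epsilon> by simp
  qed
  let ?e = "E (snd gd1) (snd gd2)"
  obtain T where T: "area_family T" "\<And>p y. norm (y - ?c) \<le> R \<Longrightarrow> T p y = y + ?e p"
    "\<And>p y. norm (y - ?c) \<ge> R + 3 * \<delta> \<Longrightarrow> T p y = y"
    using local_translation[where e = ?e and \<delta> = \<delta> and r = R and c = ?c, OF Es Eb[OF gL] \<delta>(1) less_imp_le[OF R]] by metis
  obtain \<Psi> where \<Psi>: "area_family \<Psi>" "\<And>p i. \<Psi> p (x $ i) = x $ i + E (v $ i) (w $ i) p"
    "\<And>p y. norm (y - ?c) \<le> R + \<delta> \<Longrightarrow> \<Psi> p y = y"
    using local_moves[where I = UNIV and x = "($) x" and c = ?c and R = R and e = "\<lambda>i. E (v $ i) (w $ i)", OF finite \<delta>(1) sep1 sep2 Es Eb[OF vL]] by auto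
  obtain f where f: "area_family (\<lambda>p. f)" "f ` sphere 0 R = sphere ?c R" "\<And>i. f (xb $ i) = x $ i"
    using initial_map[OF R xb x] by metis
  define \<Phi> where "\<Phi> p y = \<Psi> p (T p (f y))" for p y
  have \<Phi>: "area_family \<Phi>" unfolding \<Phi>_def[abs_def] by (rule area_family_comp[OF \<Psi>(1) area_family_comp[OF T(1) f(1)]])
  define G where "G p = g + s (fst p) *\<^sub>R gd1 + s (snd p) *\<^sub>R gd2" for p :: "real \<times> real"
  have Gs: "smooth_on UNIV G" unfolding G_def[abs_def] s_def by (intro smooth_intros open_UNIV)
  have sG: "snd (G p) = ?c + ?e p" for p by (simp add: G_def E_def)
  have bd: "\<Phi> p ` sphere 0 R = sphere (snd (G p)) R" for p
  proof -
    have "\<Phi> p ` sphere 0 R = (\<lambda>y. \<Psi> p (T p y)) ` (f ` sphere 0 R)" by (simp add: \<Phi>_def[abs_def] image_image)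
    also have "\<dots> = (\<lambda>y. y + ?e p) ` sphere ?c R" unfolding f(2)
    proof (rule image_cong[OF refl])
      fix y assume "y \<in> sphere ?c R"
      then have y: "norm (y - ?c) = R" by (simp add: dist_norm norm_minus_commute)
      then have 1: "T p y = y + ?e p" by (intro T(2)) simp
      have "norm (y + ?e p - ?c) \<le> R + \<delta>" using norm_triangle_ineq[of "y - ?c" "?e p"] y Eb[OF gL, of p] by (simp add: algebra_simps)
      then show "\<Psi> p (T p y) = y + ?e p" unfolding 1 by (rule \<Psi>(3))
    qed
    also have "\<dots> = sphere (?c + ?e p) R"
    proof -
      have "(\<lambda>y. y + ?e p) ` sphere ?c R = (\<lambda>y. y + (?c + ?e p)) ` sphere 0 R"
        unfolding translate_cball(2)[of ?c R, symmetric] by (simp add: image_image add.assoc)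
      then show ?thesis by (simp add: translate_cball(2))
    qed
    finally show ?thesis by (simp add: sG)
  qed
  define q where "q p = (G p, \<Phi> p)" for p
  have fam: "smooth_family R q" unfolding q_def[abs_def] by (rule area_family_smooth_family[OF R \<Phi> Gs bd])
  have proj: "vortex_proj xb (q p) = (x, g) + s (fst p) *\<^sub>R (v, gd1) + s (snd p) *\<^sub>R (w, gd2)" for p
  proof -
    have "\<Phi> p (xb $ i) = x $ i + E (v $ i) (w $ i) p" for i
    proof -
      have "T p (x $ i) = x $ i" by (rule T(3)) (use sep2[of i] \<delta>(1) in linarith)
      then show ?thesis by (simp add: \<Phi>_def f(3) \<Psi>(2))
    qed
    then show ?thesis by (simp add: vortex_proj_def q_def G_def E_def vec_eq_iff)
  qed
  have s0: "s 0 = 0" by (simp add: s_def)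
  have ds: "(s has_derivative (\<lambda>h. h)) (at 0)"
  proof -
    have "(s has_real_derivative 1) (at 0)" unfolding s_def[abs_def] using \<epsilon>
      by (auto intro!: derivative_eq_intros)
    then show ?thesis unfolding has_field_derivative_def by (rule has_derivative_eq_rhs) (simp add: fun_eq_iff)
  qed
  have D: "((\<lambda>p. vortex_proj xb (q p)) has_derivative (\<lambda>h. fst h *\<^sub>R (v, gd1) + snd h *\<^sub>R (w, gd2))) (at 0)"
  proof -
    have d1: "((\<lambda>p::real\<times>real. s (fst p)) has_derivative fst) (at 0)"
      using has_derivative_compose[of fst fst "0::real\<times>real" UNIV s "\<lambda>h. h"] ds by (simp add: bounded_linear_fst bounded_linear_imp_has_derivative)
    have d2: "((\<lambda>p::real\<times>real. s (snd p)) has_derivative snd) (at 0)"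
      using has_derivative_compose[of snd snd "0::real\<times>real" UNIV s "\<lambda>h. h"] ds by (simp add: bounded_linear_snd bounded_linear_imp_has_derivative)
    show ?thesis unfolding proj
      by (rule has_derivative_eq_rhs[OF has_derivative_add[OF has_derivative_add[OF has_derivative_const
          has_derivative_scaleR[OF d1 has_derivative_const]] has_derivative_scaleR[OF d2 has_derivative_const]]])
        (simp add: fun_eq_iff)
  qed
  have "q \<in> lifts R xb (x, g) (v, gd1) (w, gd2)"
    unfolding lifts_def mem_Collect_eq frechet_derivative_at[OF D, symmetric]
    using fam by (simp add: proj s0)
  then show ?thesis by blast
qed

section \<open>The stream function of the connection\<close>

context fluid_family begin

abbreviation centre where "centre p \<equiv> snd (G p)"
definition body_velocity where "body_velocity h p = snd (frechet_derivative G (at p) h)"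

lemma image_P:
  shows "x \<in> - ball 0 R \<Longrightarrow> P (p, x) \<in> - ball (centre p) R"
    and "x \<in> - cball 0 R \<Longrightarrow> P (p, x) \<in> - cball (centre p) R"
    and "x \<in> sphere 0 R \<Longrightarrow> P (p, x) \<in> sphere (centre p) R"
    and "snd (q p) ` fluid R = - ball (centre p) R"
    and "inj_on (snd (q p)) (fluid R)"
proof -
  have Q: "q p \<in> Qspace R" using fam unfolding smooth_family_def by blast
  have Q': "inj_on (snd (q p)) (fluid R) \<and> snd (q p) ` frontier (fluid R) = se2_act (fst (q p)) ` frontier (body R)"
    using Q unfolding Qspace_def mem_Collect_eq case_prod_beta by blast
  have inj: "inj_on (snd (q p)) (- ball 0 R)" using Q' unfolding fluidR(1) by (rule conjunct1)
  have bd: "snd (q p) ` sphere 0 R = sphere (centre p) R"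
    using conjunct2[OF Q'] unfolding fluidR(1) frontier_exterior[OF R] se2_act_frontier_body[OF R] G_def .
  have cont: "continuous_on (- ball 0 R) (snd (q p))"
    by (intro continuous_at_imp_continuous_on ballI has_derivative_continuous[OF derivative_slice])
  obtain C where dec: "decay_const C {p} 0" using decay_const_exists[of "{p}" 0] by auto
  have near: "norm (snd (q p) x - x) \<le> C / R\<^sup>2" if x: "x \<in> - ball 0 R" for x
  proof -
    have "R\<^sup>2 \<le> (norm x)\<^sup>2" using x R by (intro power_mono) auto
    then have "norm (P (p, x) - x) * R\<^sup>2 \<le> norm (P (p, x) - x) * (norm x)\<^sup>2" by (intro mult_left_mono) auto
    also have "\<dots> \<le> C" by (rule decay_constD(6)[OF dec singletonI x])
    finally show ?thesis using R by (simp add: pos_le_divide_eq P_def)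
  qed
  note im = embedding_image_exterior[OF R cont inj near bd]
  show "snd (q p) ` fluid R = - ball (centre p) R" unfolding fluidR by (rule im(1))
  show "inj_on (snd (q p)) (fluid R)" unfolding fluidR by (rule inj)
  have e: "P (p, x) = snd (q p) x" for x by (simp add: P_def)
  show "P (p, x) \<in> - ball (centre p) R" if "x \<in> - ball 0 R"
    using imageI[OF that, of "snd (q p)"] im(1) e by simp
  show "P (p, x) \<in> - cball (centre p) R" if "x \<in> - cball 0 R"
    using imageI[OF that, of "snd (q p)"] im(2) e by simp
  show "P (p, x) \<in> sphere (centre p) R" if "x \<in> sphere 0 R"
    using imageI[OF that, of "snd (q p)"] bd e by simp
qed

lemma P_neq: "x \<in> - ball 0 R \<Longrightarrow> P (p, x) \<noteq> centre p"
  using image_P(1)[of x p] R by auto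

lemma P_in: "x \<in> - ball 0 R \<Longrightarrow> P (p, x) \<in> - {centre p}"
  using P_neq by blast

lemma has_derivative_G: "(G has_derivative frechet_derivative G (at p)) (at p)"
  by (rule smooth_on_has_derivative[of UNIV]) (use fam in \<open>auto simp: smooth_family_def G_def[abs_def]\<close>)

lemma P_partial:
  assumes "x \<in> - ball 0 R"
  shows "((\<lambda>p. P (p, x)) has_derivative (\<lambda>h. V h (p, x))) (at p)"
proof -
  have z: "(p, x) \<in> Dom" by (rule Dom(2)[OF assms])
  have c: "((\<lambda>p. (p, x)) has_derivative (\<lambda>h. (h, 0))) (at p)"
    by (rule has_derivative_eq_rhs, (rule derivative_intros)+) simp
  show ?thesis using has_derivative_compose[OF c has_derivative_P[OF z]] linear_0[OF linear_partials(2)[OF z]] by simp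
qed

text \<open>The velocity relative to the potential flow induced by the body, at the particle
  \<open>x\<close>. The connection is its pull-back. As \<open>J\<close> preserves the area form,
  its inverse is given by Cramer's rule, and \<open>vortical_field\<close> is the result.\<close>

definition slip where "slip h p x = V h (p, x) - grad_neumann_disc R (centre p) (body_velocity h p) (P (p, x))"
definition vortical_field where
  "vortical_field h p x = (vector [area_form (slip h p x) (J (axis 2 1) (p, x)), - area_form (slip h p x) (J (axis 1 1) (p, x))] :: real^2)"

lemma area_vortical_field:
  assumes "x \<in> - ball 0 R" shows "area_form (vortical_field h p x) w = area_form (slip h p x) (J w (p, x))"
proof -
  have "area_form (slip h p x) (J w (p, x)) = area_form (slip h p x) (w $ 1 *\<^sub>R J (axis 1 1) (p, x) + w $ 2 *\<^sub>R J (axis 2 1) (p, x))"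
    by (subst J_vec2[OF Dom(2)[OF assms], of w]) (rule refl)
  then show ?thesis by (simp add: area_form_simps vortical_field_def) (simp add: area_form_def algebra_simps)
qed

lemma J_vortical_field:
  assumes x: "x \<in> - ball 0 R" shows "J (vortical_field h p x) (p, x) = slip h p x"
    and "inv (\<lambda>w. J w (p, x)) (slip h p x) = vortical_field h p x"
proof -
  have l: "linear (\<lambda>w. J w (p, x))" by (rule linear_partials(2)[OF Dom(2)[OF x]])
  have "inj (\<lambda>w. J w (p, x))"
    unfolding linear_injective_0[OF l]
  proof (intro allI impI)
    fix a assume a: "J a (p, x) = 0"
    have "area_form (J a (p, x)) (J b (p, x)) = area_form a b" for b by (rule area_J[OF x])
    then have "area_form a b = area_form 0 b" for b using a by (simp add: area_form_simps)
    then show "a = 0" by (rule area_form_nondegenerate)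
  qed
  then have surj: "surj (\<lambda>w. J w (p, x))" using linear_injective_imp_surjective[OF l] by blast
  show J: "J (vortical_field h p x) (p, x) = slip h p x"
  proof (rule area_form_nondegenerate)
    fix u
    obtain w where w: "u = J w (p, x)" using surj by (auto simp: surj_def)
    show "area_form (J (vortical_field h p x) (p, x)) u = area_form (slip h p x) u"
      unfolding w area_J[OF x] area_vortical_field[OF x] ..
  qed
  show "inv (\<lambda>w. J w (p, x)) (slip h p x) = vortical_field h p x"
    using inv_f_f[OF \<open>inj _\<close>, of "vortical_field h p x"] J by simp
qed

lemma connection_eq_vortical_field:
  assumes x: "x \<in> fluid R"
  shows "connection R (q p) (family_velocity q p h) x = vortical_field h p x"
proof -
  have x': "x \<in> - ball 0 R" using x fluidR by simp
  have qp: "q p = (G p, snd (q p))" by (simp add: G_def)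
  have fv: "family_velocity q p h = (frechet_derivative G (at p) h, \<lambda>x. frechet_derivative (\<lambda>p. P (p, x)) (at p) h)"
    by (simp add: family_velocity_def G_def[abs_def] P_def)
  have "frechet_derivative (snd (q p)) (at x) = (\<lambda>w. J w (p, x))"
    by (rule frechet_derivative_at[OF derivative_slice[OF x'], symmetric])
  moreover have "inv_into (fluid R) (snd (q p)) (snd (q p) x) = x" by (rule inv_into_f_f[OF image_P(5) x])
  moreover have "frechet_derivative (\<lambda>p. P (p, x)) (at p) h = V h (p, x)"
    by (simp add: frechet_derivative_at[OF P_partial[OF x'], symmetric])
  moreover have "grad (neumann_potential (snd (q p) ` fluid R) (G p) (frechet_derivative G (at p) h)) (snd (q p) x)
      = grad_neumann_disc R (centre p) (body_velocity h p) (P (p, x))"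
    unfolding image_P(4) body_velocity_def using grad_neumann_potential[OF R image_P(1)[OF x']] by (simp add: P_def)
  ultimately have "connection R (q p) (family_velocity q p h) x = inv (\<lambda>w. J w (p, x)) (slip h p x)"
    unfolding fv by (subst qp) (simp add: connection_def slip_def Let_def)
  then show ?thesis using J_vortical_field(2)[OF x'] by simp
qed

definition potential_stream where "potential_stream h = (\<lambda>(p, x). stream_disc R (centre p) (body_velocity h p) (P (p, x)))"
text \<open>The Hamiltonian of the connection, as the difference of the Hamiltonians of the flow
  and of the potential flow.\<close>

definition vortical_stream where "vortical_stream h p x = flow_stream h (p, x) - potential_stream h (p, x)"

lemma potential_stream_derivative_x:
  assumes x: "x \<in> - ball 0 R"
  shows "((\<lambda>x. potential_stream h (p, x)) has_derivative (\<lambda>w. area_form (grad_neumann_disc R (centre p) (body_velocity h p) (P (p, x))) (J w (p, x)))) (at x)"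
proof -
  have "((\<lambda>x. P (p, x)) has_derivative (\<lambda>w. J w (p, x))) (at x)" using derivative_slice[OF x, of p] by (simp add: P_def eta_contract_eq)
  from has_derivative_compose[OF this has_derivative_stream_disc[OF P_neq[OF x]]] show ?thesis by (simp add: potential_stream_def)
qed

lemma vortical_stream_derivative:
  assumes x: "x \<in> - cball 0 R"
  shows "(vortical_stream h p has_derivative area_form (vortical_field h p x)) (at x)"
proof -
  have x': "x \<in> - ball 0 R" using x by auto
  have "(vortical_stream h p has_derivative (\<lambda>w. flow_form h w (p, x) - area_form (grad_neumann_disc R (centre p) (body_velocity h p) (P (p, x))) (J w (p, x)))) (at x)"
    unfolding vortical_stream_def[abs_def] by (rule has_derivative_diff[OF flow_stream_derivative_x[OF x] potential_stream_derivative_x[OF x']])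
  then show ?thesis
    by (rule has_derivative_eq_rhs) (simp add: fun_eq_iff area_vortical_field[OF x'] slip_def flow_form_def area_form_simps)
qed

lemma smooth_vortical_field: "smooth_on (- cball 0 R) (vortical_field h p)"
proof -
  have o: "open (- cball (0::real^2) R)" by auto
  have sub: "(p, x) \<in> Dom" if "x \<in> - cball 0 R" for x using that by (intro Dom(2)) auto
  have pr: "smooth_on (- cball (0::real^2) R) (\<lambda>x. (p, x))" by (intro smooth_intros o)
  have c: "smooth_on (- cball 0 R) (\<lambda>x. f (p, x))" if "smooth_on Dom f" for f :: "_ \<Rightarrow> real^2"
    by (rule smooth_on_compose[OF o Dom(1) that pr sub])
  have g: "smooth_on (- cball 0 R) (\<lambda>x. grad_neumann_disc R (centre p) (body_velocity h p) (P (p, x)))"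
    by (rule smooth_on_compose[OF o _ smooth_on_disc_fields(3) c[OF Dom(3)]]) (auto intro!: P_neq)
  show ?thesis unfolding vortical_field_def[abs_def] slip_def
    by (intro smooth_on_vector2 smooth_on_area_form smooth_on_uminus smooth_on_diff c smooth_V smooth_J g o)
qed

lemma continuous_vortical_field: "continuous_on (- ball 0 R) (vortical_field h p)"
proof -
  have c: "continuous_on (- ball 0 R) (\<lambda>x. f (p, x))" if "smooth_on Dom f" for f :: "_ \<Rightarrow> real^2"
    by (rule continuous_on_Dom_compose[OF that]) (auto intro!: continuous_intros Dom(2))
  have g: "continuous_on (- ball 0 R) (\<lambda>x. grad_neumann_disc R (centre p) (body_velocity h p) (P (p, x)))"
    by (rule continuous_on_compose2[OF smooth_on_imp_continuous_on[OF smooth_on_disc_fields(3)] c[OF Dom(3)]])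
      (intro image_subsetI P_in)
  show ?thesis unfolding vortical_field_def[abs_def] slip_def
    by (intro continuous_on_vector2 continuous_intros bounded_bilinear.continuous_on[OF bounded_bilinear_area_form]
        c smooth_V smooth_J g)
qed

text \<open>Continuity up to the circle, where the function need not be differentiable: the
  integrals over bounded intervals are continuous and converge uniformly.\<close>

lemma continuous_vortical_stream: "continuous_on (- ball 0 R) (vortical_stream h p)"
proof -
  have c: "continuous_on (- ball 0 R) (\<lambda>x. P (p, x))"
    by (rule continuous_on_Dom_compose[OF Dom(3)]) (auto intro!: continuous_intros Dom(2))
  have pot: "continuous_on (- ball 0 R) (\<lambda>x. potential_stream h (p, x))" unfolding potential_stream_def prod.case
    by (rule continuous_on_compose2[OF smooth_on_imp_continuous_on[OF smooth_on_disc_fields(2)] c]) (intro image_subsetI P_in)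
  have "continuous_on (- ball 0 R) (\<lambda>x. flow_stream h (p, x))"
  proof (rule flow_stream_limit[of "{p}"])
    fix C assume C: "C \<ge> 0" "\<And>p' x h n. p' \<in> {p} \<Longrightarrow> x \<in> - ball 0 R \<Longrightarrow>
       \<bar>integral {1..real (Suc n)} (\<lambda>t. - flow_form h x (p', t *\<^sub>R x)) - flow_stream h (p', x)\<bar> \<le> C * norm h / norm x / real (Suc n)"
    let ?F = "\<lambda>n x. integral (cbox 1 (real (Suc n))) (\<lambda>t. - flow_form h x (p, t *\<^sub>R x))"
    show ?thesis
    proof (rule uniform_limit_theorem[where F = sequentially and f = ?F])
      show "\<forall>\<^sub>F n in sequentially. continuous_on (- ball 0 R) (?F n)"
      proof (rule always_eventually, rule allI, rule integral_continuous_on_param)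
        fix n
        have i: "(p, snd s *\<^sub>R fst s) \<in> Dom" if "s \<in> (- ball 0 R) \<times> cbox 1 (real (Suc n))" for s
          by (rule ray_in_Dom) (use that in auto)
        show "continuous_on ((- ball 0 R) \<times> cbox 1 (real (Suc n))) (\<lambda>(x, t). - flow_form h x (p, t *\<^sub>R x))"
          unfolding case_prod_beta by (intro continuous_intros flow_form_continuous i)
      qed
      show "uniform_limit (- ball 0 R) ?F (\<lambda>x. flow_stream h (p, x)) sequentially"
      proof (rule uniform_limitI)
        fix e :: real assume e: "0 < e"
        obtain N where N: "real N > C * norm h / R / e" using reals_Archimedean2 by blast
        show "\<forall>\<^sub>F n in sequentially. \<forall>x\<in>- ball 0 R. dist (?F n x) (flow_stream h (p, x)) < e"
        proof (rule eventually_sequentiallyI[of N], rule ballI)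
          fix n and x :: "real^2" assume n: "N \<le> n" and x: "x \<in> - ball 0 R"
          have "dist (?F n x) (flow_stream h (p, x)) \<le> C * norm h / norm x / real (Suc n)"
            using C(2)[OF singletonI x, of n h] by (simp add: dist_real_def)
          also have "\<dots> \<le> C * norm h / R / real (Suc n)"
          proof -
            have "norm x \<ge> R" using x by simp
            moreover from this have "0 < norm x" using R by linarith
            ultimately show ?thesis using R C(1) by (intro divide_right_mono divide_left_mono) auto
          qed
          also have "\<dots> < e"
          proof -
            have "C * norm h / R / e < real (Suc n)" using N n by simp
            then have "C * norm h / R < real (Suc n) * e" using e by (simp only: pos_divide_less_eq)
            then have "C * norm h / R < e * real (Suc n)" by (simp only: mult.commute)
            then show ?thesis by (simp only: pos_divide_less_eq of_nat_0_less_iff zero_less_Suc)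
          qed
          finally show "dist (?F n x) (flow_stream h (p, x)) < e" .
        qed
      qed
    qed simp
  qed simp
  then show ?thesis unfolding vortical_stream_def[abs_def] by (intro continuous_intros pot)
qed

text \<open>The dipole fields decay in the distance of \<open>P (p, x)\<close> from the centre
  of the body, which is comparable to \<open>norm x\<close>.\<close>

lemma decay_vortical:
  obtains C where "\<And>x. x \<in> - ball 0 R \<Longrightarrow> \<bar>vortical_stream h p x\<bar> * norm x \<le> C"
    "\<And>x. x \<in> - ball 0 R \<Longrightarrow> norm (vortical_field h p x) * (norm x)\<^sup>2 \<le> C"
proof -
  obtain C where dec: "decay_const C {p} 0" using decay_const_exists[of "{p}" 0] by auto
  have C0: "C \<ge> 0" by (rule decay_constD(1)[OF dec])
  obtain B where B: "\<And>x. x \<in> - ball 0 R \<Longrightarrow> \<bar>flow_stream h (p, x)\<bar> \<le> B * norm h / norm x" "B \<ge> 0"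
  proof (rule flow_stream_limit[of "{p}"])
    fix B assume "0 \<le> B" "\<And>p' x h. p' \<in> {p} \<Longrightarrow> x \<in> - ball 0 R \<Longrightarrow> \<bar>flow_stream h (p', x)\<bar> \<le> B * norm h / norm x"
    then show thesis using that by blast
  qed simp
  define k where "k = 1 + (C / R\<^sup>2 + norm (centre p)) / R"
  have k: "norm x \<le> k * norm (P (p, x) - centre p)" "norm (P (p, x) - centre p) > 0" "k > 0" if x: "x \<in> - ball 0 R" for x
  proof -
    have "R\<^sup>2 \<le> (norm x)\<^sup>2" using x R by (intro power_mono) auto
    then have "norm (P (p, x) - x) * R\<^sup>2 \<le> norm (P (p, x) - x) * (norm x)\<^sup>2" by (intro mult_left_mono) auto
    also have "\<dots> \<le> C" by (rule decay_constD(6)[OF dec singletonI x])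
    finally have n: "norm (P (p, x) - x) \<le> C / R\<^sup>2" using R by (simp add: pos_le_divide_eq)
    have PR: "norm (P (p, x) - centre p) \<ge> R" using image_P(1)[OF x, of p] by (simp add: dist_norm norm_minus_commute)
    then show "norm (P (p, x) - centre p) > 0" using R by linarith
    have c0: "0 \<le> C / R\<^sup>2 + norm (centre p)" using C0 by simp
    then show "k > 0" using R unfolding k_def by (simp add: add_pos_nonneg)
    have "norm x \<le> norm (P (p, x) - centre p) + norm (P (p, x) - x) + norm (centre p)"
      using norm_triangle_ineq4[of "P (p, x) - centre p" "P (p, x) - x"] norm_triangle_ineq[of "(P (p, x) - centre p) - (P (p, x) - x)" "centre p"] by simp
    also have "\<dots> \<le> norm (P (p, x) - centre p) + (C / R\<^sup>2 + norm (centre p))" using n by simp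
    also have "\<dots> \<le> norm (P (p, x) - centre p) + (C / R\<^sup>2 + norm (centre p)) / R * norm (P (p, x) - centre p)"
    proof -
      have "(C / R\<^sup>2 + norm (centre p)) / R * R \<le> (C / R\<^sup>2 + norm (centre p)) / R * norm (P (p, x) - centre p)"
        using PR c0 R by (intro mult_left_mono) auto
      then show ?thesis using R by simp
    qed
    finally show "norm x \<le> k * norm (P (p, x) - centre p)" by (simp add: k_def distrib_right)
  qed
  have J2: "norm (J w (p, x)) \<le> C * norm w" if "x \<in> - ball 0 R" for w x by (rule decay_constD(3)[OF dec singletonI that])
  let ?e = "norm (body_velocity h p)"
  have a: "\<bar>vortical_stream h p x\<bar> * norm x \<le> B * norm h + R\<^sup>2 * ?e * k" if x: "x \<in> - ball 0 R" for x
  proof -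
    have nx: "norm x > 0" using x R by auto
    have "\<bar>potential_stream h (p, x)\<bar> * norm x \<le> (R\<^sup>2 * ?e / norm (P (p, x) - centre p)) * (k * norm (P (p, x) - centre p))"
      unfolding potential_stream_def prod.case by (intro mult_mono abs_stream_disc k(1)[OF x]) auto
    also have "\<dots> = R\<^sup>2 * ?e * k" using k(2)[OF x] by simp
    finally have 1: "\<bar>potential_stream h (p, x)\<bar> * norm x \<le> R\<^sup>2 * ?e * k" .
    have 2: "\<bar>flow_stream h (p, x)\<bar> * norm x \<le> B * norm h" using B(1)[OF x] nx by (simp add: pos_le_divide_eq)
    have "\<bar>vortical_stream h p x\<bar> * norm x \<le> (\<bar>flow_stream h (p, x)\<bar> + \<bar>potential_stream h (p, x)\<bar>) * norm x"
      unfolding vortical_stream_def by (intro mult_right_mono) auto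
    then show ?thesis using 1 2 by (simp add: distrib_right)
  qed
  have b: "norm (vortical_field h p x) * (norm x)\<^sup>2 \<le> 2 * C * (C * norm h + 3 * R\<^sup>2 * ?e * k\<^sup>2)" if x: "x \<in> - ball 0 R" for x
  proof -
    have "norm (grad_neumann_disc R (centre p) (body_velocity h p) (P (p, x))) * (norm x)\<^sup>2
        \<le> (3 * R\<^sup>2 * ?e / (norm (P (p, x) - centre p))\<^sup>2) * (k * norm (P (p, x) - centre p))\<^sup>2"
      by (intro mult_mono norm_grad_neumann_disc power_mono k(1)[OF x]) auto
    also have "\<dots> = 3 * R\<^sup>2 * ?e * k\<^sup>2" using k(2)[OF x] by (simp add: power_mult_distrib)
    finally have 1: "norm (grad_neumann_disc R (centre p) (body_velocity h p) (P (p, x))) * (norm x)\<^sup>2 \<le> 3 * R\<^sup>2 * ?e * k\<^sup>2" .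
    have 2: "norm (V h (p, x)) * (norm x)\<^sup>2 \<le> C * norm h" by (rule decay_constD(2)[OF dec singletonI x])
    have "norm (slip h p x) * (norm x)\<^sup>2 \<le> (norm (V h (p, x)) + norm (grad_neumann_disc R (centre p) (body_velocity h p) (P (p, x)))) * (norm x)\<^sup>2"
      unfolding slip_def by (intro mult_right_mono norm_triangle_ineq4) auto
    then have s: "norm (slip h p x) * (norm x)\<^sup>2 \<le> C * norm h + 3 * R\<^sup>2 * ?e * k\<^sup>2"
      using 1 2 by (simp add: distrib_right)
    have Jb: "norm (J (axis i 1) (p, x)) \<le> C" for i :: 2 using J2[OF x, of "axis i 1"] by simp
    have comp: "\<bar>vortical_field h p x $ i\<bar> \<le> norm (slip h p x) * C" for i
    proof -
      have "\<bar>area_form (slip h p x) (J (axis j 1) (p, x))\<bar> \<le> norm (slip h p x) * C" for j :: 2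
        using area_form_bound[of "slip h p x" "J (axis j 1) (p, x)"] mult_left_mono[OF Jb[of j], of "norm (slip h p x)"] by simp
      then show ?thesis using exhaust_2[of i] by (auto simp: vortical_field_def)
    qed
    have "norm (vortical_field h p x) \<le> \<bar>vortical_field h p x $ 1\<bar> + \<bar>vortical_field h p x $ 2\<bar>"
      using norm_le_l1_cart[of "vortical_field h p x"] by (simp add: sum_2)
    also have "\<dots> \<le> 2 * (norm (slip h p x) * C)" using comp[of 1] comp[of 2] by simp
    finally have "norm (vortical_field h p x) * (norm x)\<^sup>2 \<le> 2 * (norm (slip h p x) * C) * (norm x)\<^sup>2" by (intro mult_right_mono) auto
    also have "\<dots> = 2 * C * (norm (slip h p x) * (norm x)\<^sup>2)" by simp
    also have "\<dots> \<le> 2 * C * (C * norm h + 3 * R\<^sup>2 * ?e * k\<^sup>2)" using s C0 by (intro mult_left_mono) auto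
    finally show ?thesis .
  qed
  show ?thesis
    by (rule that[of "max (B * norm h + R\<^sup>2 * ?e * k) (2 * C * (C * norm h + 3 * R\<^sup>2 * ?e * k\<^sup>2))"])
      (use a b in \<open>auto simp: le_max_iff_disj\<close>)
qed

lemma area_form_parallel:
  assumes "u \<bullet> n = 0" "v \<bullet> n = 0" "n \<noteq> 0" shows "area_form u v = 0"
proof -
  have "area_form u v * (n \<bullet> n) = (u \<bullet> n) * area_form n v - (v \<bullet> n) * area_form n u"
    unfolding inner_vec2 area_form_def by algebra
  then show ?thesis using assms by simp
qed

text \<open>Both the relative velocity and the image of the tangent vector are orthogonal to the
  normal \<open>P (p, x) - centre p\<close>, and so they are parallel. One sees this by
  differentiating the condition that the boundary stays on the circle of radius \<open>R\<close>,
  with respect to the parameter and along the circle; the Neumann condition removes the normal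
  velocity of the body.\<close>

lemma vortical_field_tangent:
  assumes x: "x \<in> sphere 0 R"
  shows "area_form (vortical_field h p x) (vector [- x $ 2, x $ 1]) = 0"
proof -
  have x': "x \<in> - ball 0 R" using x by auto
  let ?n = "P (p, x) - centre p" let ?t = "vector [- x $ 2, x $ 1] :: real^2"
  have nn: "norm (P (p', x') - centre p') = R" if "x' \<in> sphere 0 R" for p' x'
    using image_P(3)[OF that, of p'] by (simp add: dist_norm norm_minus_commute)
  then have n0: "?n \<noteq> 0" using x R by fastforce
  have dc: "((\<lambda>p. centre p) has_derivative (\<lambda>h. body_velocity h p)) (at p)"
    unfolding body_velocity_def by (rule has_derivative_snd[OF has_derivative_G])
  have "((\<lambda>p. (P (p, x) - centre p) \<bullet> (P (p, x) - centre p)) has_derivative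
      (\<lambda>h. ?n \<bullet> (V h (p, x) - body_velocity h p) + (V h (p, x) - body_velocity h p) \<bullet> ?n)) (at p)"
    by (intro has_derivative_inner has_derivative_diff P_partial[OF x'] dc)
  moreover have "(\<lambda>p. (P (p, x) - centre p) \<bullet> (P (p, x) - centre p)) = (\<lambda>p. R\<^sup>2)"
    using nn[OF x] by (simp add: dot_square_norm)
  ultimately have "((\<lambda>p. R\<^sup>2) has_derivative
      (\<lambda>h. ?n \<bullet> (V h (p, x) - body_velocity h p) + (V h (p, x) - body_velocity h p) \<bullet> ?n)) (at p)" by simp
  from has_derivative_unique[OF this has_derivative_const] have "?n \<bullet> (V h (p, x) - body_velocity h p) + (V h (p, x) - body_velocity h p) \<bullet> ?n = 0"
    by (rule fun_cong)
  then have "(V h (p, x) - body_velocity h p) \<bullet> ?n = 0" by (simp add: inner_commute)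
  moreover have "grad_neumann_disc R (centre p) (body_velocity h p) (P (p, x)) \<bullet> ?n = body_velocity h p \<bullet> ?n"
    by (rule grad_neumann_disc_radial[OF R nn[OF x]])
  ultimately have s: "slip h p x \<bullet> ?n = 0" by (simp add: slip_def inner_diff_left)
  have r: "((\<lambda>t. rot t x) has_derivative (\<lambda>s. s *\<^sub>R ?t)) (at 0)"
    unfolding rot_eq
    by (rule has_derivative_eq_rhs, (rule derivative_intros)+) (simp add: fun_eq_iff)
  have dP: "((\<lambda>x. P (p, x)) has_derivative (\<lambda>w. J w (p, x))) (at (rot 0 x))"
    using derivative_slice[OF x', of p] by (simp add: P_def eta_contract_eq)
  have "((\<lambda>t. P (p, rot t x)) has_derivative (\<lambda>s. s *\<^sub>R J ?t (p, x))) (at 0)"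
    using has_derivative_compose[OF r dP] linear_scale[OF linear_partials(2)[OF Dom(2)[OF x']]] by simp
  then have d: "((\<lambda>t. P (p, rot t x) - centre p) has_derivative (\<lambda>s. s *\<^sub>R J ?t (p, x))) (at 0)"
    using has_derivative_diff[OF _ has_derivative_const] by fastforce
  have "((\<lambda>t. (P (p, rot t x) - centre p) \<bullet> (P (p, rot t x) - centre p)) has_derivative
      (\<lambda>s. (P (p, rot 0 x) - centre p) \<bullet> (s *\<^sub>R J ?t (p, x)) + (s *\<^sub>R J ?t (p, x)) \<bullet> (P (p, rot 0 x) - centre p))) (at 0)"
    by (rule has_derivative_inner[OF d d])
  moreover have "(\<lambda>t. (P (p, rot t x) - centre p) \<bullet> (P (p, rot t x) - centre p)) = (\<lambda>t. R\<^sup>2)"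
    using nn[of "rot _ x"] x by (simp add: dot_square_norm)
  ultimately have "((\<lambda>t. R\<^sup>2) has_derivative
      (\<lambda>s. (P (p, rot 0 x) - centre p) \<bullet> (s *\<^sub>R J ?t (p, x)) + (s *\<^sub>R J ?t (p, x)) \<bullet> (P (p, rot 0 x) - centre p))) (at 0)" by simp
  from fun_cong[OF has_derivative_unique[OF this has_derivative_const], of 1]
  have "J ?t (p, x) \<bullet> ?n = 0" by (simp add: inner_commute)
  from area_form_parallel[OF s this n0] show ?thesis unfolding area_vortical_field[OF x'] .
qed

text \<open>The derivative along the circle vanishes by tangency. As differentiability holds only
  in the open exterior, the argument is carried out on slightly larger circles, along which the
  derivative is uniformly small, and passes to the limit.\<close>

lemma vortical_stream_const_boundary:
  assumes x: "x \<in> sphere 0 R" and y: "y \<in> sphere 0 R"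
  shows "vortical_stream h p x = vortical_stream h p y"
proof -
  let ?A = "\<lambda>x. area_form (vortical_field h p x) (vector [- x $ 2, x $ 1])"
  have cA: "continuous_on (cball 0 (R + 1) - ball 0 R) ?A"
    by (intro bounded_bilinear.continuous_on[OF bounded_bilinear_area_form] continuous_on_vector2 continuous_intros
        continuous_on_subset[OF continuous_vortical_field]) auto
  have angle: "\<exists>t. z = rot t (R *\<^sub>R axis 1 1)" if "z \<in> sphere 0 R" for z :: "real^2"
  proof -
    have "(z $ 1 / R)\<^sup>2 + (z $ 2 / R)\<^sup>2 = (z \<bullet> z) / R\<^sup>2"
      by (simp add: inner_vec2 power_divide power2_eq_square add_divide_distrib)
    also have "\<dots> = 1" using that R by (simp add: dot_square_norm)
    finally obtain t where "z $ 1 / R = cos t" "z $ 2 / R = sin t" using sincos_total_2pi by metis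
    then have "z = rot t (R *\<^sub>R axis 1 1)" using R by (simp add: vec2_eq_iff axis_def field_simps)
    then show ?thesis ..
  qed
  obtain s t where st: "x = rot s (R *\<^sub>R axis 1 1)" "y = rot t (R *\<^sub>R axis 1 1)" using angle x y by blast
  define u where "u r b = rot b (r *\<^sub>R (axis 1 1 :: real^2))" for r b :: real
  have nu: "norm (u r b) = r" if "r \<ge> 0" for r b using that by (simp add: u_def)
  have du: "((\<lambda>b. vortical_stream h p (u r b)) has_real_derivative ?A (u r b)) (at b)" if r: "r > R" for r b
  proof -
    have e: "u r b = cos b *\<^sub>R (r *\<^sub>R axis 1 1) + sin b *\<^sub>R (r *\<^sub>R axis 2 1)" for b
      by (simp add: u_def vec2_eq_iff axis_def)
    have d: "(u r has_derivative (\<lambda>s. s *\<^sub>R vector [- u r b $ 2, u r b $ 1])) (at b)"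
      unfolding e[abs_def]
      by (rule has_derivative_eq_rhs, (rule derivative_intros)+) (simp add: fun_eq_iff vec2_eq_iff axis_def algebra_simps)
    have i: "u r b \<in> - cball 0 R" using nu[of r b] r R by simp
    show ?thesis unfolding has_field_derivative_def
      by (rule has_derivative_eq_rhs[OF has_derivative_compose[OF d vortical_stream_derivative[OF i]]])
        (simp add: fun_eq_iff area_form_simps)
  qed
  \<comment> \<open>radii decreasing to \<open>R\<close>\<close>
  define r where "r n = R + 1 / real (Suc n)" for n
  have rR: "r n > R" "r n \<le> R + 1" for n by (auto simp: r_def)
  have rl: "r \<longlonglongrightarrow> R" unfolding r_def using tendsto_add[OF tendsto_const LIMSEQ_Suc[OF lim_1_over_n], of R] by simp
  have lim: "(\<lambda>n. vortical_stream h p (u (r n) b)) \<longlonglongrightarrow> vortical_stream h p (u R b)" for b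
  proof (rule continuous_on_tendsto_compose[OF continuous_vortical_stream])
    show "(\<lambda>n. u (r n) b) \<longlonglongrightarrow> u R b" unfolding u_def
      by (rule isCont_tendsto_compose[OF linear_continuous_at[OF bounded_linear_rot]]) (intro tendsto_intros rl)
    show "u R b \<in> - ball 0 R" using nu[of R b] R by simp
    show "\<forall>\<^sub>F n in sequentially. u (r n) b \<in> - ball 0 R"
    proof (rule always_eventually, rule allI)
      fix n show "u (r n) b \<in> - ball 0 R" using nu[of "r n" b] rR[of n] R by simp
    qed
  qed
  have z: "(\<lambda>n. vortical_stream h p (u (r n) s) - vortical_stream h p (u (r n) t)) \<longlonglongrightarrow> 0"
  proof (rule LIMSEQ_I)
    fix e :: real assume e: "0 < e"
    define e' where "e' = e / (\<bar>s - t\<bar> + 1)"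
    have e': "e' > 0" using e by (simp add: e'_def)
    obtain d where d: "d > 0" "\<And>x. x \<in> cball 0 (R + 1) - ball 0 R \<Longrightarrow> norm x < R + d \<Longrightarrow> \<bar>?A x\<bar> \<le> e'"
      by (rule small_near_circle[OF R _ cA vortical_field_tangent e']) auto
    obtain N where N: "\<And>n. n \<ge> N \<Longrightarrow> \<bar>r n - R\<bar> < d" using LIMSEQ_D[OF rl d(1)] by auto
    show "\<exists>no. \<forall>n\<ge>no. norm (vortical_stream h p (u (r n) s) - vortical_stream h p (u (r n) t) - 0) < e"
    proof (intro exI allI impI)
      fix n assume n: "N \<le> n"
      have Ab: "\<bar>?A (u (r n) b)\<bar> \<le> e'" for b
        by (rule d(2)) (use nu[of "r n" b] rR[of n] R N[OF n] in auto)
      have "norm (vortical_stream h p (u (r n) s) - vortical_stream h p (u (r n) t)) \<le> e' * norm (s - t)"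
        by (rule field_differentiable_bound[of UNIV _ "\<lambda>b. ?A (u (r n) b)"])
          (use du[OF rR(1)] Ab in \<open>auto intro: has_field_derivative_at_within\<close>)
      also have "\<dots> < e' * (\<bar>s - t\<bar> + 1)" using e' by simp
      also have "\<dots> = e"
      proof -
        have "\<bar>s - t\<bar> + 1 \<noteq> 0" by linarith
        then show ?thesis by (simp add: e'_def)
      qed
      finally show "norm (vortical_stream h p (u (r n) s) - vortical_stream h p (u (r n) t) - 0) < e" by simp
    qed
  qed
  have "(\<lambda>n. vortical_stream h p (u (r n) s) - vortical_stream h p (u (r n) t)) \<longlonglongrightarrow> vortical_stream h p (u R s) - vortical_stream h p (u R t)"
    by (intro tendsto_diff lim)
  from LIMSEQ_unique[OF this z] show ?thesis unfolding st u_def by simp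
qed

end

section \<open>The differential of the momentum one-form\<close>

text \<open>The harmonic conjugates are linear in the velocity of the body, with coefficients that
  depend only on the position relative to its centre.\<close>

definition stream_kernel :: "real \<Rightarrow> real^2 \<Rightarrow> real^2" where
  "stream_kernel R z = (R\<^sup>2 / (z \<bullet> z)) *\<^sub>R z"

lemma stream_disc_kernel: "stream_disc R c e x = area_form e (stream_kernel R (x - c))"
  by (simp add: stream_disc_def stream_kernel_def area_form_simps)

lemma has_derivative_stream_kernel:
  assumes "z \<noteq> 0"
  shows "(stream_kernel R has_derivative frechet_derivative (stream_kernel R) (at z)) (at z)"
proof (rule smooth_on_has_derivative)
  have o: "open (- {0::real^2})" by auto
  show "smooth_on (- {0}) (stream_kernel R)" unfolding stream_kernel_def[abs_def]
    by (intro smooth_on_scaleR smooth_on_divide smooth_intros o) auto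
qed (use assms in auto)

lemma ext_deriv_Theta:
  assumes R: "R > 0" and y: "y \<notin> cball (snd g) R"
  shows "ext_deriv (Theta R) (g, y) (gd1, v1) (gd2, v2) =
    area_form (snd gd2) (frechet_derivative (stream_kernel R) (at (y - snd g)) (v1 - snd gd1))
    - area_form (snd gd1) (frechet_derivative (stream_kernel R) (at (y - snd g)) (v2 - snd gd2))"
proof -
  let ?k = "stream_kernel R" let ?z = "y - snd g"
  let ?U = "{z :: se2 \<times> (real^2). R < norm (snd z - snd (fst z))}"
  have o: "open ?U" by (intro open_Collect_less continuous_intros)
  have i: "(g, y) \<in> ?U" using y by (simp add: dist_norm norm_minus_commute)
  have z: "?z \<noteq> 0" using y R by auto
  have d: "((\<lambda>z :: se2 \<times> (real^2). snd z - snd (fst z)) has_derivative (\<lambda>h. snd h - snd (fst h))) (at (g, y))"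
    by (intro derivative_intros)
  have k: "((\<lambda>z :: se2 \<times> (real^2). ?k (snd z - snd (fst z))) has_derivative
      (\<lambda>h. frechet_derivative ?k (at ?z) (snd h - snd (fst h)))) (at (g, y))"
    using has_derivative_compose[OF d, of ?k "frechet_derivative ?k (at ?z)"] has_derivative_stream_kernel[OF z] by simp
  have T: "((\<lambda>z. Theta R z (gd, v)) has_derivative
      (\<lambda>h. area_form (snd gd) (frechet_derivative ?k (at ?z) (snd h - snd (fst h))))) (at (g, y))" for gd v
  proof (rule has_derivative_transform_within_open[OF _ o i])
    show "((\<lambda>z. area_form (snd gd) (?k (snd z - snd (fst z)))) has_derivative
      (\<lambda>h. area_form (snd gd) (frechet_derivative ?k (at ?z) (snd h - snd (fst h))))) (at (g, y))"
      using has_derivative_area_form[OF has_derivative_const k] by (simp add: area_form_simps)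
    fix z assume "z \<in> ?U"
    then have "snd z \<in> - ball (snd (fst z)) R" by (simp add: dist_norm norm_minus_commute)
    from Theta_eq[OF R this, of gd v]
    show "area_form (snd gd) (?k (snd z - snd (fst z))) = Theta R z (gd, v)" by (simp add: stream_disc_kernel)
  qed
  show ?thesis unfolding ext_deriv_def frechet_derivative_at[OF T, symmetric] by simp
qed

context fluid_family begin

text \<open>The connection is tangent to the boundary and Hamiltonian, and it decays; so the
  pairing with the momentum only sees its Hamiltonian at the vortices.\<close>

lemma momentum_form_eq:
  assumes "vortex_momentum R \<Gamma> xb \<alpha>"
  shows "momentum_form R \<alpha> (q p) (family_velocity q p h) = (\<Sum>i\<in>UNIV. \<Gamma> $ i * vortical_stream h p (xb $ i))"
proof -
  interpret vm: vortex_momentum R \<Gamma> xb \<alpha> by (rule assms)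
  have o: "open (- cball (0::real^2) R)" by auto
  obtain C where C: "\<And>x. x \<in> - ball 0 R \<Longrightarrow> \<bar>vortical_stream h p x\<bar> * norm x \<le> C"
    "\<And>x. x \<in> - ball 0 R \<Longrightarrow> norm (vortical_field h p x) * (norm x)\<^sup>2 \<le> C"
    using decay_vortical[of h p] by metis
  have "momentum_form R \<alpha> (q p) (family_velocity q p h) = (LINT x:fluid R|lborel. \<alpha> x \<bullet> vortical_field h p x)"
    unfolding momentum_form_def pairing_def
    by (rule set_lebesgue_integral_cong) (auto simp: fluid_def connection_eq_vortical_field[unfolded fluid_def])
  also have "\<dots> = (\<Sum>i\<in>UNIV. \<Gamma> $ i * vortical_stream h p (xb $ i))"
  proof (rule vm.green_exterior[where c = "vortical_stream h p (R *\<^sub>R axis 1 1)" and C = C])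
    show "smooth_on (- cball 0 R) (vortical_stream h p)"
      by (rule smooth_onI_deriv[OF o], erule vortical_stream_derivative, intro smooth_on_area_form smooth_vortical_field smooth_on_const o)
    show "vortical_stream h p x = vortical_stream h p (R *\<^sub>R axis 1 1)" if "x \<in> sphere 0 R" for x
      by (rule vortical_stream_const_boundary[OF that]) (use R in simp)
  qed (fact vortical_stream_derivative continuous_vortical_stream continuous_vortical_field C)+
  finally show ?thesis .
qed

text \<open>The function is the pull-back of \<open>Theta\<close> along
  \<open>p \<mapsto> (G p, P (p, x))\<close>. The exterior derivative commutes with
  pull-backs because the second derivatives of the motion of the body are symmetric.\<close>

lemma potential_stream_curl:
  assumes x: "x \<in> - cball 0 R"
  shows "(\<lambda>p. potential_stream h (p, x)) differentiable (at p)"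
    and "frechet_derivative (\<lambda>p. potential_stream h2 (p, x)) (at p) h1 - frechet_derivative (\<lambda>p. potential_stream h1 (p, x)) (at p) h2 =
      ext_deriv (Theta R) (G p, P (p, x)) (frechet_derivative G (at p) h1, V h1 (p, x)) (frechet_derivative G (at p) h2, V h2 (p, x))"
proof -
  have x': "x \<in> - ball 0 R" using x by auto
  have Gs: "smooth_on UNIV G" using fam by (simp add: smooth_family_def G_def[abs_def])
  \<comment> \<open>the acceleration of the centre\<close>
  define e2 where "e2 h a = snd (frechet_derivative (\<lambda>p. frechet_derivative G (at p) h) (at p) a)" for h a
  have e2: "e2 h a = e2 a h" for h a
    using iter_deriv_symmetric[OF open_UNIV Gs UNIV_I, where a = a and b = h and x = p] by (simp add: e2_def)
  have de: "(body_velocity h has_derivative e2 h) (at p)" for h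
    unfolding body_velocity_def[abs_def] e2_def
    by (rule has_derivative_snd[OF smooth_on_has_derivative[OF smooth_on_deriv[OF Gs] UNIV_I]])
  have dc: "((\<lambda>p. centre p) has_derivative (\<lambda>h. body_velocity h p)) (at p)"
    unfolding body_velocity_def by (rule has_derivative_snd[OF has_derivative_G])
  let ?k = "stream_kernel R" let ?z = "P (p, x) - centre p"
  let ?Dk = "frechet_derivative ?k (at ?z)"
  have z: "?z \<noteq> 0" using P_neq[OF x'] by simp
  have dk: "((\<lambda>p. ?k (P (p, x) - centre p)) has_derivative (\<lambda>h. ?Dk (V h (p, x) - body_velocity h p))) (at p)"
    by (rule has_derivative_compose[OF has_derivative_diff[OF P_partial[OF x'] dc] has_derivative_stream_kernel[OF z]])
  have D: "((\<lambda>p. potential_stream h (p, x)) has_derivative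
      (\<lambda>a. area_form (body_velocity h p) (?Dk (V a (p, x) - body_velocity a p)) + area_form (e2 h a) (?k ?z))) (at p)" for h
    unfolding potential_stream_def prod.case stream_disc_kernel by (rule has_derivative_area_form[OF de dk])
  show "(\<lambda>p. potential_stream h (p, x)) differentiable (at p)" using D differentiable_def by blast
  have y: "P (p, x) \<notin> cball (snd (G p)) R" using image_P(2)[OF x, of p] by simp
  show "frechet_derivative (\<lambda>p. potential_stream h2 (p, x)) (at p) h1 - frechet_derivative (\<lambda>p. potential_stream h1 (p, x)) (at p) h2 =
      ext_deriv (Theta R) (G p, P (p, x)) (frechet_derivative G (at p) h1, V h1 (p, x)) (frechet_derivative G (at p) h2, V h2 (p, x))"
    unfolding ext_deriv_Theta[OF R y] frechet_derivative_at[OF D, symmetric]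
    by (simp add: body_velocity_def e2[of h2 h1])
qed

lemma ext_deriv_momentum:
  assumes vm: "vortex_momentum R \<Gamma> xb \<alpha>"
  shows "ext_deriv (pullback q (momentum_form R \<alpha>)) p h1 h2 =
    (\<Sum>i\<in>UNIV. \<Gamma> $ i * (- area_form (V h1 (p, xb $ i)) (V h2 (p, xb $ i))
       - ext_deriv (Theta R) (G p, P (p, xb $ i)) (frechet_derivative G (at p) h1, V h1 (p, xb $ i))
           (frechet_derivative G (at p) h2, V h2 (p, xb $ i))))"
proof -
  have xb: "xb $ i \<in> - cball 0 R" for i using vm fluidR unfolding vortex_momentum_def by blast
  then have xb': "xb $ i \<in> - ball 0 R" for i using ball_subset_cball[of 0 R] by blast
  let ?B = "\<lambda>h i. frechet_derivative (\<lambda>p. flow_stream h (p, xb $ i)) (at p)"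
  let ?S = "\<lambda>h i. frechet_derivative (\<lambda>p. potential_stream h (p, xb $ i)) (at p)"
  have D: "((\<lambda>p. \<Sum>i\<in>UNIV. \<Gamma> $ i * vortical_stream h p (xb $ i)) has_derivative (\<lambda>a. \<Sum>i\<in>UNIV. \<Gamma> $ i * (?B h i a - ?S h i a))) (at p)" for h
    unfolding vortical_stream_def
  proof (intro has_derivative_sum has_derivative_mult_right has_derivative_diff)
    fix i
    show "((\<lambda>p. flow_stream h (p, xb $ i)) has_derivative ?B h i) (at p)"
      using flow_stream_derivative_p(1)[OF xb'] frechet_derivative_works differentiable_def by blast
    show "((\<lambda>p. potential_stream h (p, xb $ i)) has_derivative ?S h i) (at p)"
      using potential_stream_curl(1)[OF xb] frechet_derivative_works by blast
  qed
  have e: "(\<lambda>p. pullback q (momentum_form R \<alpha>) p h) = (\<lambda>p. \<Sum>i\<in>UNIV. \<Gamma> $ i * vortical_stream h p (xb $ i))" for h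
    by (simp add: pullback_def momentum_form_eq[OF vm])
  have "ext_deriv (pullback q (momentum_form R \<alpha>)) p h1 h2 =
      (\<Sum>i\<in>UNIV. \<Gamma> $ i * (?B h2 i h1 - ?S h2 i h1)) - (\<Sum>i\<in>UNIV. \<Gamma> $ i * (?B h1 i h2 - ?S h1 i h2))"
    unfolding ext_deriv_def e frechet_derivative_at[OF D, symmetric] ..
  also have "\<dots> = (\<Sum>i\<in>UNIV. \<Gamma> $ i * ((?B h2 i h1 - ?B h1 i h2) - (?S h2 i h1 - ?S h1 i h2)))"
    by (simp add: sum_subtractf[symmetric] algebra_simps)
  finally show ?thesis unfolding flow_stream_curl[OF xb'] potential_stream_curl(2)[OF xb] .
qed

end

lemma has_derivative_vec_lambda:
  fixes f :: "'a::real_normed_vector \<Rightarrow> 'n::finite \<Rightarrow> 'b::euclidean_space"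
  assumes "\<And>i. ((\<lambda>x. f x i) has_derivative (\<lambda>h. f' h i)) F"
  shows "((\<lambda>x. \<chi> i. f x i) has_derivative (\<lambda>h. \<chi> i. f' h i)) F"
proof -
  have e: "(\<chi> i. g i) = (\<Sum>i\<in>UNIV. axis i (g i))" for g :: "'n \<Rightarrow> 'b"
    by (simp add: vec_eq_iff axis_def if_distrib cong: if_cong)
  have l: "bounded_linear (axis i :: 'b \<Rightarrow> 'b^'n)" for i
    unfolding linear_conv_bounded_linear[symmetric] by (rule linearI) (auto simp: vec_eq_iff axis_def)
  show ?thesis unfolding e by (intro has_derivative_sum bounded_linear.has_derivative[OF l] assms)
qed

text \<open>A lift has the prescribed positions and velocities of the vortices and of the body at
  the origin of the parameter plane, and nothing else enters the differential of the momentum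
  one-form.\<close>

lemma lifts_value:
  fixes \<Gamma> :: "real^'n"
  assumes vm: "vortex_momentum R \<Gamma> xb \<alpha>" and q: "q \<in> lifts R xb (x, g) (v, gd1) (w, gd2)"
  shows "ext_deriv (pullback q (momentum_form R \<alpha>)) 0 (1, 0) (0, 1) =
    (\<Sum>i\<in>UNIV. \<Gamma> $ i *
       (- area_form (v $ i) (w $ i) - ext_deriv (Theta R) (g, x $ i) (gd1, v $ i) (gd2, w $ i)))"
proof -
  have R: "R > 0" using vm unfolding vortex_momentum_def by blast
  have q': "smooth_family R q" "vortex_proj xb (q 0) = (x, g)"
    "frechet_derivative (\<lambda>p. vortex_proj xb (q p)) (at 0) (1, 0) = (v, gd1)"
    "frechet_derivative (\<lambda>p. vortex_proj xb (q p)) (at 0) (0, 1) = (w, gd2)"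
    using q unfolding lifts_def by auto
  interpret fluid_family R q using R q'(1) by unfold_locales
  have xb: "xb $ i \<in> - cball 0 R" for i using vm fluidR unfolding vortex_momentum_def by blast
  then have xb': "xb $ i \<in> - ball 0 R" for i using ball_subset_cball[of 0 R] by blast
  have proj: "vortex_proj xb (q p) = (\<chi> i. P (p, xb $ i), G p)" for p
    by (simp add: vortex_proj_def P_def G_def)
  have H: "((\<lambda>p. vortex_proj xb (q p)) has_derivative (\<lambda>h. (\<chi> i. V h (0, xb $ i), frechet_derivative G (at 0) h))) (at 0)"
    unfolding proj by (intro has_derivative_Pair has_derivative_vec_lambda P_partial[OF xb'] has_derivative_G)
  have d: "(\<chi> i. V (1, 0) (0, xb $ i), frechet_derivative G (at 0) (1, 0)) = (v, gd1)"
    "(\<chi> i. V (0, 1) (0, xb $ i), frechet_derivative G (at 0) (0, 1)) = (w, gd2)"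
    using q'(3,4) unfolding frechet_derivative_at[OF H, symmetric] by simp_all
  have "V (1, 0) (0, xb $ i) = v $ i" "V (0, 1) (0, xb $ i) = w $ i" "P (0, xb $ i) = x $ i" for i
    using d q'(2) unfolding proj by (auto simp: vec_eq_iff)
  moreover have "frechet_derivative G (at 0) (1, 0) = gd1" "frechet_derivative G (at 0) (0, 1) = gd2" "G 0 = g"
    using d q'(2) unfolding proj by auto
  ultimately show ?thesis unfolding ext_deriv_momentum[OF vm] by simp
qed

theorem theorem4p5:
  fixes R :: real and \<Gamma> :: "real^'n" and xb :: "(real^2)^'n" and \<alpha> :: "real^2 \<Rightarrow> real^2"
    and x v w :: "(real^2)^'n" and g gd1 gd2 :: se2
  assumes "R > 0"
    and "inj (($) xb)" and "\<And>i. xb $ i \<in> interior (fluid R)"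
    and "represents_momentum R \<Gamma> xb \<alpha>"
    and "(x, g) \<in> configurations R"
  shows "magnetic_form R xb \<alpha> (x, g) (v, gd1) (w, gd2) =
    (\<Sum>i\<in>UNIV. \<Gamma> $ i *
       (- area_form (v $ i) (w $ i) - ext_deriv (Theta R) (g, x $ i) (gd1, v $ i) (gd2, w $ i)))"
proof -
  have vm: "vortex_momentum R \<Gamma> xb \<alpha>" using assms by unfold_locales
  have "xb $ i \<notin> cball 0 R" for i
    using assms(3)[of i] unfolding fluid_eq[OF assms(1)] interior_exterior[OF assms(1)] by simp
  then obtain q where q: "q \<in> lifts R xb (x, g) (v, gd1) (w, gd2)"
    using lifts_nonempty[OF assms(1,2) _ assms(5), of v gd1 w gd2] by blast
  show ?thesis unfolding magnetic_form_def
    by (rule the_equality) (use lifts_value[OF vm] q in auto)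
qed

end
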